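(* Let $f:(0,\infty)\to\mathbb R$ be operator convex, given in its integral representation $$f(t)=a+b(t-1)+c(t-1)^2+d\,\frac{(t-1)^2}{t}+\int_{(0,\infty)}\frac{(t-1)^2}{t+\lambda}\,d\mu(\lambda),\qquad t\in(0,\infty),$$ where $a,b\in\mathbb R$, $c,d\ge0$ and $\mu$ is a positive measure on $(0,\infty)$ with $\int_{(0,\infty)}(1+\lambda)^{-1}\,d\mu(\lambda)<\infty$. Let $a_0:=b-2c+d$ and $b_0:=a-b+c-2d$. Then for every Hilbert space $\mathcal H$, every $A,B\in B(\mathcal H)_+$ and every $\rho\in B(\mathcal H)_*^+$, $$\phi_f(A,B)(\rho)=a_0\rho(A)+b_0\rho(B)+c\,\phi_{t^2}(A,B)(\rho)+d\,\phi_{t^2}(B,A)(\rho)+\int_{(0,\infty)}\Bigl[\rho(A)+\frac1\lambda\,\rho(B)-\Bigl(\frac{1+\lambda}{\lambda}\Bigr)^2\rho(A:(\lambda B))\Bigr]\,d\mu(\lambda),$$ where $\phi_f$ and $\phi_{t^2}$ denote the extended operator perspectives associated with $f$ and with the function $t\mapsto t^2$.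
   Context: $B(\mathcal H)_+$ is the set of positive bounded operators on $\mathcal H$. $B(\mathcal H)_*^+$ is the set of positive normal functionals on $B(\mathcal H)$ (i.e. $X\mapsto\mathrm{Tr}(X\rho)$ with $\rho$ positive trace-class). Convention $0\cdot\infty=0$. Every operator convex $f:(0,\infty)\to\mathbb R$ has a unique representation of the displayed form. Extended operator perspective: for operator convex $f:(0,\infty)\to\mathbb R$ put $f'(\infty):=\lim_{t\to\infty}f(t)/t$ and $f(0^+):=\lim_{t\searrow0}f(t)$, in $(-\infty,\infty]$, and $\phi_f(x,y):=yf(x/y)$ for $x,y>0$, $\phi_f(x,0):=f'(\infty)x$ for $x\ge0$, $\phi_f(0,y):=f(0^+)y$ for $y\ge0$. For $A,B\in B(\mathcal H)_+$ put $\mathcal H_{A,B}:=\overline{\mathrm{ran}}(A+B)$ and $T_{A,B}:\mathcal H\to\mathcal H_{A,B}$, $T_{A,B}\xi:=(A+B)^{1/2}\xi$. There are unique positive contractions $R_{A,B},S_{A,B}$ on $\mathcal H_{A,B}$ with $R_{A,B}+S_{A,B}=I$, $A=T_{A,B}^*R_{A,B}T_{A,B}$, $B=T_{A,B}^*S_{A,B}T_{A,B}$. Then $\phi_f(A,B):B(\mathcal H)_*^+\to(-\infty,\infty]$ is defined by $\phi_f(A,B)(\rho):=\int_{[0,1]}\phi_f(r,1-r)\,d\rho(T_{A,B}^*E_{R_{A,B}}(r)T_{A,B})$, with $E_{R_{A,B}}$ the spectral measure of $R_{A,B}$. Parallel sum: $A:B:=\lim_{\varepsilon\searrow0}((A+\varepsilon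 I)^{-1}+(B+\varepsilon I)^{-1})^{-1}$ in the strong operator topology, for $A,B\in B(\mathcal H)_+$. *)

theory Defs
  imports
    "HOL-Analysis.Analysis"
    "HOL-Library.Complex_Order"
    "Jordan_Normal_Form.Schur_Decomposition"
begin

section \<open>Complex Hilbert spaces and bounded operators\<close>

text \<open>The inner product \<open>cinner\<close> is conjugate linear in its first argument.
  Its real part is the library's \<^const>\<open>inner\<close>, so the norm is the one of \<^class>\<open>real_inner\<close>;
  positive definiteness and completeness are inherited from \<^class>\<open>real_inner\<close> and
  \<^class>\<open>banach\<close>. No bound on the dimension is imposed.\<close>

class complex_hilbert_space = real_inner + banach +
  fixes scaleC :: "complex \<Rightarrow> 'a \<Rightarrow> 'a"
    and cinner :: "'a \<Rightarrow> 'a \<Rightarrow> complex"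
  assumes scaleC_add_right: "scaleC u (x + y) = scaleC u x + scaleC u y"
    and scaleC_add_left: "scaleC (u + v) x = scaleC u x + scaleC v x"
    and scaleC_scaleC: "scaleC u (scaleC v x) = scaleC (u * v) x"
    and scaleC_of_real: "scaleC (complex_of_real r) x = scaleR r x"
    and cinner_commute: "cinner x y = cnj (cinner y x)"
    and cinner_add_right: "cinner x (y + z) = cinner x y + cinner x z"
    and cinner_scaleC_right: "cinner x (scaleC u y) = u * cinner x y"
    and inner_eq_Re_cinner: "inner x y = Re (cinner x y)"

definition bounded_op :: "('a::complex_hilbert_space \<Rightarrow> 'a) \<Rightarrow> bool" where
  "bounded_op X \<longleftrightarrow> bounded_linear X \<and> (\<forall>z x. X (scaleC z x) = scaleC z (X x))"

text \<open>Here \<open>0 \<le> z\<close> for complex \<open>z\<close> says that \<open>z\<close> is real and nonnegative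
  (\<^theory>\<open>HOL-Library.Complex_Order\<close>).\<close>

definition positive_op :: "('a::complex_hilbert_space \<Rightarrow> 'a) \<Rightarrow> bool" where
  "positive_op X \<longleftrightarrow> bounded_op X \<and> (\<forall>x. 0 \<le> cinner x (X x))"

definition adj :: "('a::complex_hilbert_space \<Rightarrow> 'a) \<Rightarrow> 'a \<Rightarrow> 'a" where
  "adj X = (THE Y. bounded_op Y \<and> (\<forall>x y. cinner (X x) y = cinner x (Y y)))"

definition sqrt_op :: "('a::complex_hilbert_space \<Rightarrow> 'a) \<Rightarrow> 'a \<Rightarrow> 'a" where
  "sqrt_op X = (THE Y. positive_op Y \<and> Y \<circ> Y = X)"

text \<open>An operator on a closed subspace \<open>M\<close> is represented by its extension by \<open>0\<close> on the
  orthogonal complement of \<open>M\<close>.\<close>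

definition op_on :: "'a::complex_hilbert_space set \<Rightarrow> ('a \<Rightarrow> 'a) \<Rightarrow> bool" where
  "op_on M X \<longleftrightarrow> bounded_op X \<and> range X \<subseteq> M \<and>
     (\<forall>x. (\<forall>y\<in>M. cinner y x = 0) \<longrightarrow> X x = 0)"

definition positive_contraction_on :: "'a::complex_hilbert_space set \<Rightarrow> ('a \<Rightarrow> 'a) \<Rightarrow> bool" where
  "positive_contraction_on M X \<longleftrightarrow> op_on M X \<and> (\<forall>x\<in>M. 0 \<le> cinner x (X x) \<and> norm (X x) \<le> norm x)"


section \<open>Positive normal functionals\<close>

text \<open>An orthonormal basis is a maximal orthonormal set; \<open>the_onb\<close> is an arbitrary one. Neither
  the trace of a trace-class operator nor the trace-class property of a positive operator depends
  on the choice.\<close>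

definition is_onb :: "'a::complex_hilbert_space set \<Rightarrow> bool" where
  "is_onb B \<longleftrightarrow> (\<forall>e\<in>B. norm e = 1) \<and> (\<forall>e\<in>B. \<forall>e'\<in>B. e \<noteq> e' \<longrightarrow> cinner e e' = 0) \<and>
     (\<forall>x. (\<forall>e\<in>B. cinner e x = 0) \<longrightarrow> x = 0)"

definition the_onb :: "'a::complex_hilbert_space set" where
  "the_onb = (SOME B. is_onb B)"

definition trace_op :: "('a::complex_hilbert_space \<Rightarrow> 'a) \<Rightarrow> complex" where
  "trace_op X = infsum (\<lambda>e. cinner e (X e)) the_onb"

definition positive_trace_class :: "('a::complex_hilbert_space \<Rightarrow> 'a) \<Rightarrow> bool" where
  "positive_trace_class D \<longleftrightarrow> positive_op D \<and> (\<lambda>e. cinner e (D e)) summable_on the_onb"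

text \<open>Functionals on the bounded operators are total functions whose values outside the
  bounded operators are irrelevant.\<close>

definition positive_normal :: "(('a::complex_hilbert_space \<Rightarrow> 'a) \<Rightarrow> complex) \<Rightarrow> bool" where
  "positive_normal \<rho> \<longleftrightarrow>
     (\<exists>D. positive_trace_class D \<and> (\<forall>X. bounded_op X \<longrightarrow> \<rho> X = trace_op (X \<circ> D)))"


section \<open>Spectral measures\<close>

text \<open>For a positive operator valued measure \<open>E\<close> on the Borel sets of the line, the scalar
  measures \<open>N \<mapsto> \<langle>x, E N x\<rangle>\<close> and \<open>N \<mapsto> \<rho> (T\<^sup>* (E N) T)\<close>; the complex values occurring here are
  nonnegative reals.\<close>

definition vector_measure :: "(real set \<Rightarrow> 'a \<Rightarrow> 'a) \<Rightarrow> 'a::complex_hilbert_space \<Rightarrow> real measure" where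
  "vector_measure E x = measure_of UNIV (sets borel) (\<lambda>N. ennreal (Re (cinner x (E N x))))"

definition functional_measure ::
  "(('a::complex_hilbert_space \<Rightarrow> 'a) \<Rightarrow> complex) \<Rightarrow> ('a \<Rightarrow> 'a) \<Rightarrow> (real set \<Rightarrow> 'a \<Rightarrow> 'a) \<Rightarrow> real measure" where
  "functional_measure \<rho> T E = measure_of UNIV (sets borel) (\<lambda>N. ennreal (Re (\<rho> (adj T \<circ> E N \<circ> T))))"

text \<open>\<open>E\<close> is the projection valued measure on \<open>M\<close> with \<open>R = \<integral>r dE(r)\<close>.\<close>

definition is_spectral_measure ::
  "'a::complex_hilbert_space set \<Rightarrow> ('a \<Rightarrow> 'a) \<Rightarrow> (real set \<Rightarrow> 'a \<Rightarrow> 'a) \<Rightarrow> bool" where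
  "is_spectral_measure M R E \<longleftrightarrow>
     (\<forall>N\<in>sets borel. op_on M (E N) \<and> positive_op (E N) \<and> E N \<circ> E N = E N) \<and>
     (\<forall>x\<in>M. E UNIV x = x) \<and>
     (\<forall>F. range F \<subseteq> sets borel \<and> disjoint_family F \<longrightarrow>
        (\<forall>x. (\<lambda>i::nat. E (F i) x) sums E (\<Union>i. F i) x)) \<and>
     (\<forall>x\<in>M. integrable (vector_measure E x) (\<lambda>r. r) \<and>
        cinner x (R x) = complex_of_real (\<integral>r. r \<partial>vector_measure E x))"

text \<open>\<open>E\<close> is determined by \<open>R\<close> on the Borel sets, the only sets on which its values matter.\<close>

definition spectral_measure ::
  "'a::complex_hilbert_space set \<Rightarrow> ('a \<Rightarrow> 'a) \<Rightarrow> real set \<Rightarrow> 'a \<Rightarrow> 'a" where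
  "spectral_measure M R = (SOME E. is_spectral_measure M R E)"


section \<open>Operator convex functions\<close>

text \<open>Operator convexity is convexity with respect to the order of Hermitian matrices of every
  size \<open>n\<close>, equivalently of bounded self-adjoint operators on all Hilbert spaces, on
  matrices with spectrum in the domain \<open>(0,\<infinity>)\<close>. A complex matrix with real
  quadratic form is Hermitian.\<close>

definition pos_semidef_mat :: "nat \<Rightarrow> complex mat \<Rightarrow> bool" where
  "pos_semidef_mat n X \<longleftrightarrow> X \<in> carrier_mat n n \<and> (\<forall>v\<in>carrier_vec n. 0 \<le> (X *\<^sub>v v) \<bullet>c v)"

definition pos_def_mat :: "nat \<Rightarrow> complex mat \<Rightarrow> bool" where
  "pos_def_mat n X \<longleftrightarrow> X \<in> carrier_mat n n \<and> (\<forall>v\<in>carrier_vec n. v \<noteq> 0\<^sub>v n \<longrightarrow> 0 < (X *\<^sub>v v) \<bullet>c v)"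

definition unitary_diag :: "nat \<Rightarrow> complex mat \<Rightarrow> (nat \<Rightarrow> real) \<Rightarrow> complex mat" where
  "unitary_diag n U g = U * mat_diag n (\<lambda>i. complex_of_real (g i)) * mat_adjoint U"

definition mat_fun :: "nat \<Rightarrow> (real \<Rightarrow> real) \<Rightarrow> complex mat \<Rightarrow> complex mat" where
  "mat_fun n f X = (THE Y. \<exists>U g. U \<in> carrier_mat n n \<and>
     U * mat_adjoint U = 1\<^sub>m n \<and> mat_adjoint U * U = 1\<^sub>m n \<and>
     X = unitary_diag n U g \<and> Y = unitary_diag n U (f \<circ> g))"

definition operator_convex :: "(real \<Rightarrow> real) \<Rightarrow> bool" where
  "operator_convex f \<longleftrightarrow> (\<forall>n X Y s. pos_def_mat n X \<longrightarrow> pos_def_mat n Y \<longrightarrow> 0 \<le> s \<longrightarrow> s \<le> 1 \<longrightarrow>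
     pos_semidef_mat n
       (complex_of_real s \<cdot>\<^sub>m mat_fun n f X + complex_of_real (1 - s) \<cdot>\<^sub>m mat_fun n f Y
        - mat_fun n f (complex_of_real s \<cdot>\<^sub>m X + complex_of_real (1 - s) \<cdot>\<^sub>m Y)))"


section \<open>The extended operator perspective\<close>

text \<open>The integral of an extended-real function whose negative part has a finite
  integral. In \<^typ>\<open>ereal\<close>, \<open>0 * \<infinity> = 0\<close>.\<close>

definition ereal_integral :: "'b measure \<Rightarrow> ('b \<Rightarrow> ereal) \<Rightarrow> ereal" where
  "ereal_integral M g =
     enn2ereal (\<integral>\<^sup>+x. e2ennreal (g x) \<partial>M) - enn2ereal (\<integral>\<^sup>+x. e2ennreal (- g x) \<partial>M)"

definition slope_at_infinity :: "(real \<Rightarrow> real) \<Rightarrow> ereal" where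
  "slope_at_infinity f = Lim at_top (\<lambda>t. ereal (f t / t))"

definition value_at_0 :: "(real \<Rightarrow> real) \<Rightarrow> ereal" where
  "value_at_0 f = Lim (at_right 0) (\<lambda>t. ereal (f t))"

text \<open>Only arguments \<open>x, y \<ge> 0\<close> are relevant.\<close>

definition persp :: "(real \<Rightarrow> real) \<Rightarrow> real \<Rightarrow> real \<Rightarrow> ereal" where
  "persp f x y =
     (if y = 0 then slope_at_infinity f * ereal x
      else if x = 0 then value_at_0 f * ereal y
      else ereal (y * f (x / y)))"

definition H_sp :: "('a::complex_hilbert_space \<Rightarrow> 'a) \<Rightarrow> ('a \<Rightarrow> 'a) \<Rightarrow> 'a set" where
  "H_sp A B = closure (range (\<lambda>x. A x + B x))"

text \<open>As a map into \<open>H_sp A B\<close>, \<open>T_op A B\<close> is considered here with codomain the whole space. Its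
  adjoint vanishes on the orthogonal complement of \<open>H_sp A B\<close>, so it agrees with the extension by
  \<open>0\<close> of the adjoint of the map into \<open>H_sp A B\<close>.\<close>

definition T_op :: "('a::complex_hilbert_space \<Rightarrow> 'a) \<Rightarrow> ('a \<Rightarrow> 'a) \<Rightarrow> 'a \<Rightarrow> 'a" where
  "T_op A B = sqrt_op (\<lambda>x. A x + B x)"

definition R_op :: "('a::complex_hilbert_space \<Rightarrow> 'a) \<Rightarrow> ('a \<Rightarrow> 'a) \<Rightarrow> 'a \<Rightarrow> 'a" where
  "R_op A B = (THE R. \<exists>S. positive_contraction_on (H_sp A B) R \<and> positive_contraction_on (H_sp A B) S \<and>
     (\<forall>x\<in>H_sp A B. R x + S x = x) \<and>
     A = adj (T_op A B) \<circ> R \<circ> T_op A B \<and>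
     B = adj (T_op A B) \<circ> S \<circ> T_op A B)"

definition op_persp :: "(real \<Rightarrow> real) \<Rightarrow> ('a::complex_hilbert_space \<Rightarrow> 'a) \<Rightarrow> ('a \<Rightarrow> 'a) \<Rightarrow>
    (('a \<Rightarrow> 'a) \<Rightarrow> complex) \<Rightarrow> ereal" where
  "op_persp f A B \<rho> =
     ereal_integral
       (restrict_space
         (functional_measure \<rho> (T_op A B) (spectral_measure (H_sp A B) (R_op A B))) {0..1})
       (\<lambda>r. persp f r (1 - r))"


section \<open>The parallel sum\<close>

text \<open>The limit is pointwise, i.e. in the strong operator topology; \<open>inv_into UNIV\<close> is the inverse of
  a bijective operator.\<close>

definition parallel_sum :: "('a::complex_hilbert_space \<Rightarrow> 'a) \<Rightarrow> ('a \<Rightarrow> 'a) \<Rightarrow> 'a \<Rightarrow> 'a" where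
  "parallel_sum A B = (\<lambda>x. Lim (at_right 0) (\<lambda>\<epsilon>.
     inv_into UNIV (\<lambda>y. inv_into UNIV (\<lambda>z. A z + \<epsilon> *\<^sub>R z) y
                    + inv_into UNIV (\<lambda>z. B z + \<epsilon> *\<^sub>R z) y) x))"

end

theory Submission
  imports Defs "HOL-Probability.Distribution_Functions"
begin

text \<open>
  Write \<open>A = T R T\<close> and \<open>B = T (1 - R) T\<close>. With the spectral measure \<open>E\<close> of \<open>R\<close>, the functional \<open>\<rho>\<close> becomes
  a finite measure \<open>N\<close> on \<open>[0,1]\<close>, for which \<open>\<rho>(A)\<close>, \<open>\<rho>(B)\<close> and \<open>\<rho>(A : (l B))\<close> are the integrals of
  \<open>r\<close>, \<open>1 - r\<close> and \<open>l r (1 - r) / (r + l (1 - r))\<close>. The last one holds because \<open>\<langle>x, (A : (l B)) x\<rangle>\<close> is the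
  infimum over \<open>y\<close> of \<open>\<langle>y, A y\<rangle> + l \<langle>x - y, B (x - y)\<rangle>\<close>, an infimum that is computed explicitly after
  the substitution \<open>v = T y\<close>. The theorem is then the scalar identity
  \<open>r + (1 - r) / l - ((1 + l) / l)\<^sup>2 l r (1 - r) / (r + l (1 - r)) = (2 r - 1)\<^sup>2 / (r + l (1 - r))\<close>
  integrated with respect to \<open>N\<close> and \<open>\<mu>\<close>. The term with \<open>B, A\<close> exchanged is reached without comparing
  the two spectral measures: the perspective of \<open>t\<^sup>2\<close> is an increasing limit of combinations of
  parallel sums, and these are symmetric in the two operators.
\<close>

section \<open>Operators on a complex Hilbert space\<close>

text \<open>The operator of the pair \<open>B\<close>, \<open>A\<close> is the complement of the one
  of \<open>A\<close>, \<open>B\<close>, but \<open>spectral_measure\<close> is a choice, so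
  transporting one measure to the other would need uniqueness of spectral measures. This is the
  obstacle behind the detour through increasing approximants. Of the chosen measure only a few
  integrals are ever computed, and they come out the same for every spectral measure of
  \<open>R\<close>. Both sides of the theorem may be infinite. The integrand is therefore split into
  an affine function of \<open>r\<close>, which is integrable with either sign and carries the
  coefficients \<open>a0\<close> and \<open>b0\<close>, and a sum of nonnegative terms, for which
  additivity and the exchange of integrals hold in the extended range. Equations that would involve
  a difference are integrated in a rearranged form without subtraction. Complex scalars enter
  through the real inner product and the single operator \<open>iC\<close>, multiplication by the
  imaginary unit.\<close>

definition iC :: "'a::complex_hilbert_space \<Rightarrow> 'a" where
  "iC x = scaleC \<i> x"

lemma scaleC_eq: "scaleC z x = Re z *\<^sub>R x + Im z *\<^sub>R iC (x::'a::complex_hilbert_space)"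
proof -
  have "scaleC z x = scaleC (complex_of_real (Re z) + complex_of_real (Im z) * \<i>) x"
    by (metis complex_eq mult.commute)
  also have "\<dots> = Re z *\<^sub>R x + Im z *\<^sub>R iC x"
    by (simp add: scaleC_add_left scaleC_of_real scaleC_scaleC[symmetric] iC_def)
  finally show ?thesis .
qed

lemma iC_add: "iC (x + y) = iC x + iC (y::'a::complex_hilbert_space)"
  by (simp add: iC_def scaleC_add_right)

lemma iC_scaleR: "iC (r *\<^sub>R x) = r *\<^sub>R iC (x::'a::complex_hilbert_space)"
  by (simp add: iC_def scaleC_of_real[symmetric] scaleC_scaleC mult.commute)

lemma iC_iC [simp]: "iC (iC x) = - (x::'a::complex_hilbert_space)"
proof -
  have "iC (iC x) = scaleC (complex_of_real (-1)) x"
    by (simp add: iC_def scaleC_scaleC)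
  thus ?thesis by (simp only: scaleC_of_real) simp
qed

lemma Im_cinner: "Im (cinner x y) = - inner x (iC (y::'a::complex_hilbert_space))"
  by (simp add: iC_def inner_eq_Re_cinner cinner_scaleC_right)

lemma cinner_eq: "cinner x y = Complex (inner x y) (- inner x (iC (y::'a::complex_hilbert_space)))"
  by (simp add: complex_eq_iff Im_cinner inner_eq_Re_cinner)

lemma inner_iC_left: "inner (iC x) y = - inner x (iC (y::'a::complex_hilbert_space))"
proof -
  have "inner (iC x) y = - Im (cinner y x)"
    by (simp add: inner_commute Im_cinner)
  also have "\<dots> = Im (cinner x y)"
    by (subst cinner_commute) simp
  finally show ?thesis by (simp add: Im_cinner)
qed

lemma inner_iC_iC [simp]: "inner (iC x) (iC y) = inner x (y::'a::complex_hilbert_space)"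
  by (simp add: inner_iC_left)

lemma norm_iC [simp]: "norm (iC (x::'a::complex_hilbert_space)) = norm x"
  by (simp add: norm_eq_sqrt_inner)

lemma bounded_linear_iC: "bounded_linear (iC :: 'a::complex_hilbert_space \<Rightarrow> 'a)"
  by (rule bounded_linear_intro[where K=1]) (auto simp: iC_add iC_scaleR)

lemma iC_diff: "iC (x - y) = iC x - iC (y::'a::complex_hilbert_space)"
  and iC_zero [simp]: "iC (0::'a) = 0"
  using linear_diff[OF bounded_linear_iC[THEN bounded_linear.linear]]
    linear_0[OF bounded_linear_iC[THEN bounded_linear.linear]]
  by auto

lemma inner_iC_self [simp]: "inner x (iC (x::'a::complex_hilbert_space)) = 0"
  using inner_iC_left[of x x] by (simp add: inner_commute)

lemma cinner_self: "cinner x x = complex_of_real ((norm (x::'a::complex_hilbert_space))\<^sup>2)"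
  by (simp add: cinner_eq complex_eq_iff power2_norm_eq_inner)

lemma cinner_zero_right [simp]: "cinner x (0::'a::complex_hilbert_space) = 0"
  by (simp add: cinner_eq complex_eq_iff)

lemma cinner_diff_right: "cinner x (y - z) = cinner x y - cinner x (z::'a::complex_hilbert_space)"
  and cinner_sum_right: "cinner x (sum f F) = (\<Sum>e\<in>F. cinner x (f e :: 'a))"
proof -
  show "cinner x (y - z) = cinner x y - cinner x z"
    by (simp add: cinner_eq complex_eq_iff iC_diff inner_diff_right)
  show "cinner x (sum f F) = (\<Sum>e\<in>F. cinner x (f e))"
    by (induction F rule: infinite_finite_induct) (auto simp: cinner_add_right)
qed

lemma cinner_scaleC_left: "cinner (scaleC u x) y = cnj u * cinner x (y::'a::complex_hilbert_space)"
  by (subst cinner_commute, subst cinner_scaleC_right, subst cinner_commute) simp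

lemma norm_scaleC: "norm (scaleC u (x::'a::complex_hilbert_space)) = cmod u * norm x"
proof -
  have "complex_of_real ((norm (scaleC u x))\<^sup>2) = cnj u * u * complex_of_real ((norm x)\<^sup>2)"
    by (simp only: cinner_self[symmetric] cinner_scaleC_left cinner_scaleC_right) simp
  also have "\<dots> = complex_of_real ((cmod u * norm x)\<^sup>2)"
    by (simp add: power_mult_distrib mult.commute complex_norm_square[symmetric])
  finally have "(norm (scaleC u x))\<^sup>2 = (cmod u * norm x)\<^sup>2"
    by (simp only: of_real_eq_iff)
  thus ?thesis by (simp add: power2_eq_iff_nonneg)
qed

text \<open>Rotating \<open>y\<close> by the phase \<open>u\<close> makes the product real and
  nonnegative, which reduces the claim to the real Cauchy-Schwarz inequality.\<close>

lemma cmod_cinner_le: "cmod (cinner x y) \<le> norm x * norm (y::'a::complex_hilbert_space)"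
proof (cases "cinner x y = 0")
  case False
  define u where "u = cnj (cinner x y) / complex_of_real (cmod (cinner x y))"
  have u: "cmod u = 1" using False by (simp add: u_def norm_divide)
  have "u * cinner x y = complex_of_real (cmod (cinner x y))"
    using False by (simp add: u_def field_simps complex_norm_square[symmetric] power2_eq_square)
  hence "cmod (cinner x y) = inner x (scaleC u y)"
    by (simp add: inner_eq_Re_cinner cinner_scaleC_right)
  also have "\<dots> \<le> norm x * norm (scaleC u y)"
    by (rule norm_cauchy_schwarz)
  finally show ?thesis by (simp add: norm_scaleC u)
qed simp

text \<open>Complex homogeneity is real homogeneity, already part of \<open>bounded_linear\<close>,
  plus commutation with \<open>iC\<close>. Operators can thus be handled in the real theory with one
  extra equation to check.\<close>

lemma bounded_op_iff: "bounded_op X \<longleftrightarrow> bounded_linear X \<and> (\<forall>x. X (iC x) = iC (X x))"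
proof
  assume "bounded_linear X \<and> (\<forall>x. X (iC x) = iC (X x))"
  thus "bounded_op X"
    by (auto simp: bounded_op_def scaleC_eq bounded_linear.linear linear_add linear_scale)
qed (auto simp: bounded_op_def iC_def)

lemma bounded_op_linear: "bounded_op X \<Longrightarrow> linear X"
  by (auto simp: bounded_op_iff bounded_linear.linear)

lemma bounded_op_iC: "bounded_op X \<Longrightarrow> X (iC x) = iC (X x)"
  by (auto simp: bounded_op_iff)

lemma bounded_op_add: "bounded_op X \<Longrightarrow> X (x + y) = X x + X y"
  and bounded_op_diff: "bounded_op X \<Longrightarrow> X (x - y) = X x - X y"
  and bounded_op_minus: "bounded_op X \<Longrightarrow> X (- x) = - X x"
  and bounded_op_scaleR: "bounded_op X \<Longrightarrow> X (r *\<^sub>R x) = r *\<^sub>R X x"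
  and bounded_op_0: "bounded_op X \<Longrightarrow> X 0 = 0"
  and bounded_op_sum: "bounded_op X \<Longrightarrow> X (sum f F) = (\<Sum>i\<in>F. X (f i))"
  using linear_add[of X x y] linear_diff[of X x y] linear_neg[of X x] linear_scale[of X r x]
    linear_0[of X] linear_sum[of X f F] by (auto dest!: bounded_op_linear)

lemmas op_simps = bounded_op_add bounded_op_diff bounded_op_scaleR bounded_op_0 bounded_op_minus

lemma bounded_op_bound: "bounded_op X \<Longrightarrow> \<exists>K>0. \<forall>x. norm (X x) \<le> K * norm x"
  using bounded_linear.pos_bounded[of X] unfolding bounded_op_iff by (metis mult.commute)

lemma bounded_op_isCont: "bounded_op X \<Longrightarrow> isCont X x"
  unfolding bounded_op_iff using bounded_linear.continuous[of X "at x" "\<lambda>x. x"] by auto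

lemma bounded_op_tendsto: "bounded_op X \<Longrightarrow> (f \<longlongrightarrow> l) F \<Longrightarrow> ((\<lambda>n. X (f n)) \<longlongrightarrow> X l) F"
  unfolding bounded_op_iff using bounded_linear.tendsto by blast

lemma bounded_op_compose: "bounded_op X \<Longrightarrow> bounded_op Y \<Longrightarrow> bounded_op (X \<circ> Y)"
  by (auto simp: bounded_op_iff o_def intro: bounded_linear_compose)

lemma bounded_op_comp: "bounded_op X \<Longrightarrow> bounded_op Y \<Longrightarrow> bounded_op (\<lambda>x. X (Y x))"
  by (auto simp: bounded_op_iff o_def intro: bounded_linear_compose)

lemma bounded_op_plus: "bounded_op X \<Longrightarrow> bounded_op Y \<Longrightarrow> bounded_op (\<lambda>x. X x + Y x)"
  by (auto simp: bounded_op_iff iC_add intro: bounded_linear_add)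

lemma bounded_op_sub: "bounded_op X \<Longrightarrow> bounded_op Y \<Longrightarrow> bounded_op (\<lambda>x. X x - Y x)"
  by (auto simp: bounded_op_iff iC_diff intro: bounded_linear_sub)

lemma bounded_op_scale: "bounded_op X \<Longrightarrow> bounded_op (\<lambda>x. r *\<^sub>R X x)"
  by (auto simp: bounded_op_iff iC_scaleR bounded_linear_const_scaleR)

lemma bounded_op_id: "bounded_op (\<lambda>x. x)"
  by (auto simp: bounded_op_iff)

lemma bounded_op_zero: "bounded_op (\<lambda>x. 0)"
  by (auto simp: bounded_op_iff)

lemmas bounded_op_intros = bounded_op_plus bounded_op_sub
  bounded_op_scale bounded_op_id bounded_op_zero

lemma bounded_opI:
  assumes "\<And>x y. X (x + y) = X x + X y" "\<And>r x. X (r *\<^sub>R x) = r *\<^sub>R X x" "\<And>x. X (iC x) = iC (X x)"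
    and "\<And>x. norm (X x) \<le> K * norm x"
  shows "bounded_op X"
  unfolding bounded_op_iff
  using assms by (auto intro!: bounded_linear_intro[where K=K] simp: mult.commute)

section \<open>Self-adjoint and positive operators\<close>

definition selfadj :: "('a::complex_hilbert_space \<Rightarrow> 'a) \<Rightarrow> bool" where
  "selfadj X \<longleftrightarrow> bounded_op X \<and> (\<forall>x y. inner (X x) y = inner x (X y))"

lemma selfadj_op: "selfadj X \<Longrightarrow> bounded_op X" by (simp add: selfadj_def)

lemma selfadj_inner: "selfadj X \<Longrightarrow> inner (X x) y = inner x (X y)" by (simp add: selfadj_def)

text \<open>The imaginary part of \<open>cinner\<close> is, up to sign, the real inner product
  against \<open>iC y\<close>, so commutation with \<open>iC\<close> upgrades real symmetry to
  complex symmetry.\<close>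

lemma selfadj_cinner: "selfadj X \<Longrightarrow> cinner (X x) y = cinner x (X y)"
  by (simp add: cinner_eq complex_eq_iff selfadj_inner bounded_op_iC[OF selfadj_op])

lemma selfadj_plus: "selfadj X \<Longrightarrow> selfadj Y \<Longrightarrow> selfadj (\<lambda>x. X x + Y x)"
  by (auto simp: selfadj_def bounded_op_intros inner_add_left inner_add_right)

lemma selfadj_sub: "selfadj X \<Longrightarrow> selfadj Y \<Longrightarrow> selfadj (\<lambda>x. X x - Y x)"
  by (auto simp: selfadj_def bounded_op_intros inner_diff_left inner_diff_right)

lemma selfadj_scale: "selfadj X \<Longrightarrow> selfadj (\<lambda>x. r *\<^sub>R X x)"
  by (auto simp: selfadj_def bounded_op_intros)

lemma selfadj_id: "selfadj (\<lambda>x. x)"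
  by (auto simp: selfadj_def bounded_op_intros)

lemma selfadj_zero: "selfadj (\<lambda>x. 0)"
  by (auto simp: selfadj_def bounded_op_intros)

lemma selfadj_comp: "selfadj X \<Longrightarrow> selfadj Y \<Longrightarrow> (\<And>x. X (Y x) = Y (X x)) \<Longrightarrow> selfadj (\<lambda>x. X (Y x))"
  by (auto simp: selfadj_def bounded_op_comp)

lemma selfadj_conj: "selfadj X \<Longrightarrow> selfadj Y \<Longrightarrow> selfadj (\<lambda>x. X (Y (X x)))"
  using bounded_op_comp[of X "\<lambda>x. Y (X x)"] bounded_op_comp[of Y X] by (auto simp: selfadj_def)

lemmas selfadj_intros = selfadj_plus selfadj_sub selfadj_scale selfadj_id selfadj_zero

text \<open>On a complex space a real form forces symmetry: its vanishing imaginary part, polarized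
  at \<open>iC u + v\<close>, is \<open>inner u (X v) - inner v (X u)\<close>. In the other
  direction symmetry makes the imaginary part equal to its own negative.\<close>

lemma positive_op_iff: "positive_op X \<longleftrightarrow> selfadj X \<and> (\<forall>x. 0 \<le> inner x (X x))"
proof
  assume X: "positive_op X"
  hence op: "bounded_op X" by (simp add: positive_op_def)
  have re: "0 \<le> inner x (X x)" and im: "inner x (iC (X x)) = 0" for x
    using X by (auto simp: positive_op_def cinner_eq less_eq_complex_def)
  have "inner (X u) v = inner u (X v)" for u v
  proof -
    have "iC (X (iC u + v)) = iC (X v) - X u"
      by (simp add: bounded_op_add[OF op] bounded_op_iC[OF op] iC_add)
    hence "inner (iC u + v) (iC (X (iC u + v))) = inner (iC u) (iC (X v)) - inner (iC u) (X u)
        + inner v (iC (X v)) - inner v (X u)"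
      by (simp add: inner_add_left inner_diff_right)
    hence "inner (iC u + v) (iC (X (iC u + v))) = inner u (X v) - inner v (X u)"
      using im[of u] im[of v] by (simp add: inner_iC_left[of u "X u"])
    thus ?thesis using im[of "iC u + v"] by (simp add: inner_commute)
  qed
  thus "selfadj X \<and> (\<forall>x. 0 \<le> inner x (X x))"
    using op re by (auto simp: selfadj_def)
next
  assume X: "selfadj X \<and> (\<forall>x. 0 \<le> inner x (X x))"
  have "inner x (iC (X x)) = 0" for x
  proof -
    have "inner x (iC (X x)) = inner (X x) (iC x)"
      using X by (simp add: selfadj_inner bounded_op_iC[OF selfadj_op])
    also have "\<dots> = - inner x (iC (X x))"
      by (simp add: inner_commute[of "X x"] inner_iC_left)
    finally show ?thesis by simp
  qed
  thus "positive_op X"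
    using X by (auto simp: positive_op_def selfadj_op cinner_eq less_eq_complex_def)
qed

lemma positive_selfadj: "positive_op X \<Longrightarrow> selfadj X"
  and positive_inner: "positive_op X \<Longrightarrow> 0 \<le> inner x (X x)"
  by (auto simp: positive_op_iff)

lemma positive_op_op: "positive_op X \<Longrightarrow> bounded_op X"
  by (simp add: positive_op_def)

lemma positive_opI: "selfadj X \<Longrightarrow> (\<And>x. 0 \<le> inner x (X x)) \<Longrightarrow> positive_op X"
  by (simp add: positive_op_iff)

lemma positive_plus: "positive_op X \<Longrightarrow> positive_op Y \<Longrightarrow> positive_op (\<lambda>x. X x + Y x)"
  by (auto simp: positive_op_iff selfadj_intros inner_add_right)

lemma positive_scale: "positive_op X \<Longrightarrow> 0 \<le> r \<Longrightarrow> positive_op (\<lambda>x. r *\<^sub>R X x)"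
  by (auto simp: positive_op_iff selfadj_intros)

lemma positive_conj: "selfadj X \<Longrightarrow> positive_op Y \<Longrightarrow> positive_op (\<lambda>x. X (Y (X x)))"
  by (auto simp: positive_op_iff selfadj_conj) (metis selfadj_inner)

lemma positive_square: "selfadj X \<Longrightarrow> positive_op (\<lambda>x. X (X x))"
  by (auto simp: positive_op_iff selfadj_comp) (metis selfadj_inner inner_ge_zero)

section \<open>Cauchy-Schwarz for the form of a positive operator\<close>

lemma positive_cauchy_schwarz:
  assumes X: "positive_op X"
  shows "(inner x (X y))\<^sup>2 \<le> inner x (X x) * inner y (X y)"
proof -
  define a b c where "a = inner x (X x)" and "b = inner x (X y)" and "c = inner y (X y)"
  have sym: "inner y (X x) = b"
    using X by (metis b_def inner_commute positive_selfadj selfadj_inner)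
  have q: "0 \<le> a + 2 * t * b + t\<^sup>2 * c" for t
  proof -
    have "0 \<le> inner (x + t *\<^sub>R y) (X (x + t *\<^sub>R y))"
      using X by (rule positive_inner)
    also have "\<dots> = a + 2 * t * b + t\<^sup>2 * c"
      using sym X by (simp add: op_simps positive_op_op inner_add_left inner_add_right
          a_def b_def c_def power2_eq_square algebra_simps)
    finally show ?thesis .
  qed
  have ac: "0 \<le> a" "0 \<le> c" using X by (auto simp: a_def c_def positive_inner)
  show ?thesis
  proof (cases "c = 0")
    case True
    have "b = 0"
    proof (rule ccontr)
      assume "b \<noteq> 0"
      \<comment> \<open>For \<open>c = 0\<close> the quadratic is affine in \<open>t\<close>; this
        \<open>t\<close> gives it the value -1.\<close>
      hence "2 * (- (a + 1) / (2 * b)) * b = - (a + 1)" by simp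
      thus False using q[of "- (a + 1) / (2 * b)"] True by simp
    qed
    thus ?thesis using ac by (simp add: a_def b_def c_def)
  next
    case False
    hence "0 < c" using ac by simp
    have "0 \<le> a - b\<^sup>2 / c"
      using q[of "- b / c"] False by (simp add: power2_eq_square field_simps)
    thus ?thesis using \<open>0 < c\<close> by (simp add: field_simps a_def b_def c_def)
  qed
qed

text \<open>Cauchy-Schwarz at the pair \<open>x\<close>, \<open>X x\<close>. It bounds the vector
  \<open>X x\<close> by the form, which is how vanishing or small forms are converted into vanishing
  or small vectors later on.\<close>

lemma positive_norm_sq:
  assumes X: "positive_op X" and K: "\<And>x. norm (X x) \<le> K * norm x"
  shows "(norm (X x))\<^sup>2 \<le> K * inner x (X x)"
proof (cases "X x = 0")
  case True
  thus ?thesis by simp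
next
  case False
  hence n: "0 < norm (X x)" by simp
  have K0: "0 \<le> K"
    using K[of x] n by (smt (verit) mult_nonneg_nonneg mult_nonpos_nonneg norm_ge_zero)
  have "(norm (X x))\<^sup>2 * (norm (X x))\<^sup>2 = (inner x (X (X x)))\<^sup>2"
    using X by (metis power2_eq_square power2_norm_eq_inner positive_selfadj selfadj_inner)
  also have "\<dots> \<le> inner x (X x) * inner (X x) (X (X x))"
    by (rule positive_cauchy_schwarz[OF X])
  also have "\<dots> \<le> inner x (X x) * (norm (X x) * (K * norm (X x)))"
    using positive_inner[OF X] by (intro mult_left_mono order_trans[OF norm_cauchy_schwarz] K) auto
  also have "\<dots> = (K * inner x (X x)) * (norm (X x))\<^sup>2"
    by (simp add: power2_eq_square)
  finally show ?thesis by (rule mult_right_le_imp_le) (use n in auto)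
qed

lemma positive_inner_eq_0:
  assumes "positive_op X" "inner x (X x) = 0"
  shows "X x = 0"
proof -
  obtain K where "\<And>x. norm (X x) \<le> K * norm x"
    using bounded_op_bound[OF positive_op_op[OF assms(1)]] by auto
  from positive_norm_sq[OF assms(1) this, of x] assms(2) show ?thesis by simp
qed

text \<open>The contraction \<open>1 - X / K\<close> is what the square root iteration is applied
  to. On expanding the square, \<open>positive_norm_sq\<close> makes the quadratic term at most half
  of the linear one.\<close>

lemma norm_sub_positive_le:
  assumes X: "positive_op X" and K: "\<And>x. norm (X x) \<le> K * norm x" and "0 < K"
  shows "norm (x - (1 / K) *\<^sub>R X x) \<le> norm x"
proof -
  have "(norm (x - (1/K) *\<^sub>R X x))\<^sup>2 = (norm x)\<^sup>2 - 2/K * inner x (X x) + (norm (X x))\<^sup>2 / K\<^sup>2"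
    by (simp add: power2_norm_eq_inner inner_diff_left inner_diff_right inner_commute)
       (simp add: power2_eq_square)
  also have "\<dots> \<le> (norm x)\<^sup>2 - 2/K * inner x (X x) + (K * inner x (X x)) / K\<^sup>2"
    using positive_norm_sq[OF X K] \<open>0 < K\<close> by (intro add_left_mono divide_right_mono) auto
  also have "\<dots> \<le> (norm x)\<^sup>2"
    using positive_inner[OF X, of x] \<open>0 < K\<close> by (simp add: power2_eq_square field_simps)
  finally show ?thesis by (simp add: power2_le_iff_abs_le)
qed

text \<open>The same Cauchy-Schwarz argument, with the form bound used in both factors. It yields
  operator bounds where only the form is controlled.\<close>

lemma norm_le_of_form:
  assumes X: "positive_op X" and c: "\<And>x. inner x (X x) \<le> c * (norm x)\<^sup>2" and "0 \<le> c"
  shows "norm (X x) \<le> c * norm x"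
proof (cases "X x = 0")
  case True thus ?thesis using \<open>0 \<le> c\<close> by simp
next
  case False
  have "(norm (X x))\<^sup>2 * (norm (X x))\<^sup>2 = (inner x (X (X x)))\<^sup>2"
    using X by (metis power2_eq_square power2_norm_eq_inner positive_selfadj selfadj_inner)
  also have "\<dots> \<le> inner x (X x) * inner (X x) (X (X x))"
    by (rule positive_cauchy_schwarz[OF X])
  also have "\<dots> \<le> (c * (norm x)\<^sup>2) * (c * (norm (X x))\<^sup>2)"
    using positive_inner[OF X] c \<open>0 \<le> c\<close> by (intro mult_mono) auto
  also have "\<dots> = (c * norm x)\<^sup>2 * (norm (X x))\<^sup>2"
    by (simp add: power2_eq_square)
  finally have "(norm (X x))\<^sup>2 \<le> (c * norm x)\<^sup>2"
    by (rule mult_right_le_imp_le) (use False in auto)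
  thus ?thesis using \<open>0 \<le> c\<close> by (simp add: power2_le_iff_abs_le)
qed

text \<open>Minimising \<open>\<parallel>T x\<parallel>\<^sup>2 - 2 \<phi> x\<close> gives both the orthogonal projection (with
  \<open>T\<close> an inclusion) and the representation of bounded forms on a non-closed range.\<close>

lemma riesz_dense:
  fixes T :: "'b::real_vector \<Rightarrow> 'a::{real_inner,banach}"
  assumes V: "Real_Vector_Spaces.subspace V" and T: "linear T" and \<phi>: "linear \<phi>"
    and bd: "\<And>x. x \<in> V \<Longrightarrow> \<bar>\<phi> x\<bar> \<le> c * norm (T x)" and "0 \<le> c"
  shows "\<exists>u\<in>closure (T ` V). norm u \<le> c \<and> (\<forall>x\<in>V. (\<phi> x :: real) = inner (T x) u)"
proof -
  define J where "J x = (norm (T x))\<^sup>2 - 2 * \<phi> x" for x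
  have low: "- c\<^sup>2 \<le> J x" if "x \<in> V" for x
  proof -
    have "- c\<^sup>2 \<le> (norm (T x))\<^sup>2 - 2 * (c * norm (T x))"
      using zero_le_power2[of "norm (T x) - c"] by (simp add: power2_eq_square algebra_simps)
    also have "\<dots> \<le> J x" using bd[OF that] by (simp add: J_def)
    finally show ?thesis .
  qed
  have V0: "V \<noteq> {}" using real_vector.subspace_0[OF V] by auto
  define m where "m = Inf (J ` V)"
  have bb: "bdd_below (J ` V)" using low by (auto intro!: bdd_belowI)
  have mle: "m \<le> J x" if "x \<in> V" for x
    unfolding m_def using that bb by (intro cInf_lower) auto
  have "\<exists>x\<in>V. J x < m + 1 / (real n + 1)" for n
    using cInf_less_iff[of "J ` V" "m + 1 / (real n + 1)"] V0 bb by (auto simp: m_def)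
  then obtain X where X: "\<And>n. X n \<in> V" "\<And>n. J (X n) < m + 1 / (real n + 1)" by metis
  have quad: "J (x + t *\<^sub>R y) = J x + 2 * t * (inner (T x) (T y) - \<phi> y) + t\<^sup>2 * (norm (T y))\<^sup>2" for x y t
  proof -
    have "(norm (T x + t *\<^sub>R T y))\<^sup>2 = (norm (T x))\<^sup>2 + 2 * t * inner (T x) (T y) + t\<^sup>2 * (norm (T y))\<^sup>2"
      by (simp add: power2_norm_eq_inner inner_add_left inner_add_right inner_commute)
         (simp add: power2_eq_square algebra_simps)
    thus ?thesis
      by (simp add: J_def linear_add[OF T] linear_scale[OF T] linear_add[OF \<phi>] linear_scale[OF \<phi>]
          algebra_simps)
  qed
  \<comment> \<open>Parallelogram law: \<open>J\<close> at the midpoint is at least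
    \<open>m\<close>, so near-minimizers have nearby images under \<open>T\<close>.\<close>
  have near: "(norm (T x - T y))\<^sup>2 \<le> 2 * (J x - m) + 2 * (J y - m)" if "x \<in> V" "y \<in> V" for x y
  proof -
    have "m \<le> J ((1/2) *\<^sub>R (x + y))"
      using that V by (intro mle) (auto intro: subspace_add subspace_scale)
    moreover have "4 * J ((1/2) *\<^sub>R (x + y)) = (norm (T x + T y))\<^sup>2 - 4 * \<phi> x - 4 * \<phi> y"
      by (simp add: J_def linear_add[OF T] linear_scale[OF T] linear_add[OF \<phi>] linear_scale[OF \<phi>]
          power_mult_distrib power_divide del: scaleR_add_right) (simp add: field_simps)
    moreover have "(norm (T x + T y))\<^sup>2 + (norm (T x - T y))\<^sup>2 = 2 * (norm (T x))\<^sup>2 + 2 * (norm (T y))\<^sup>2"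
      by (simp add: power2_norm_eq_inner algebra_simps inner_commute)
    ultimately show ?thesis by (simp add: J_def)
  qed
  have "Cauchy (\<lambda>n. T (X n))"
  proof (rule metric_CauchyI)
    fix e :: real assume "0 < e"
    \<comment> \<open>Two excesses below \<open>1 / (N + 1)\<close> give a squared distance below
      \<open>4 / (N + 1)\<close>.\<close>
    obtain N where N: "4 / e\<^sup>2 < real N" using reals_Archimedean2 by blast
    have "dist (T (X i)) (T (X j)) < e" if "i \<ge> N" "j \<ge> N" for i j
    proof -
      have le: "J (X k) - m < 1 / (real N + 1)" if "k \<ge> N" for k
      proof -
        have "J (X k) - m < 1 / (real k + 1)" using X(2)[of k] by simp
        also have "\<dots> \<le> 1 / (real N + 1)" using that by (intro divide_left_mono) auto
        finally show ?thesis .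
      qed
      have "(norm (T (X i) - T (X j)))\<^sup>2 < 4 / (real N + 1)"
        using near[OF X(1)[of i] X(1)[of j]] le[OF that(1)] le[OF that(2)] by simp
      also have "\<dots> < e\<^sup>2"
      proof -
        have "0 < e\<^sup>2" "4 < real N * e\<^sup>2" using N \<open>0 < e\<close> by (auto simp: field_simps)
        hence "4 < e\<^sup>2 * (real N + 1)" unfolding distrib_left by (simp only: mult.commute mult_1_left)
        thus ?thesis by (simp add: pos_divide_less_eq)
      qed
      finally show ?thesis using \<open>0 < e\<close> by (auto simp: dist_norm intro: power2_less_imp_less)
    qed
    thus "\<exists>M. \<forall>i\<ge>M. \<forall>j\<ge>M. dist (T (X i)) (T (X j)) < e" by blast
  qed
  \<comment> \<open>Only the images converge; the vectors \<open>X n\<close> may not, which is why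
    \<open>u\<close> is sought in the closure of the image.\<close>
  then obtain u where u: "(\<lambda>n. T (X n)) \<longlonglongrightarrow> u"
    using Cauchy_convergent convergent_def by blast
  have Jlim: "(\<lambda>n. J (X n)) \<longlonglongrightarrow> m"
  proof (rule tendsto_sandwich[of "\<lambda>_. m" _ _ "\<lambda>n. m + 1 / (real n + 1)"])
    show "(\<lambda>n. m + 1 / (real n + 1)) \<longlonglongrightarrow> m"
      using LIMSEQ_inverse_real_of_nat_add[of m] by (simp add: field_simps)
  qed (use X mle in \<open>auto intro!: always_eventually less_imp_le\<close>)
  have main: "\<phi> y = inner (T y) u" if y: "y \<in> V" for y
  proof -
    have pos: "0 \<le> 2 * t * (inner u (T y) - \<phi> y) + t\<^sup>2 * (norm (T y))\<^sup>2" for t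
    proof -
      have "(\<lambda>n. J (X n) - m + 2 * t * (inner (T (X n)) (T y) - \<phi> y) + t\<^sup>2 * (norm (T y))\<^sup>2)
           \<longlonglongrightarrow> m - m + 2 * t * (inner u (T y) - \<phi> y) + t\<^sup>2 * (norm (T y))\<^sup>2"
        by (intro tendsto_intros Jlim u)
      moreover have "0 \<le> J (X n) - m + 2 * t * (inner (T (X n)) (T y) - \<phi> y) + t\<^sup>2 * (norm (T y))\<^sup>2" for n
        using mle[of "X n + t *\<^sub>R y"] quad[of "X n" t y] X(1) y V
        by (auto simp: subspace_add subspace_scale)
      ultimately show ?thesis by (auto intro: LIMSEQ_le_const)
    qed
    define b where "b = inner u (T y) - \<phi> y"
    define n where "n = (norm (T y))\<^sup>2"
    have "b = 0"
    proof (cases "n = 0")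
      case True
      thus ?thesis using pos[of "- b"] pos[of b] by (simp add: b_def[symmetric] n_def[symmetric])
          (smt (verit) mult_nonneg_nonneg not_real_square_gt_zero)
    next
      case False
      hence "n > 0" by (simp add: n_def)
      have "0 \<le> 2 * (- b / n) * b + (- b / n)\<^sup>2 * n" using pos[of "- b / n"] by (simp add: b_def n_def)
      also have "\<dots> = - (b\<^sup>2 / n)" using \<open>n > 0\<close> by (simp add: power2_eq_square field_simps)
      finally have "b\<^sup>2 \<le> 0" using \<open>n > 0\<close> by (simp add: divide_le_0_iff)
      thus ?thesis by simp
    qed
    thus ?thesis by (simp add: b_def inner_commute)
  qed
  have "inner u u \<le> c * norm u"
  proof (rule LIMSEQ_le)
    show "(\<lambda>n. inner (T (X n)) u) \<longlonglongrightarrow> inner u u" "(\<lambda>n. c * norm (T (X n))) \<longlonglongrightarrow> c * norm u"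
      by (intro tendsto_intros u)+
    show "\<exists>N. \<forall>n\<ge>N. inner (T (X n)) u \<le> c * norm (T (X n))"
      using main X(1) bd by (metis abs_le_D1)
  qed
  hence "norm u * norm u \<le> c * norm u"
    by (metis power2_eq_square power2_norm_eq_inner)
  hence "norm u \<le> c"
    using \<open>0 \<le> c\<close> by (cases "u = 0") auto
  moreover have "u \<in> closure (T ` V)"
    unfolding closure_sequential using u X(1) by (intro exI[of _ "\<lambda>n. T (X n)"]) auto
  ultimately show ?thesis using main by blast
qed

lemma closure_seqI: "(\<And>n. f n \<in> S) \<Longrightarrow> f \<longlonglongrightarrow> x \<Longrightarrow> x \<in> closure (S :: 'a::metric_space set)"
  unfolding closure_sequential by (intro exI[of _ f]) auto

subsection \<open>Closed subspaces and projections\<close>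

definition closed_csub :: "'a::complex_hilbert_space set \<Rightarrow> bool" where
  "closed_csub M \<longleftrightarrow> Real_Vector_Spaces.subspace M \<and> closed M \<and> (\<forall>x\<in>M. iC x \<in> M)"

lemma closed_csub_arith:
  assumes "closed_csub M"
  shows "0 \<in> M" "x \<in> M \<Longrightarrow> y \<in> M \<Longrightarrow> x + y \<in> M" "x \<in> M \<Longrightarrow> y \<in> M \<Longrightarrow> x - y \<in> M"
    "x \<in> M \<Longrightarrow> r *\<^sub>R x \<in> M" "x \<in> M \<Longrightarrow> iC x \<in> M" "closed M"
  using assms real_vector.subspace_0 real_vector.subspace_add real_vector.subspace_diff
    real_vector.subspace_scale
  unfolding closed_csub_def by blast+

lemma closed_csubI:
  assumes "0 \<in> M" "\<And>x y. x \<in> M \<Longrightarrow> y \<in> M \<Longrightarrow> x + y \<in> M" "\<And>r x. x \<in> M \<Longrightarrow> r *\<^sub>R x \<in> M"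
    "\<And>x. x \<in> M \<Longrightarrow> iC x \<in> M" "closed M"
  shows "closed_csub M"
  using assms by (auto simp: closed_csub_def intro: real_vector.subspaceI)

lemma closed_csub_ker:
  assumes "bounded_op X"
  shows "closed_csub {x. X x = 0}"
proof (rule closed_csubI)
  have "continuous_on UNIV X"
    using assms by (simp add: bounded_op_iff linear_continuous_on)
  thus "closed {x. X x = 0}"
    by (intro closed_Collect_eq) auto
qed (use assms in \<open>auto simp: op_simps bounded_op_iC\<close>)

lemma closed_csub_range:
  assumes "bounded_op X"
  shows "closed_csub (closure (range X))"
proof (rule closed_csubI)
  show "0 \<in> closure (range X)"
    using subsetD[OF closure_subset, of "X 0" "range X"] bounded_op_0[OF assms] by simp
next
  fix x y assume "x \<in> closure (range X)" "y \<in> closure (range X)"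
  then obtain f g where fg: "\<And>n. f n \<in> range X" "f \<longlonglongrightarrow> x" "\<And>n. g n \<in> range X" "g \<longlonglongrightarrow> y"
    by (metis closure_sequential)
  have "f n + g n \<in> range X" for n
    using fg(1)[of n] fg(3)[of n] by (auto simp: bounded_op_add[OF assms, symmetric])
  moreover have "(\<lambda>n. f n + g n) \<longlonglongrightarrow> x + y" by (intro tendsto_add fg)
  ultimately show "x + y \<in> closure (range X)" by (rule closure_seqI)
next
  fix r x assume "x \<in> closure (range X)"
  then obtain f where fg: "\<And>n. f n \<in> range X" "f \<longlonglongrightarrow> x"
    by (metis closure_sequential)
  have "r *\<^sub>R f n \<in> range X" for n
    using fg(1)[of n] by (auto simp: bounded_op_scaleR[OF assms, symmetric])
  moreover have "(\<lambda>n. r *\<^sub>R f n) \<longlonglongrightarrow> r *\<^sub>R x" by (intro tendsto_intros fg)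
  ultimately show "r *\<^sub>R x \<in> closure (range X)" by (rule closure_seqI)
next
  fix x assume "x \<in> closure (range X)"
  then obtain f where fg: "\<And>n. f n \<in> range X" "f \<longlonglongrightarrow> x"
    by (metis closure_sequential)
  have "iC (f n) \<in> range X" for n
    using fg(1)[of n] by (auto simp: bounded_op_iC[OF assms, symmetric])
  moreover have "(\<lambda>n. iC (f n)) \<longlonglongrightarrow> iC x" by (rule bounded_linear.tendsto[OF bounded_linear_iC fg(2)])
  ultimately show "iC x \<in> closure (range X)" by (rule closure_seqI)
qed simp

text \<open>Orthogonality to \<open>M\<close> is tested with the real inner product; for
  \<open>M\<close> stable under \<open>iC\<close> this is the same as complex orthogonality.\<close>

definition proj :: "'a::complex_hilbert_space set \<Rightarrow> 'a \<Rightarrow> 'a" where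
  "proj M x = (THE u. u \<in> M \<and> (\<forall>y\<in>M. inner y (x - u) = 0))"

lemma proj_unique:
  assumes M: "closed_csub M" and u: "u \<in> M" "\<And>y. y \<in> M \<Longrightarrow> inner y (x - u) = 0"
  shows "proj M x = u"
  unfolding proj_def
proof (rule the_equality)
  fix v assume v: "v \<in> M \<and> (\<forall>y\<in>M. inner y (x - v) = 0)"
  hence uv: "u - v \<in> M" using u M by (simp add: closed_csub_arith)
  have "inner (u - v) (u - v) = inner (u - v) (x - v) - inner (u - v) (x - u)"
    by (simp add: inner_diff_right)
  also have "\<dots> = 0" using u(2)[OF uv] v uv by simp
  finally show "v = u" by simp
qed (use u in auto)

lemma proj_props:
  assumes M: "closed_csub M"
  shows proj_in: "proj M x \<in> M" and proj_orth: "y \<in> M \<Longrightarrow> inner y (x - proj M x) = 0"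
proof -
  have "\<exists>u\<in>closure ((\<lambda>y. y) ` M). norm u \<le> norm x \<and> (\<forall>y\<in>M. inner y x = inner y u)"
  proof (rule riesz_dense)
    show "linear (\<lambda>y. inner y x)" by (simp add: bounded_linear.linear bounded_linear_inner_left)
    show "\<bar>inner y x\<bar> \<le> norm x * norm y" for y
      using Cauchy_Schwarz_ineq2[of y x] by (simp add: mult.commute)
    show "linear (\<lambda>y::'a. y)" by (simp add: linear_iff)
  qed (use M in \<open>auto simp: closed_csub_def\<close>)
  then obtain u where u: "u \<in> M" "\<And>y. y \<in> M \<Longrightarrow> inner y (x - u) = 0"
    using M by (auto simp: closed_csub_def inner_diff_right)
  from proj_unique[OF M this] u
  show "proj M x \<in> M" "y \<in> M \<Longrightarrow> inner y (x - proj M x) = 0" by auto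
qed

lemma proj_fix: "closed_csub M \<Longrightarrow> x \<in> M \<Longrightarrow> proj M x = x"
  by (rule proj_unique) auto

lemma proj_orth_eq_0: "closed_csub M \<Longrightarrow> (\<And>y. y \<in> M \<Longrightarrow> inner y x = 0) \<Longrightarrow> proj M x = 0"
  by (rule proj_unique) (auto simp: closed_csub_arith)

definition is_proj :: "('a::complex_hilbert_space \<Rightarrow> 'a) \<Rightarrow> bool" where
  "is_proj P \<longleftrightarrow> selfadj P \<and> (\<forall>x. P (P x) = P x)"

lemma is_proj_selfadj: "is_proj P \<Longrightarrow> selfadj P"
  and is_proj_op: "is_proj P \<Longrightarrow> bounded_op P"
  and is_proj_idem: "is_proj P \<Longrightarrow> P (P x) = P x"
  by (auto simp: is_proj_def selfadj_op)

lemma is_proj_inner: "is_proj P \<Longrightarrow> inner x (P x) = (norm (P x))\<^sup>2"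
  using selfadj_inner[OF is_proj_selfadj, of P x "P x"] is_proj_idem[of P x]
  by (simp add: power2_norm_eq_inner)

lemma is_proj_positive: "is_proj P \<Longrightarrow> positive_op P"
  by (rule positive_opI) (auto simp: is_proj_selfadj is_proj_inner)

lemma is_proj_norm_le: "is_proj P \<Longrightarrow> norm (P x) \<le> norm x"
proof -
  assume P: "is_proj P"
  have "norm (P x) * norm (P x) \<le> norm x * norm (P x)"
    using norm_cauchy_schwarz[of x "P x"] is_proj_inner[OF P, of x] by (simp add: power2_eq_square)
  thus ?thesis by (cases "P x = 0") auto
qed

lemma is_proj_compl: "is_proj P \<Longrightarrow> is_proj (\<lambda>x. x - P x)"
  by (auto simp: is_proj_def selfadj_intros op_simps selfadj_op)

lemma is_proj_zero: "is_proj (\<lambda>x. 0)"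
  by (auto simp: is_proj_def selfadj_intros)

lemma is_proj_id: "is_proj (\<lambda>x. x)"
  by (auto simp: is_proj_def selfadj_intros)

lemma is_proj_comp:
  assumes "is_proj P" "is_proj Q" "\<And>x. P (Q x) = Q (P x)"
  shows "is_proj (\<lambda>x. P (Q x))"
  unfolding is_proj_def
proof (intro conjI allI)
  show "selfadj (\<lambda>x. P (Q x))" 
    by (rule selfadj_comp[OF is_proj_selfadj[OF assms(1)] is_proj_selfadj[OF assms(2)] assms(3)])
  show "P (Q (P (Q x))) = P (Q x)" for x
    using assms(3)[of "Q x"] by (simp add: is_proj_idem assms(1,2))
qed

lemma is_proj_proj:
  assumes M: "closed_csub M"
  shows "is_proj (proj M)"
proof -
  note ar = closed_csub_arith[OF M] and pi = proj_in[OF M] and po = proj_orth[OF M]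
  have add: "proj M (x + y) = proj M x + proj M y" for x y
    using po[of _ x] po[of _ y]
    by (intro proj_unique[OF M]) (auto simp: ar pi inner_diff_right inner_add_right)
  have sc: "proj M (r *\<^sub>R x) = r *\<^sub>R proj M x" for r x
    using po[of _ x]
    by (intro proj_unique[OF M]) (auto simp: ar pi inner_diff_right)
  have J: "proj M (iC x) = iC (proj M x)" for x
  proof (intro proj_unique[OF M])
    fix y assume "y \<in> M"
    hence "inner (iC y) (x - proj M x) = 0" by (intro po ar)
    thus "inner y (iC x - iC (proj M x)) = 0" by (simp add: inner_iC_left iC_diff)
  qed (auto simp: ar pi)
  have sym: "inner (proj M x) y = inner x (proj M y)" for x y
    using po[OF pi, of x y] po[OF pi, of y x] by (simp add: inner_diff_right inner_commute)
  have idem: "proj M (proj M x) = proj M x" for x by (rule proj_fix[OF M pi])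
  have "norm (proj M x) \<le> 1 * norm x" for x
  proof -
    have "norm (proj M x) * norm (proj M x) = inner x (proj M x)"
      by (metis sym idem power2_eq_square power2_norm_eq_inner)
    also have "\<dots> \<le> norm x * norm (proj M x)" by (rule norm_cauchy_schwarz)
    finally show ?thesis by (cases "proj M x = 0") auto
  qed
  from bounded_opI[OF add sc J this] sym idem show ?thesis
    by (simp add: is_proj_def selfadj_def)
qed

text \<open>\<open>Y\<close> preserves the kernel of \<open>Z\<close> and, being self-adjoint, also
  its orthogonal complement.\<close>

lemma proj_ker_commute:
  assumes Z: "bounded_op Z" and Y: "selfadj Y" and YZ: "\<And>x. Y (Z x) = Z (Y x)"
  shows "proj {x. Z x = 0} (Y x) = Y (proj {x. Z x = 0} x)"
proof -
  note M = closed_csub_ker[OF Z]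
  show ?thesis
  proof (rule proj_unique[OF M])
    show "Y (proj {x. Z x = 0} x) \<in> {x. Z x = 0}"
      using proj_in[OF M, of x] by (simp add: YZ[symmetric] bounded_op_0[OF selfadj_op[OF Y]])
    fix y assume "y \<in> {x. Z x = 0}"
    hence "Y y \<in> {x. Z x = 0}" by (simp add: YZ[symmetric] bounded_op_0[OF selfadj_op[OF Y]])
    from proj_orth[OF M this, of x]
    show "inner y (Y x - Y (proj {x. Z x = 0} x)) = 0"
      by (simp add: selfadj_inner[OF Y] bounded_op_diff[OF selfadj_op[OF Y]])
  qed
qed

text \<open>\<open>op_on\<close> speaks of complex orthogonality. Since \<open>M\<close> is stable
  under \<open>iC\<close>, real orthogonality to \<open>M\<close> already implies it.\<close>

lemma op_on_orth:
  assumes "op_on M X" "closed_csub M" "\<And>y. y \<in> M \<Longrightarrow> inner y x = 0"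
  shows "X x = 0"
proof -
  have "cinner y x = 0" if "y \<in> M" for y
    using assms(3)[OF that] assms(3)[OF closed_csub_arith(5)[OF assms(2) that]]
    by (simp add: cinner_eq complex_eq_iff inner_iC_left)
  thus ?thesis using assms(1) by (auto simp: op_on_def)
qed

lemma op_onI:
  assumes "closed_csub M" "bounded_op X" "\<And>x. X x \<in> M" "\<And>x. (\<And>y. y \<in> M \<Longrightarrow> inner y x = 0) \<Longrightarrow> X x = 0"
  shows "op_on M X"
  using assms by (auto simp: op_on_def inner_eq_Re_cinner)

lemma op_on_proj:
  assumes "op_on M X" "closed_csub M"
  shows "X (proj M x) = X x" "proj M (X x) = X x"
proof -
  have "X (x - proj M x) = 0"
    by (rule op_on_orth[OF assms]) (rule proj_orth[OF assms(2)])
  thus "X (proj M x) = X x" using assms by (simp add: op_on_def op_simps)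
  show "proj M (X x) = X x" using assms by (intro proj_fix) (auto simp: op_on_def)
qed

subsection \<open>Square roots and inverses\<close>

text \<open>Iteration for \<open>1 - sqrt (1 - X)\<close>: a fixed point satisfies
  \<open>2 Y = X + Y Y\<close>, that is \<open>(1 - Y)^2 = 1 - X\<close>.\<close>

fun sqrt_iter :: "('a::real_vector \<Rightarrow> 'a) \<Rightarrow> nat \<Rightarrow> 'a \<Rightarrow> 'a" where
  "sqrt_iter X 0 = (\<lambda>x. 0)"
| "sqrt_iter X (Suc n) = (\<lambda>x. (1/2) *\<^sub>R (X x + sqrt_iter X n (sqrt_iter X n x)))"

text \<open>The same recursion with the number 1 in place of \<open>X\<close>. It increases, stays
  below 1, and majorizes both the norms of the iterates and their increments, so convergence needs
  no order relation between commuting operators.\<close>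

fun sqrt_maj :: "nat \<Rightarrow> real" where
  "sqrt_maj 0 = 0"
| "sqrt_maj (Suc n) = (1 + (sqrt_maj n)\<^sup>2) / 2"

lemma sqrt_maj_bounds: "0 \<le> sqrt_maj n" "sqrt_maj n \<le> 1"
proof (induction n)
  case (Suc n)
  { case 1 show ?case by simp }
  { case 2 show ?case using Suc by (simp add: power_le_one) }
qed auto

lemma sqrt_maj_mono: "incseq sqrt_maj"
proof (rule incseq_SucI)
  show "sqrt_maj n \<le> sqrt_maj (Suc n)" for n
    using zero_le_power2[of "sqrt_maj n - 1"] by (simp add: power2_eq_square algebra_simps)
qed

context
  fixes X :: "'a::complex_hilbert_space \<Rightarrow> 'a"
  assumes X: "selfadj X" and X1: "\<And>x. norm (X x) \<le> norm x"
begin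

lemma sqrt_iter_selfadj: "selfadj (sqrt_iter X n)"
proof (induction n)
  case (Suc n)
  show ?case unfolding sqrt_iter.simps by (intro selfadj_intros X selfadj_comp[OF Suc Suc]) simp
qed (simp add: selfadj_zero)

lemma sqrt_iter_commute:
  assumes "bounded_op Z" "\<And>x. Z (X x) = X (Z x)"
  shows "Z (sqrt_iter X n x) = sqrt_iter X n (Z x)"
  by (induction n arbitrary: x) (auto simp: op_simps assms)

lemma sqrt_iter_norm: "norm (sqrt_iter X n x) \<le> sqrt_maj n * norm x"
proof (induction n arbitrary: x)
  case (Suc n)
  have "norm (X x + sqrt_iter X n (sqrt_iter X n x)) \<le> norm x + sqrt_maj n * (sqrt_maj n * norm x)"
    by (intro norm_triangle_le add_mono X1 order_trans[OF Suc] mult_left_mono Suc sqrt_maj_bounds)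
  thus ?case by (simp add: power2_eq_square algebra_simps del: scaleR_add_right)
qed simp

text \<open>The factorization \<open>Y' Y' - Y Y = Y' (Y' - Y) + (Y' - Y) Y\<close> mirrors that of
  \<open>p'^2 - p^2\<close>, so the scalar increments dominate by induction.\<close>

lemma sqrt_iter_diff:
  "norm (sqrt_iter X (Suc n) x - sqrt_iter X n x) \<le> (sqrt_maj (Suc n) - sqrt_maj n) * norm x"
proof (induction n arbitrary: x)
  case 0
  show ?case using X1 by simp
next
  case (Suc n)
  define Y where "Y = sqrt_iter X n"
  define Y' where "Y' = sqrt_iter X (Suc n)"
  define p where "p = sqrt_maj n"
  define p' where "p' = sqrt_maj (Suc n)"
  have op: "bounded_op Y'" unfolding Y'_def by (intro selfadj_op sqrt_iter_selfadj)
  have IH: "norm (Y' x - Y x) \<le> (p' - p) * norm x" for x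
    unfolding Y_def Y'_def p_def p'_def by (rule Suc)
  have Y: "norm (Y x) \<le> p * norm x" and Y': "norm (Y' x) \<le> p' * norm x" for x
    unfolding Y_def Y'_def p_def p'_def by (rule sqrt_iter_norm)+
  have p: "0 \<le> p" "0 \<le> p'" "p \<le> p'"
    using sqrt_maj_bounds sqrt_maj_mono[THEN incseq_SucD] by (auto simp: p_def p'_def simp del: sqrt_maj.simps)
  have "Y' (Y' x) - Y (Y x) = Y' (Y' x - Y x) + (Y' (Y x) - Y (Y x))"
    by (simp add: bounded_op_diff[OF op])
  also have "norm \<dots> \<le> p' * ((p' - p) * norm x) + (p' - p) * (p * norm x)"
    using p by (intro norm_triangle_le add_mono order_trans[OF Y'] order_trans[OF IH] mult_left_mono IH Y) auto
  also have "\<dots> = (p'\<^sup>2 - p\<^sup>2) * norm x" by (simp add: power2_eq_square algebra_simps)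
  finally have *: "norm (Y' (Y' x) - Y (Y x)) \<le> (p'\<^sup>2 - p\<^sup>2) * norm x" .
  have "sqrt_iter X (Suc (Suc n)) x = (1/2) *\<^sub>R (X x + Y' (Y' x))"
    by (simp only: sqrt_iter.simps(2)[of X "Suc n"] Y'_def)
  moreover have "sqrt_iter X (Suc n) x = (1/2) *\<^sub>R (X x + Y (Y x))"
    by (simp only: sqrt_iter.simps(2)[of X n] Y_def)
  ultimately have "sqrt_iter X (Suc (Suc n)) x - sqrt_iter X (Suc n) x = (1/2) *\<^sub>R (Y' (Y' x) - Y (Y x))"
    by (simp only: scaleR_diff_right[symmetric]) simp
  moreover have "sqrt_maj (Suc (Suc n)) - sqrt_maj (Suc n) = (p'\<^sup>2 - p\<^sup>2) / 2"
    by (simp add: p_def p'_def field_simps)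
  ultimately show ?case using * by (simp only:) simp
qed

lemma sqrt_iter_diff_le:
  assumes "n \<le> m"
  shows "norm (sqrt_iter X m x - sqrt_iter X n x) \<le> (sqrt_maj m - sqrt_maj n) * norm x"
  using assms
proof (induction m rule: dec_induct)
  case (step m)
  have "norm (sqrt_iter X (Suc m) x - sqrt_iter X n x)
      \<le> norm (sqrt_iter X (Suc m) x - sqrt_iter X m x) + norm (sqrt_iter X m x - sqrt_iter X n x)"
    using norm_triangle_ineq[of "sqrt_iter X (Suc m) x - sqrt_iter X m x" "sqrt_iter X m x - sqrt_iter X n x"]
    by (simp only: diff_add_cancel add_diff_eq)
  also have "\<dots> \<le> (sqrt_maj (Suc m) - sqrt_maj m) * norm x + (sqrt_maj m - sqrt_maj n) * norm x"
    by (intro add_mono sqrt_iter_diff step.IH)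
  also have "\<dots> = (sqrt_maj (Suc m) - sqrt_maj n) * norm x"
    by (simp only: ring_distribs)
  finally show ?case .
qed simp

lemma sqrt_iter_convergent: "convergent (\<lambda>n. sqrt_iter X n x)"
proof -
  have c: "Cauchy sqrt_maj"
    using incseq_convergent[OF sqrt_maj_mono, of 1] sqrt_maj_bounds(2) LIMSEQ_imp_Cauchy by metis
  have "Cauchy (\<lambda>n. sqrt_iter X n x)"
  proof (rule metric_CauchyI)
    fix e :: real assume "0 < e"
    hence "0 < e / (norm x + 1)" by (simp add: add_nonneg_pos)
    from metric_CauchyD[OF c this] obtain M
      where M: "\<And>m n. m \<ge> M \<Longrightarrow> n \<ge> M \<Longrightarrow> \<bar>sqrt_maj m - sqrt_maj n\<bar> < e / (norm x + 1)"
      by (auto simp: dist_real_def)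
    have "dist (sqrt_iter X m x) (sqrt_iter X n x) < e" if "n \<le> m" "M \<le> n" for m n
    proof -
      have "dist (sqrt_iter X m x) (sqrt_iter X n x) \<le> (sqrt_maj m - sqrt_maj n) * norm x"
        unfolding dist_norm by (rule sqrt_iter_diff_le[OF that(1)])
      also have "\<dots> \<le> e / (norm x + 1) * norm x"
        using M[of m n] that by (intro mult_right_mono) auto
      also have "\<dots> < e"
        using \<open>0 < e\<close> by (subst times_divide_eq_left, subst pos_divide_less_eq) (use norm_ge_zero[of x] in \<open>auto simp: add_pos_nonneg algebra_simps\<close>)
      finally show ?thesis .
    qed
    thus "\<exists>M. \<forall>m\<ge>M. \<forall>n\<ge>M. dist (sqrt_iter X m x) (sqrt_iter X n x) < e"
      by (metis dist_commute nle_le)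
  qed
  thus ?thesis by (rule Cauchy_convergent)
qed

text \<open>Commutation with everything that commutes with \<open>X\<close> holds for each iterate
  and passes to the limit; uniqueness of the root and the commutation of spectral projections rest
  on it.\<close>

lemma sqrt_one_minus:
  "\<exists>W. positive_op W \<and> (\<forall>x. W (W x) = x - X x) \<and>
    (\<forall>Z. bounded_op Z \<longrightarrow> (\<forall>x. Z (X x) = X (Z x)) \<longrightarrow> (\<forall>x. Z (W x) = W (Z x)))"
proof -
  define Y where "Y x = lim (\<lambda>n. sqrt_iter X n x)" for x
  have lim: "(\<lambda>n. sqrt_iter X n x) \<longlonglongrightarrow> Y x" for x
    unfolding Y_def using sqrt_iter_convergent convergent_LIMSEQ_iff by blast
  note op = selfadj_op[OF sqrt_iter_selfadj]
  have n1: "norm (sqrt_iter X n x) \<le> norm x" for n x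
    using sqrt_iter_norm[of n x] mult_right_mono[OF sqrt_maj_bounds(2), of "norm x" n] by simp
  have "bounded_op Y"
  proof (rule bounded_opI)
    show "Y (x + y) = Y x + Y y" for x y
      by (rule LIMSEQ_unique[OF lim]) (simp add: bounded_op_add[OF op] tendsto_add lim)
    show "Y (r *\<^sub>R x) = r *\<^sub>R Y x" for r x
      by (rule LIMSEQ_unique[OF lim]) (simp add: bounded_op_scaleR[OF op] tendsto_scaleR lim)
    show "Y (iC x) = iC (Y x)" for x
      by (rule LIMSEQ_unique[OF lim])
         (simp add: bounded_op_iC[OF op] bounded_linear.tendsto[OF bounded_linear_iC] lim)
    show "norm (Y x) \<le> 1 * norm x" for x
      using LIMSEQ_le_const2[OF tendsto_norm[OF lim]] n1 by auto
  qed
  have "inner (Y x) y = inner x (Y y)" for x y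
  proof (rule LIMSEQ_unique)
    show "(\<lambda>n. inner (sqrt_iter X n x) y) \<longlonglongrightarrow> inner (Y x) y" by (intro tendsto_intros lim)
    show "(\<lambda>n. inner (sqrt_iter X n x) y) \<longlonglongrightarrow> inner x (Y y)"
      unfolding selfadj_inner[OF sqrt_iter_selfadj] by (intro tendsto_intros lim)
  qed
  hence Y: "selfadj Y" using \<open>bounded_op Y\<close> by (simp add: selfadj_def)
  have Y1: "norm (Y x) \<le> norm x" for x
    using LIMSEQ_le_const2[OF tendsto_norm[OF lim]] n1 by auto
  have YY: "Y x = (1/2) *\<^sub>R (X x + Y (Y x))" for x
  proof (rule LIMSEQ_unique)
    show "(\<lambda>n. sqrt_iter X (Suc n) x) \<longlonglongrightarrow> Y x" using lim LIMSEQ_Suc by blast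
    have "(\<lambda>n. sqrt_iter X n (sqrt_iter X n x - Y x)) \<longlonglongrightarrow> 0"
    proof (rule Lim_null_comparison)
      show "\<forall>\<^sub>F n in sequentially. norm (sqrt_iter X n (sqrt_iter X n x - Y x)) \<le> norm (sqrt_iter X n x - Y x)"
        using n1 by auto
      show "(\<lambda>n. norm (sqrt_iter X n x - Y x)) \<longlonglongrightarrow> 0"
        using lim LIM_zero tendsto_norm_zero by blast
    qed
    from tendsto_add[OF this lim[of "Y x"]]
    have "(\<lambda>n. sqrt_iter X n (sqrt_iter X n x)) \<longlonglongrightarrow> Y (Y x)"
      by (simp add: bounded_op_diff[OF op])
    thus "(\<lambda>n. sqrt_iter X (Suc n) x) \<longlonglongrightarrow> (1/2) *\<^sub>R (X x + Y (Y x))"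
      unfolding sqrt_iter.simps by (intro tendsto_intros)
  qed
  have YY': "Y (Y x) = 2 *\<^sub>R Y x - X x" for x
    using arg_cong[OF YY, of "\<lambda>v. 2 *\<^sub>R v" x] by (simp add: algebra_simps)
  show ?thesis
  proof (intro exI conjI allI impI)
    show "positive_op (\<lambda>x. x - Y x)"
    proof (rule positive_opI)
      fix x
      have "inner x (Y x) \<le> norm x * norm x"
        using norm_cauchy_schwarz[of x "Y x"] mult_left_mono[OF Y1[of x], of "norm x"] by simp
      thus "0 \<le> inner x (x - Y x)"
        by (simp add: inner_diff_right power2_norm_eq_inner[symmetric] power2_eq_square)
    qed (intro selfadj_intros Y)
    show "(x - Y x) - Y (x - Y x) = x - X x" for x
      by (simp add: bounded_op_diff[OF \<open>bounded_op Y\<close>] YY' algebra_simps scaleR_2)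
    fix Z x assume Z: "bounded_op Z" "\<forall>x. Z (X x) = X (Z x)"
    have "Z (Y x) = Y (Z x)"
    proof (rule LIMSEQ_unique)
      show "(\<lambda>n. Z (sqrt_iter X n x)) \<longlonglongrightarrow> Z (Y x)" by (rule bounded_op_tendsto[OF Z(1) lim])
      show "(\<lambda>n. Z (sqrt_iter X n x)) \<longlonglongrightarrow> Y (Z x)"
        using lim[of "Z x"] sqrt_iter_commute[OF Z(1)] Z(2) by simp
    qed
    thus "Z (x - Y x) = Z x - Y (Z x)" by (simp add: bounded_op_diff[OF Z(1)])
  qed
qed

end

lemma positive_sqrt_exists:
  assumes P: "positive_op P"
  shows "\<exists>W. positive_op W \<and> (\<forall>x. W (W x) = P x) \<and>
    (\<forall>Z. bounded_op Z \<longrightarrow> (\<forall>x. Z (P x) = P (Z x)) \<longrightarrow> (\<forall>x. Z (W x) = W (Z x)))"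
proof -
  obtain K where K: "0 < K" "\<And>x. norm (P x) \<le> K * norm x"
    using bounded_op_bound[OF positive_op_op[OF P]] by auto
  define X where "X x = x - (1/K) *\<^sub>R P x" for x
  have "selfadj X" unfolding X_def by (intro selfadj_intros positive_selfadj P)
  moreover have "norm (X x) \<le> norm x" for x
    unfolding X_def by (rule norm_sub_positive_le[OF P K(2,1)])
  ultimately obtain W where W: "positive_op W" "\<And>x. W (W x) = x - X x"
    "\<And>Z x. bounded_op Z \<Longrightarrow> (\<forall>x. Z (X x) = X (Z x)) \<Longrightarrow> Z (W x) = W (Z x)"
    using sqrt_one_minus[of X] by blast
  show ?thesis
  proof (intro exI conjI allI impI)
    show "positive_op (\<lambda>x. sqrt K *\<^sub>R W x)" using K by (intro positive_scale W) auto
    show "sqrt K *\<^sub>R W (sqrt K *\<^sub>R W x) = P x" for x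
      using K by (simp add: op_simps positive_op_op[OF W(1)] W(2) X_def)
    fix Z x assume Z: "bounded_op Z" "\<forall>x. Z (P x) = P (Z x)"
    have "Z (W x) = W (Z x)" by (rule W(3)) (use Z in \<open>auto simp: X_def op_simps\<close>)
    thus "Z (sqrt K *\<^sub>R W x) = sqrt K *\<^sub>R W (Z x)" using Z by (simp add: op_simps)
  qed
qed

text \<open>\<open>Y\<close> and \<open>Z\<close> commute because \<open>Z\<close> commutes with
  \<open>P = Z Z\<close>. Hence \<open>(Y + Z) (Y - Z) = 0\<close>, so by positivity both
  \<open>Y\<close> and \<open>Z\<close> annihilate \<open>v = Y x - Z x\<close>, and the squared
  norm of \<open>v\<close> is \<open>inner (Y v - Z v) x = 0\<close>.\<close>

lemma positive_sqrt_unique: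
  assumes P: "positive_op P" and Y: "positive_op Y" "\<And>x. Y (Y x) = P x"
    and Z: "positive_op Z" "\<And>x. Z (Z x) = P x"
    and comm: "\<And>V. bounded_op V \<Longrightarrow> (\<forall>x. V (P x) = P (V x)) \<Longrightarrow> \<forall>x. V (Y x) = Y (V x)"
  shows "Z = Y"
proof
  fix x
  note op = positive_op_op[OF Y(1)] positive_op_op[OF Z(1)]
  have ZY: "Z (Y x) = Y (Z x)" for x
  proof -
    have "Z (P x) = P (Z x)" for x by (simp only: Z(2)[symmetric])
    thus ?thesis using comm[OF op(2)] by blast
  qed
  define v where "v = Y x - Z x"
  have "Y v + Z v = 0"
    by (simp add: v_def op_simps op Y Z ZY)
  hence "inner v (Y v) + inner v (Z v) = 0" by (simp add: inner_add_right[symmetric])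
  with positive_inner[OF Y(1), of v] positive_inner[OF Z(1), of v]
  have "inner v (Y v) = 0" "inner v (Z v) = 0" by linarith+
  hence yz: "Y v = 0" "Z v = 0" using positive_inner_eq_0 Y(1) Z(1) by blast+
  have "inner v v = inner v (Y x) - inner v (Z x)"
    by (subst (2) v_def) (rule inner_diff_right)
  hence "inner v v = inner (Y v) x - inner (Z v) x"
    by (simp add: selfadj_inner[OF positive_selfadj[OF Y(1)]] selfadj_inner[OF positive_selfadj[OF Z(1)]])
  thus "Z x = Y x" using yz by (simp add: v_def)
qed

lemma sqrt_op_props:
  assumes P: "positive_op P"
  shows positive_sqrt_op: "positive_op (sqrt_op P)" and sqrt_op_sqrt_op: "sqrt_op P (sqrt_op P x) = P x"
    and sqrt_op_commute: "bounded_op Z \<Longrightarrow> (\<And>x. Z (P x) = P (Z x)) \<Longrightarrow> Z (sqrt_op P x) = sqrt_op P (Z x)"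
proof -
  obtain W where W: "positive_op W" "\<And>x. W (W x) = P x"
    "\<And>Z. bounded_op Z \<Longrightarrow> (\<forall>x. Z (P x) = P (Z x)) \<Longrightarrow> \<forall>x. Z (W x) = W (Z x)"
    using positive_sqrt_exists[OF P] by blast
  have "sqrt_op P = W" unfolding sqrt_op_def
  proof (rule the_equality)
    show "positive_op W \<and> W \<circ> W = P" using W by auto
    fix V assume "positive_op V \<and> V \<circ> V = P"
    thus "V = W" by (intro positive_sqrt_unique[OF P W(1,2) _ _ W(3)]) (auto dest: fun_cong)
  qed
  with W show "positive_op (sqrt_op P)" "sqrt_op P (sqrt_op P x) = P x"
    "bounded_op Z \<Longrightarrow> (\<And>x. Z (P x) = P (Z x)) \<Longrightarrow> Z (sqrt_op P x) = sqrt_op P (Z x)" by auto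
qed

lemma norm_sqrt_op: "positive_op P \<Longrightarrow> (norm (sqrt_op P x))\<^sup>2 = inner x (P x)"
  by (metis positive_sqrt_op positive_selfadj power2_norm_eq_inner selfadj_inner sqrt_op_sqrt_op)

text \<open>Surjectivity comes from \<open>riesz_dense\<close> with the square root of
  \<open>K\<close> in the role of \<open>T\<close>: the lower bound makes every functional
  \<open>inner x z\<close> bounded with respect to \<open>norm (sqrt_op K x)\<close>. So the root is
  onto, and therefore \<open>K\<close> is.\<close>

lemma positive_inverse:
  assumes K: "positive_op K" and "0 < \<delta>" and \<delta>: "\<And>x. \<delta> * (norm x)\<^sup>2 \<le> inner x (K x)"
  shows positive_inv: "positive_op (inv_into UNIV K)"
    and positive_f_inv: "K (inv_into UNIV K x) = x" and positive_inv_f: "inv_into UNIV K (K x) = x"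
proof -
  note W = positive_sqrt_op[OF K] and Wop = positive_op_op[OF positive_sqrt_op[OF K]]
  have "\<exists>u. z = sqrt_op K u" for z
  proof -
    have "\<exists>u\<in>closure (sqrt_op K ` UNIV). norm u \<le> norm z / sqrt \<delta> \<and>
        (\<forall>x\<in>UNIV. inner x z = inner (sqrt_op K x) u)"
    proof (rule riesz_dense)
      show "\<bar>inner x z\<bar> \<le> norm z / sqrt \<delta> * norm (sqrt_op K x)" for x
      proof -
        have "(sqrt \<delta> * norm x)\<^sup>2 \<le> (norm (sqrt_op K x))\<^sup>2"
          using \<delta>[of x] \<open>0 < \<delta>\<close> by (simp add: norm_sqrt_op[OF K] power_mult_distrib)
        hence "sqrt \<delta> * norm x \<le> norm (sqrt_op K x)" by (rule power2_le_imp_le) simp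
        hence "norm x \<le> norm (sqrt_op K x) / sqrt \<delta>" using \<open>0 < \<delta>\<close> by (simp add: field_simps)
        with Cauchy_Schwarz_ineq2[of x z] mult_right_mono[of _ _ "norm z", OF this]
        show ?thesis by (simp add: mult.commute)
      qed
      show "linear (\<lambda>x. inner x z)" by (simp add: bounded_linear.linear bounded_linear_inner_left)
    qed (use Wop \<open>0 < \<delta>\<close> in \<open>auto simp: bounded_op_linear\<close>)
    then obtain u where "\<And>x. inner x z = inner (sqrt_op K x) u" by auto
    hence "inner x (z - sqrt_op K u) = 0" for x
      by (simp add: inner_diff_right selfadj_inner[OF positive_selfadj[OF W]])
    thus ?thesis by (metis inner_eq_zero_iff right_minus_eq)
  qed
  hence "surj K" by (metis sqrt_op_sqrt_op[OF K] surjI surj_def)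
  have inj: "inj K"
  proof (rule injI)
    fix x y assume "K x = K y"
    hence "\<delta> * (norm (x - y))\<^sup>2 \<le> 0" using \<delta>[of "x - y"] by (simp add: op_simps positive_op_op[OF K])
    thus "x = y" using \<open>0 < \<delta>\<close> by (simp add: mult_le_0_iff)
  qed
  have f: "K (inv_into UNIV K x) = x" for x using \<open>surj K\<close> by (simp add: surj_f_inv_f)
  have eq: "inv_into UNIV K y = x" if "K x = y" for x y using inj that by (metis inv_f_f)
  show "K (inv_into UNIV K x) = x" "inv_into UNIV K (K x) = x" by (auto simp: f eq)
  note Kop = positive_op_op[OF K]
  have "bounded_op (inv_into UNIV K)"
  proof (rule bounded_opI)
    show "inv_into UNIV K (x + y) = inv_into UNIV K x + inv_into UNIV K y" for x y by (rule eq) (simp add: op_simps Kop f)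
    show "inv_into UNIV K (r *\<^sub>R x) = r *\<^sub>R inv_into UNIV K x" for r x by (rule eq) (simp add: op_simps Kop f)
    show "inv_into UNIV K (iC x) = iC (inv_into UNIV K x)" for x by (rule eq) (simp add: bounded_op_iC Kop f)
    show "norm (inv_into UNIV K x) \<le> (1/\<delta>) * norm x" for x
    proof -
      have "\<delta> * (norm (inv_into UNIV K x))\<^sup>2 \<le> norm (inv_into UNIV K x) * norm x"
        using \<delta>[of "inv_into UNIV K x"] norm_cauchy_schwarz[of "inv_into UNIV K x" x] by (simp add: f)
      thus ?thesis using \<open>0 < \<delta>\<close>
        by (cases "inv_into UNIV K x = 0") (auto simp: power2_eq_square field_simps)
    qed
  qed
  moreover have "inner (inv_into UNIV K x) y = inner x (inv_into UNIV K y)" for x y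
    by (metis f selfadj_inner[OF positive_selfadj[OF K]])
  ultimately show "positive_op (inv_into UNIV K)"
  proof (intro positive_opI)
    show "0 \<le> inner x (inv_into UNIV K x)" for x
      using positive_inner[OF K, of "inv_into UNIV K x"] by (simp add: f inner_commute)
  qed (simp add: selfadj_def)
qed

text \<open>\<open>P\<close> projects onto the kernel of \<open>V + X\<close>, where
  \<open>V\<close> is the absolute value of \<open>X\<close>, the root of \<open>X X\<close>. On it
  \<open>X = - V\<close>, so this is the spectral subspace for nonpositive values; the last clause
  expresses that the complement carries only strictly positive ones.\<close>

lemma spectral_projection:
  assumes X: "selfadj X"
  shows "\<exists>P. is_proj P \<and> (\<forall>Y x. selfadj Y \<longrightarrow> (\<forall>x. Y (X x) = X (Y x)) \<longrightarrow> P (Y x) = Y (P x)) \<and>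
    (\<forall>x. P x = x \<longrightarrow> inner x (X x) \<le> 0) \<and> (\<forall>x. P x = 0 \<longrightarrow> inner x (X x) \<le> 0 \<longrightarrow> x = 0)"
proof -
  define V where "V = sqrt_op (\<lambda>x. X (X x))"
  note XX = positive_square[OF X] and Xop = selfadj_op[OF X]
  have V: "positive_op V" and VV: "V (V x) = X (X x)" for x
    unfolding V_def using positive_sqrt_op[OF XX] sqrt_op_sqrt_op[OF XX] by auto
  note Vop = positive_op_op[OF V]
  have comm: "Y (V x) = V (Y x)" if "selfadj Y" "\<forall>x. Y (X x) = X (Y x)" for Y x
    unfolding V_def by (rule sqrt_op_commute[OF XX selfadj_op[OF that(1)]]) (use that in auto)
  have XV: "X (V x) = V (X x)" for x using comm[OF X] by auto
  define Z where "Z x = V x + X x" for x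
  have Z: "bounded_op Z" unfolding Z_def by (intro bounded_op_intros Vop Xop)
  note M = closed_csub_ker[OF Z]
  show ?thesis
  proof (intro exI conjI allI impI)
    show "is_proj (proj {x. Z x = 0})" by (rule is_proj_proj[OF M])
    show "proj {x. Z x = 0} (Y x) = Y (proj {x. Z x = 0} x)" if "selfadj Y" "\<forall>x. Y (X x) = X (Y x)" for Y x
      by (rule proj_ker_commute[OF Z that(1)])
         (use that comm[OF that] in \<open>auto simp: Z_def op_simps selfadj_op\<close>)
  next
    fix x assume "proj {x. Z x = 0} x = x"
    hence "Z x = 0" using proj_in[OF M, of x] by simp
    hence "X x = - V x" by (simp add: Z_def eq_neg_iff_add_eq_0 add.commute)
    thus "inner x (X x) \<le> 0" using positive_inner[OF V, of x] by simp
  next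
    fix x assume x: "proj {x. Z x = 0} x = 0" "inner x (X x) \<le> 0"
    \<comment> \<open>\<open>(V + X) (V - X) = 0\<close>, so the range of \<open>V - X\<close> lies
      in the kernel; a vector orthogonal to the kernel therefore satisfies
      \<open>V x = X x\<close>.\<close>
    have "inner y (V x - X x) = 0" for y
    proof -
      have "Z (V y - X y) = 0" by (simp add: Z_def op_simps Vop Xop VV XV)
      hence "inner (V y - X y) x = 0" using proj_orth[OF M, of "V y - X y" x] x by simp
      thus ?thesis
        by (simp add: inner_diff_left inner_diff_right selfadj_inner[OF X]
            selfadj_inner[OF positive_selfadj[OF V]])
    qed
    hence VX: "V x = X x" by (metis inner_eq_zero_iff right_minus_eq)
    hence "inner x (V x) = 0" using x(2) positive_inner[OF V, of x] by simp
    hence "V x = 0" by (rule positive_inner_eq_0[OF V])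
    hence "Z x = 0" using VX by (simp add: Z_def)
    thus "x = 0" using proj_fix[OF M, of x] x by simp
  qed
qed

subsection \<open>The operators \<open>T\<close> and \<open>R\<close> of a pair of positive operators\<close>

lemma adj_selfadj:
  assumes X: "selfadj X"
  shows "adj X = X"
  unfolding adj_def
proof (rule the_equality)
  show "bounded_op X \<and> (\<forall>x y. cinner (X x) y = cinner x (X y))"
    using X by (simp add: selfadj_op selfadj_cinner)
  fix Y assume Y: "bounded_op Y \<and> (\<forall>x y. cinner (X x) y = cinner x (Y y))"
  have "inner x (Y y - X y) = 0" for x y
  proof -
    have "cinner x (Y y) = cinner x (X y)" using Y selfadj_cinner[OF X, of x y] by simp
    hence "inner x (Y y) = inner x (X y)" by (simp add: inner_eq_Re_cinner)
    thus ?thesis by (simp add: inner_diff_right)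
  qed
  thus "Y = X" by (metis ext inner_eq_zero_iff right_minus_eq)
qed

lemma inner_self_le_zero: "inner x x \<le> 0 \<longleftrightarrow> (x::'a::real_inner) = 0"
  by (metis inner_eq_zero_iff inner_ge_zero order_antisym order_refl)

lemma inner_eq_on_closure:
  fixes X Y :: "'a::complex_hilbert_space \<Rightarrow> real"
  assumes "v \<in> closure S" "\<And>x. isCont X x" "\<And>x. isCont Y x" "\<And>x. x \<in> S \<Longrightarrow> X x \<le> Y x"
  shows "X v \<le> Y v"
proof -
  have "closed {x. X x \<le> Y x}"
    using assms(2,3) by (intro closed_Collect_le continuous_at_imp_continuous_on) auto
  moreover have "S \<subseteq> {x. X x \<le> Y x}" using assms(4) by auto
  ultimately show ?thesis using assms(1) closure_minimal by blast
qed

text \<open>A form of Douglas' lemma.\<close>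

lemma positive_factor:
  assumes T: "selfadj T" and M: "closed_csub M" and ran: "range T \<subseteq> M" and dense: "M \<subseteq> closure (range T)"
    and A: "positive_op A" and le: "\<And>x. inner x (A x) \<le> (norm (T x))\<^sup>2"
  shows "\<exists>R. op_on M R \<and> positive_op R \<and> (\<forall>x. norm (R x) \<le> norm x) \<and> (\<forall>x. T (R (T x)) = A x)"
proof -
  note Top = selfadj_op[OF T] and Aop = positive_op_op[OF A] and ar = closed_csub_arith[OF M]
  have cl: "closure (range T) \<subseteq> M" using ran ar(6) by (rule closure_minimal)
  have zero: "u = 0" if "u \<in> M" "\<And>x. inner (T x) u = 0" for u
  proof -
    have "inner u u \<le> 0"
      by (rule inner_eq_on_closure[of u "range T" "\<lambda>v. inner v u" "\<lambda>v. 0"])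
         (use that dense in \<open>auto intro!: continuous_intros\<close>)
    thus ?thesis by (simp add: inner_self_le_zero)
  qed
  have uniq: "u = v" if "u \<in> M" "v \<in> M" "\<And>x. inner (T x) u = inner (T x) v" for u v
    using zero[of "u - v"] that ar by (simp add: inner_diff_right)
  have sqrt_le: "sqrt (inner x (A x)) \<le> norm (T x)" for x
    using le[of x] by (simp add: real_le_lsqrt positive_inner[OF A])
  \<comment> \<open>\<open>D y\<close> is to become \<open>R (T y)\<close>; it solves
    \<open>T (D y) = A y\<close> in the weak sense. The bound by \<open>norm (T y)\<close> is what
    lets \<open>D\<close> factor through \<open>T\<close>.\<close>
  have "\<exists>u\<in>M. norm u \<le> norm (T y) \<and> (\<forall>x. inner x (A y) = inner (T x) u)" for y
  proof -
    have "\<exists>u\<in>closure (T ` UNIV). norm u \<le> norm (T y) \<and> (\<forall>x\<in>UNIV. inner x (A y) = inner (T x) u)"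
    proof (rule riesz_dense)
      show "linear (\<lambda>x. inner x (A y))" by (simp add: bounded_linear.linear bounded_linear_inner_left)
      show "\<bar>inner x (A y)\<bar> \<le> norm (T y) * norm (T x)" for x
      proof -
        have "\<bar>inner x (A y)\<bar> = sqrt ((inner x (A y))\<^sup>2)" by simp
        also have "\<dots> \<le> sqrt (inner x (A x)) * sqrt (inner y (A y))"
          unfolding real_sqrt_mult[symmetric] by (intro real_sqrt_le_mono positive_cauchy_schwarz A)
        also have "\<dots> \<le> norm (T x) * norm (T y)"
          by (intro mult_mono sqrt_le) (auto simp: positive_inner[OF A])
        finally show ?thesis by (simp add: mult.commute)
      qed
    qed (auto simp: bounded_op_linear[OF Top])
    thus ?thesis using cl by blast
  qed
  then obtain D where D: "\<And>y. D y \<in> M" "\<And>y. norm (D y) \<le> norm (T y)"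
    "\<And>x y. inner (T x) (D y) = inner x (A y)" by metis
  have D_add: "D (x + y) = D x + D y" for x y
    by (rule uniq) (auto simp: D ar inner_add_right op_simps Aop)
  have D_sc: "D (r *\<^sub>R x) = r *\<^sub>R D x" for r x
    by (rule uniq) (auto simp: D ar op_simps Aop)
  have D_J: "D (iC x) = iC (D x)" for x
  proof (rule uniq)
    fix y
    have "inner (T y) (iC (D x)) = - inner (T (iC y)) (D x)"
      by (simp add: bounded_op_iC[OF Top] inner_iC_left)
    thus "inner (T y) (D (iC x)) = inner (T y) (iC (D x))"
      by (simp add: D inner_iC_left bounded_op_iC[OF Aop])
  qed (auto simp: D ar)
  \<comment> \<open>\<open>R\<close> is obtained as the adjoint of the map from \<open>T y\<close>
    to \<open>D y\<close>. It is thereby given on the whole space at once, with no extension from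
    the range of \<open>T\<close> to its closure.\<close>
  have "\<exists>u\<in>M. norm u \<le> norm w \<and> (\<forall>y. inner (D y) w = inner (T y) u)" for w
  proof -
    have "\<exists>u\<in>closure (T ` UNIV). norm u \<le> norm w \<and> (\<forall>y\<in>UNIV. inner (D y) w = inner (T y) u)"
    proof (rule riesz_dense)
      show "linear (\<lambda>y. inner (D y) w)" by (rule linearI) (auto simp: D_add D_sc inner_add_left)
      show "\<bar>inner (D y) w\<bar> \<le> norm w * norm (T y)" for y
        using Cauchy_Schwarz_ineq2[of "D y" w] mult_right_mono[OF D(2)[of y], of "norm w"]
        by (simp add: mult.commute)
    qed (auto simp: bounded_op_linear[OF Top])
    thus ?thesis using cl by blast
  qed
  then obtain R where R: "\<And>w. R w \<in> M" "\<And>w. norm (R w) \<le> norm w"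
    "\<And>y w. inner (T y) (R w) = inner (D y) w" by metis
  have Rop: "bounded_op R"
  proof (rule bounded_opI)
    show "R (x + y) = R x + R y" for x y
      by (rule uniq) (auto simp: R ar inner_add_right)
    show "R (r *\<^sub>R x) = r *\<^sub>R R x" for r x
      by (rule uniq) (auto simp: R ar)
    show "R (iC x) = iC (R x)" for x
    proof (rule uniq)
      fix y
      have "inner (T y) (iC (R x)) = - inner (T (iC y)) (R x)"
        by (simp add: bounded_op_iC[OF Top] inner_iC_left)
      thus "inner (T y) (R (iC x)) = inner (T y) (iC (R x))"
        by (simp add: R D_J inner_iC_left)
    qed (auto simp: R ar)
    show "norm (R x) \<le> 1 * norm x" for x using R by simp
  qed
  \<comment> \<open>Symmetry of \<open>A\<close> identifies the adjoint with the map itself on the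
    range of \<open>T\<close>.\<close>
  have RT: "R (T x) = D x" for x
  proof (rule uniq)
    show "inner (T y) (R (T x)) = inner (T y) (D x)" for y
      by (metis D(3) R(3) inner_commute selfadj_inner[OF positive_selfadj[OF A]])
  qed (auto simp: R D)
  have TRT: "T (R (T x)) = A x" for x
  proof -
    have "inner y (T (R (T x)) - A x) = 0" for y
      by (simp add: inner_diff_right selfadj_inner[OF T, symmetric] RT D)
    thus ?thesis by (metis inner_eq_zero_iff right_minus_eq)
  qed
  have cR: "isCont R x" for x by (rule bounded_op_isCont[OF Rop])
  have kill: "R x = 0" if "\<And>y. y \<in> M \<Longrightarrow> inner y x = 0" for x
    by (rule zero) (auto simp: R D that)
  have op: "op_on M R" by (rule op_onI[OF M Rop R(1) kill])
  have sym1: "inner v (R w) = inner (R v) w" if "v \<in> M" for v w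
  proof -
    have "v \<in> closure (range T)" using that dense by auto
    hence "inner v (R w) \<le> inner (R v) w" "inner (R v) w \<le> inner v (R w)"
      by (rule inner_eq_on_closure, auto intro!: continuous_intros cR simp: RT R)+
    thus ?thesis by simp
  qed
  have pr: "inner v (R w) = inner (proj M v) (R w)" for v w
    using proj_orth[OF M R(1), of w v] by (simp add: inner_diff_right inner_commute)
  have "inner (R v) w = inner v (R w)" for v w
    using sym1[OF proj_in[OF M], of v w] pr op_on_proj[OF op M] by simp
  hence sa: "selfadj R" using Rop by (simp add: selfadj_def)
  have posM: "0 \<le> inner v (R v)" if "v \<in> M" for v
  proof -
    have "v \<in> closure (range T)" using that dense by auto
    thus ?thesis
      by (rule inner_eq_on_closure)
         (auto intro!: continuous_intros cR simp: RT D(3) positive_inner[OF A])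
  qed
  have "positive_op R"
  proof (rule positive_opI[OF sa])
    show "0 \<le> inner x (R x)" for x
      using posM[OF proj_in[OF M], of x] pr[of x x] op_on_proj(1)[OF op M] by simp
  qed
  thus ?thesis using op R(2) TRT by blast
qed

context
  fixes A B :: "'a::complex_hilbert_space \<Rightarrow> 'a"
  assumes A: "positive_op A" and B: "positive_op B"
begin

lemma positive_T_op: "positive_op (T_op A B)"
  unfolding T_op_def by (intro positive_sqrt_op positive_plus A B)

lemma selfadj_T_op: "selfadj (T_op A B)"
  by (rule positive_selfadj[OF positive_T_op])

lemma T_op_T_op: "T_op A B (T_op A B x) = A x + B x"
  unfolding T_op_def by (rule sqrt_op_sqrt_op[OF positive_plus[OF A B]])

lemma norm_T_op: "(norm (T_op A B x))\<^sup>2 = inner x (A x) + inner x (B x)"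
  unfolding T_op_def using norm_sqrt_op[OF positive_plus[OF A B]] by (simp add: inner_add_right)

lemma closed_csub_H_sp: "closed_csub (H_sp A B)"
  unfolding H_sp_def by (intro closed_csub_range bounded_op_plus positive_op_op A B)

text \<open>\<open>H_sp\<close> is the closed range of \<open>A + B\<close>, the square of
  \<open>T\<close>, so an argument is needed: the component \<open>u\<close> of \<open>T x\<close>
  orthogonal to it satisfies \<open>inner (T (T u)) u = 0\<close>, hence \<open>T u = 0\<close>, and
  then \<open>u\<close> is orthogonal to \<open>T x\<close> as well.\<close>

lemma T_op_in_H_sp: "T_op A B x \<in> H_sp A B"
proof -
  define u where "u = T_op A B x - proj (H_sp A B) (T_op A B x)"
  have orth: "inner y u = 0" if "y \<in> H_sp A B" for y
    unfolding u_def by (rule proj_orth[OF closed_csub_H_sp that])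
  have "inner (A y + B y) u = 0" for y
    by (rule orth) (auto simp: H_sp_def intro: closure_subset[THEN subsetD])
  hence "inner (T_op A B (T_op A B u)) u = 0" by (simp add: T_op_T_op)
  hence "inner (T_op A B u) (T_op A B u) = 0" by (simp add: selfadj_inner[OF selfadj_T_op])
  hence "T_op A B u = 0" by simp
  hence "inner (T_op A B x) u = 0" by (simp add: selfadj_inner[OF selfadj_T_op])
  moreover have "inner (proj (H_sp A B) (T_op A B x)) u = 0"
    by (rule orth[OF proj_in[OF closed_csub_H_sp]])
  ultimately have "inner u u = 0" by (subst (1) u_def) (simp add: inner_diff_left)
  thus ?thesis using proj_in[OF closed_csub_H_sp, of "T_op A B x"] by (simp add: u_def)
qed

lemma H_sp_subset: "H_sp A B \<subseteq> closure (range (T_op A B))"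
  unfolding H_sp_def by (rule closure_mono) (auto simp: T_op_T_op[symmetric])

text \<open>Density of the range of \<open>T\<close> in \<open>H_sp\<close> is used on both sides of
  \<open>Z = X - Y\<close>: \<open>T Z T = 0\<close> gives \<open>Z T = 0\<close> because
  \<open>Z\<close> maps into \<open>H_sp\<close>, and then \<open>Z = 0\<close> by
  continuity.\<close>

lemma op_on_H_sp_eqI:
  assumes X: "op_on (H_sp A B) X" and Y: "op_on (H_sp A B) Y"
    and eq: "\<And>x. T_op A B (X (T_op A B x)) = T_op A B (Y (T_op A B x))"
  shows "X = Y"
proof
  fix x
  let ?M = "H_sp A B" let ?T = "T_op A B"
  define Z where "Z x = X x - Y x" for x
  have Z: "op_on ?M Z"
  proof (rule op_onI[OF closed_csub_H_sp])
    show "bounded_op Z" unfolding Z_def using X Y by (intro bounded_op_intros) (auto simp: op_on_def)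
    show "Z x \<in> ?M" for x
      unfolding Z_def using X Y by (intro closed_csub_arith(3)[OF closed_csub_H_sp]) (auto simp: op_on_def)
    show "(\<And>y. y \<in> ?M \<Longrightarrow> inner y x = 0) \<Longrightarrow> Z x = 0" for x
      using op_on_orth[OF X closed_csub_H_sp] op_on_orth[OF Y closed_csub_H_sp] by (simp add: Z_def)
  qed
  have Zop: "bounded_op Z" and Zin: "Z x \<in> ?M" for x using Z by (auto simp: op_on_def)
  have TZ: "?T (Z (?T x)) = 0" for x
    using eq by (simp add: Z_def op_simps positive_op_op[OF positive_T_op])
  have ZT: "Z (?T x) = 0" for x
  proof -
    have "inner (Z (?T x)) (Z (?T x)) \<le> 0"
      by (rule inner_eq_on_closure[of _ "range ?T" "\<lambda>v. inner v (Z (?T x))" "\<lambda>v. 0"])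
         (use Zin H_sp_subset in \<open>auto intro!: continuous_intros simp: selfadj_inner[OF selfadj_T_op] TZ\<close>)
    thus ?thesis by (simp add: inner_self_le_zero)
  qed
  have "Z (proj ?M x) = 0"
  proof -
    have "inner (Z (proj ?M x)) (Z (proj ?M x)) \<le> 0"
      by (rule inner_eq_on_closure[of "proj ?M x" "range ?T" "\<lambda>v. inner (Z v) (Z v)" "\<lambda>v. 0"])
         (use proj_in[OF closed_csub_H_sp] H_sp_subset ZT in
           \<open>auto intro!: continuous_intros bounded_op_isCont[OF Zop]\<close>)
    thus ?thesis by (simp add: inner_self_le_zero)
  qed
  thus "X x = Y x" using op_on_proj(1)[OF Z closed_csub_H_sp, of x] by (simp add: Z_def)
qed

lemma R_op_props:
  shows op_on_R_op: "op_on (H_sp A B) (R_op A B)" and positive_R_op: "positive_op (R_op A B)"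
    and R_op_le: "inner x (R_op A B x) \<le> (norm x)\<^sup>2"
    and A_eq_T_R_T: "A x = T_op A B (R_op A B (T_op A B x))"
    and B_eq_T_S_T: "B x = T_op A B (T_op A B x - R_op A B (T_op A B x))"
proof -
  let ?M = "H_sp A B" let ?T = "T_op A B"
  have ran: "range ?T \<subseteq> ?M" using T_op_in_H_sp by auto
  obtain R where R: "op_on ?M R" "positive_op R" "\<And>x. norm (R x) \<le> norm x" "\<And>x. ?T (R (?T x)) = A x"
    using positive_factor[OF selfadj_T_op closed_csub_H_sp ran H_sp_subset A]
    by (auto simp: norm_T_op positive_inner[OF B])
  obtain S where S: "op_on ?M S" "positive_op S" "\<And>x. norm (S x) \<le> norm x" "\<And>x. ?T (S (?T x)) = B x"
    using positive_factor[OF selfadj_T_op closed_csub_H_sp ran H_sp_subset B]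
    by (auto simp: norm_T_op positive_inner[OF A])
  note Top = positive_op_op[OF positive_T_op] and Rop = positive_op_op[OF R(2)] and Sop = positive_op_op[OF S(2)]
  note P = is_proj_proj[OF closed_csub_H_sp]
  \<comment> \<open>\<open>R\<close> and \<open>S\<close> come from separate factorizations; they
    are complementary because \<open>T (R + S) T = A + B = T P T\<close> for the projection
    \<open>P\<close> onto \<open>H_sp\<close>.\<close>
  have "(\<lambda>x. R x + S x) = proj ?M"
  proof (rule op_on_H_sp_eqI)
    show "op_on ?M (\<lambda>x. R x + S x)"
    proof (rule op_onI[OF closed_csub_H_sp])
      show "bounded_op (\<lambda>x. R x + S x)" by (intro bounded_op_intros Rop Sop)
      show "R x + S x \<in> ?M" for x
        using R(1) S(1) by (intro closed_csub_arith(2)[OF closed_csub_H_sp]) (auto simp: op_on_def)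
      show "(\<And>y. y \<in> ?M \<Longrightarrow> inner y x = 0) \<Longrightarrow> R x + S x = 0" for x
        using op_on_orth[OF R(1) closed_csub_H_sp] op_on_orth[OF S(1) closed_csub_H_sp] by simp
    qed
    show "op_on ?M (proj ?M)"
      by (rule op_onI[OF closed_csub_H_sp is_proj_op[OF P]])
         (auto intro: proj_in[OF closed_csub_H_sp] proj_orth_eq_0[OF closed_csub_H_sp])
    show "?T (R (?T x) + S (?T x)) = ?T (proj ?M (?T x))" for x
      by (simp add: bounded_op_add[OF Top] R S proj_fix[OF closed_csub_H_sp T_op_in_H_sp] T_op_T_op)
  qed
  hence RS: "R x + S x = proj ?M x" for x by (rule fun_cong)
  have "R_op A B = R" unfolding R_op_def
  proof (rule the_equality)
    have "adj ?T = ?T" by (rule adj_selfadj[OF selfadj_T_op])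
    thus "\<exists>S. positive_contraction_on ?M R \<and> positive_contraction_on ?M S \<and>
       (\<forall>x\<in>?M. R x + S x = x) \<and> A = adj ?T \<circ> R \<circ> ?T \<and> B = adj ?T \<circ> S \<circ> ?T"
      using R S RS by (intro exI[of _ S])
        (auto simp: positive_contraction_on_def positive_op_def fun_eq_iff proj_fix[OF closed_csub_H_sp])
    fix R' assume "\<exists>S. positive_contraction_on ?M R' \<and> positive_contraction_on ?M S \<and>
       (\<forall>x\<in>?M. R' x + S x = x) \<and> A = adj ?T \<circ> R' \<circ> ?T \<and> B = adj ?T \<circ> S \<circ> ?T"
    hence "op_on ?M R'" "A = ?T \<circ> R' \<circ> ?T"
      using \<open>adj ?T = ?T\<close> by (auto simp: positive_contraction_on_def)
    moreover from this(2) have "?T (R' (?T x)) = ?T (R (?T x))" for x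
      using R(4) by (metis comp_apply)
    ultimately show "R' = R" using R(1) by (intro op_on_H_sp_eqI) auto
  qed
  moreover have "inner x (R x) \<le> (norm x)\<^sup>2"
    using norm_cauchy_schwarz[of x "R x"] mult_left_mono[OF R(3)[of x], of "norm x"]
    by (simp add: power2_eq_square)
  moreover have "B x = ?T (?T x - R (?T x))"
  proof -
    have "?T x - R (?T x) = S (?T x)"
      using RS[of "?T x"] proj_fix[OF closed_csub_H_sp T_op_in_H_sp, of x] by (simp add: algebra_simps)
    thus ?thesis by (simp add: S)
  qed
  ultimately show "op_on (H_sp A B) (R_op A B)" "positive_op (R_op A B)"
    "inner x (R_op A B x) \<le> (norm x)\<^sup>2" "A x = T_op A B (R_op A B (T_op A B x))"
    "B x = T_op A B (T_op A B x - R_op A B (T_op A B x))"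
    using R by auto
qed

end

section \<open>The spectral theorem for positive contractions\<close>

text \<open>The order of projections is phrased with norms since the squared norms will be values of
  measures. The hypothesis at \<open>x - Q x\<close> gives \<open>E (x - Q x) = 0\<close>.\<close>

lemma is_proj_le:
  assumes E: "is_proj E" and Q: "is_proj Q" and le: "\<And>x. norm (E x) \<le> norm (Q x)"
  shows "E (Q x) = E x" "Q (E x) = E x"
proof -
  have *: "E (Q x) = E x" for x
    using le[of "x - Q x"] by (simp add: op_simps is_proj_op[OF Q] is_proj_op[OF E] is_proj_idem[OF Q])
  show "E (Q x) = E x" by (rule *)
  have "inner y (Q (E x) - E x) = 0" for y
    by (simp add: inner_diff_right selfadj_inner[OF is_proj_selfadj[OF E], symmetric]
        selfadj_inner[OF is_proj_selfadj[OF Q], symmetric] *)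
  thus "Q (E x) = E x" by (metis inner_eq_zero_iff right_minus_eq)
qed

lemma is_proj_diff:
  assumes E: "is_proj E" and Q: "is_proj Q" and le: "\<And>x. norm (E x) \<le> norm (Q x)"
  shows "is_proj (\<lambda>x. Q x - E x)" "(norm (Q x - E x))\<^sup>2 = (norm (Q x))\<^sup>2 - (norm (E x))\<^sup>2"
proof -
  show *: "is_proj (\<lambda>x. Q x - E x)"
    unfolding is_proj_def using is_proj_le[OF assms] selfadj_sub[OF is_proj_selfadj[OF Q] is_proj_selfadj[OF E]]
    by (auto simp: op_simps is_proj_op[OF E] is_proj_op[OF Q] is_proj_idem[OF E] is_proj_idem[OF Q])
  show "(norm (Q x - E x))\<^sup>2 = (norm (Q x))\<^sup>2 - (norm (E x))\<^sup>2"
    using is_proj_inner[OF *, of x] is_proj_inner[OF Q, of x] is_proj_inner[OF E, of x]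
    by (simp add: inner_diff_right)
qed

text \<open>At \<open>Q x\<close> the hypothesis leaves no room for \<open>E (Q x)\<close>. This is
  how disjointness of sets turns into orthogonality of ranges.\<close>

lemma is_proj_add:
  assumes E: "is_proj E" and Q: "is_proj Q" and le: "\<And>x. (norm (E x))\<^sup>2 + (norm (Q x))\<^sup>2 \<le> (norm x)\<^sup>2"
  shows "is_proj (\<lambda>x. E x + Q x)" "E (Q x) = 0"
proof -
  have EQ: "E (Q x) = 0" for x using le[of "Q x"] by (simp add: is_proj_idem[OF Q])
  have QE: "Q (E x) = 0" for x using le[of "E x"] by (simp add: is_proj_idem[OF E])
  show "E (Q x) = 0" by (rule EQ)
  show "is_proj (\<lambda>x. E x + Q x)"
    unfolding is_proj_def using EQ QE selfadj_plus[OF is_proj_selfadj[OF E] is_proj_selfadj[OF Q]]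
    by (auto simp: op_simps is_proj_op[OF E] is_proj_op[OF Q] is_proj_idem[OF E] is_proj_idem[OF Q])
qed

text \<open>For ordered projections the squared distance of two vectors \<open>S n x\<close> is the
  difference of their squared norms, and those form a bounded increasing sequence.\<close>

lemma is_proj_limit:
  fixes S :: "nat \<Rightarrow> 'a::complex_hilbert_space \<Rightarrow> 'a"
  assumes S: "\<And>n. is_proj (S n)" and mono: "\<And>n x. norm (S n x) \<le> norm (S (Suc n) x)"
  shows "\<exists>E. is_proj E \<and> (\<forall>x. (\<lambda>n. S n x) \<longlonglongrightarrow> E x)"
proof -
  have le: "norm (S n x) \<le> norm (S m x)" if "n \<le> m" for n m x
    using that by (rule lift_Suc_mono_le[rotated]) (rule mono)
  have "convergent (\<lambda>n. S n x)" for x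
  proof (rule Cauchy_convergent, rule metric_CauchyI)
    fix e :: real assume "0 < e"
    have "incseq (\<lambda>n. (norm (S n x))\<^sup>2)"
      by (rule incseq_SucI) (simp add: mono power_mono)
    moreover have "(norm (S n x))\<^sup>2 \<le> (norm x)\<^sup>2" for n
      by (simp add: is_proj_norm_le[OF S] power_mono)
    ultimately have "Cauchy (\<lambda>n. (norm (S n x))\<^sup>2)"
      using incseq_convergent[of "\<lambda>n. (norm (S n x))\<^sup>2" "(norm x)\<^sup>2"] LIMSEQ_imp_Cauchy by metis
    from metric_CauchyD[OF this, of "e\<^sup>2"] \<open>0 < e\<close> obtain N
      where N: "\<And>m n. m \<ge> N \<Longrightarrow> n \<ge> N \<Longrightarrow> \<bar>(norm (S m x))\<^sup>2 - (norm (S n x))\<^sup>2\<bar> < e\<^sup>2"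
      by (auto simp: dist_real_def)
    have "dist (S m x) (S n x) < e" if "n \<le> m" "N \<le> n" for m n
    proof -
      have "(norm (S m x - S n x))\<^sup>2 < e\<^sup>2"
        using is_proj_diff(2)[OF S S le[OF that(1)], of x] N[of m n] that by auto
      thus ?thesis using \<open>0 < e\<close> by (auto simp: dist_norm intro: power2_less_imp_less)
    qed
    thus "\<exists>M. \<forall>m\<ge>M. \<forall>n\<ge>M. dist (S m x) (S n x) < e"
      by (metis dist_commute nle_le)
  qed
  then obtain E where lim: "\<And>x. (\<lambda>n. S n x) \<longlonglongrightarrow> E x"
    unfolding convergent_def by metis
  note op = is_proj_op[OF S]
  have "bounded_op E"
  proof (rule bounded_opI)
    show "E (x + y) = E x + E y" for x y
      by (rule LIMSEQ_unique[OF lim]) (simp add: bounded_op_add[OF op] tendsto_add lim)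
    show "E (r *\<^sub>R x) = r *\<^sub>R E x" for r x
      by (rule LIMSEQ_unique[OF lim]) (simp add: bounded_op_scaleR[OF op] tendsto_scaleR lim)
    show "E (iC x) = iC (E x)" for x
      by (rule LIMSEQ_unique[OF lim])
         (simp add: bounded_op_iC[OF op] bounded_linear.tendsto[OF bounded_linear_iC] lim)
    show "norm (E x) \<le> 1 * norm x" for x
      using LIMSEQ_le_const2[OF tendsto_norm[OF lim]] is_proj_norm_le[OF S] by auto
  qed
  moreover have "inner (E x) y = inner x (E y)" for x y
  proof (rule LIMSEQ_unique)
    show "(\<lambda>n. inner (S n x) y) \<longlonglongrightarrow> inner (E x) y" by (intro tendsto_intros lim)
    show "(\<lambda>n. inner (S n x) y) \<longlonglongrightarrow> inner x (E y)"
      unfolding selfadj_inner[OF is_proj_selfadj[OF S]] by (intro tendsto_intros lim)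
  qed
  moreover have SE: "S n (E x) = S n x" for n x
  proof (rule LIMSEQ_unique)
    show "(\<lambda>m. S n (S m x)) \<longlonglongrightarrow> S n (E x)" by (rule bounded_op_tendsto[OF op lim])
    show "(\<lambda>m. S n (S m x)) \<longlonglongrightarrow> S n x"
      by (rule tendsto_eventually, rule eventually_sequentiallyI[of n])
         (simp add: is_proj_le[OF S S le])
  qed
  have "E (E x) = E x" for x
    by (rule LIMSEQ_unique[OF lim]) (simp add: SE lim)
  ultimately show ?thesis using lim by (auto simp: is_proj_def selfadj_def)
qed

lemma selfadj_eqI:
  assumes X: "selfadj X" and Y: "selfadj Y" and eq: "\<And>x. inner x (X x) = inner x (Y x)"
  shows "X x = Y x"
proof -
  have "inner u (X v) = inner u (Y v)" for u v
    using eq[of "u + v"] eq[of u] eq[of v] selfadj_inner[OF X, of u v] selfadj_inner[OF Y, of u v]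
    by (simp add: op_simps selfadj_op X Y inner_add_left inner_add_right inner_commute)
  hence "inner u (X x - Y x) = 0" for u by (simp add: inner_diff_right)
  thus ?thesis by (metis inner_eq_zero_iff right_minus_eq)
qed

section \<open>Scalar measures of a resolution of the identity\<close>

lemma measure_of_emeasure:
  fixes M :: "real measure"
  assumes "sets M = sets borel" "space M = UNIV" "\<And>N. N \<in> sets borel \<Longrightarrow> emeasure M N = \<nu> N"
  shows "measure_of UNIV (sets borel) \<nu> = M"
proof -
  have "sigma_sets UNIV (sets borel) = sets (borel :: real measure)"
    using sets.sigma_sets_eq[of "borel :: real measure"] by simp
  hence "measure_of UNIV (sets borel) \<nu> = measure_of UNIV (sets borel) (emeasure M)"
    using assms(3) by (intro measure_of_eq) auto
  also have "\<dots> = measure_of (space M) (sets M) (emeasure M)" by (simp add: assms)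
  finally show ?thesis by (simp add: measure_of_of_measure)
qed

text \<open>A right continuous resolution of the identity on the range of \<open>Q\<close>, with
  spectrum in [0,1]. Right continuity along one sequence is enough for the distribution functions,
  because the norms are monotone in the parameter.\<close>

locale spectral_family =
  fixes G :: "real \<Rightarrow> 'a::complex_hilbert_space \<Rightarrow> 'a" and Q :: "'a \<Rightarrow> 'a"
  assumes proj_G: "\<And>t. is_proj (G t)" and proj_Q: "is_proj Q"
    and G_mono: "\<And>s t x. s \<le> t \<Longrightarrow> norm (G s x) \<le> norm (G t x)"
    and G_neg: "\<And>t x. t < 0 \<Longrightarrow> G t x = 0" and G_ge1: "\<And>t x. 1 \<le> t \<Longrightarrow> G t x = Q x"
    and G_right: "\<And>s x. (\<lambda>n. G (s + 1 / (real n + 1)) x) \<longlonglongrightarrow> G s x"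
begin

definition F :: "'a \<Rightarrow> real \<Rightarrow> real" where "F x t = (norm (G t x))\<^sup>2"

lemma F_mono: "s \<le> t \<Longrightarrow> F x s \<le> F x t"
  by (simp add: F_def G_mono power_mono)

lemma F_right: "continuous (at_right s) (F x)"
  unfolding continuous_within
proof (rule order_tendstoI)
  fix a assume "a < F x s"
  show "\<forall>\<^sub>F t in at_right s. a < F x t"
    using eventually_at_right_less
    by eventually_elim (rule less_le_trans[OF \<open>a < F x s\<close> F_mono], simp)
next
  fix a assume a: "F x s < a"
  have "(\<lambda>n. F x (s + 1 / (real n + 1))) \<longlonglongrightarrow> F x s"
    unfolding F_def by (intro tendsto_intros G_right)
  from order_tendstoD(2)[OF this a] obtain n where n: "F x (s + 1 / (real n + 1)) < a"
    by (auto simp: eventually_sequentially)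
  have "\<forall>\<^sub>F t in at_right s. t \<in> {s<..<s + 1 / (real n + 1)}"
    by (rule eventually_at_right_real) simp
  thus "\<forall>\<^sub>F t in at_right s. F x t < a"
    by eventually_elim (use n F_mono in \<open>meson greaterThanLessThan_iff le_less_trans less_imp_le\<close>)
qed

definition \<mu> :: "'a \<Rightarrow> real measure" where "\<mu> x = interval_measure (F x)"

lemma sets_\<mu> [simp]: "sets (\<mu> x) = sets borel" and space_\<mu> [simp]: "space (\<mu> x) = UNIV"
  by (auto simp: \<mu>_def)

lemma F_bot: "(F x \<longlongrightarrow> 0) at_bot"
  by (rule tendsto_eventually)
     (use eventually_gt_at_bot[of 0] in \<open>auto simp: F_def G_neg eventually_at_bot_dense intro!: exI[of _ 0]\<close>)

lemma emeasure_\<mu>_Iic: "emeasure (\<mu> x) {..t} = ennreal (F x t)"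
  and measure_\<mu>_Iic: "measure (\<mu> x) {..t} = F x t"
  unfolding \<mu>_def
  by (rule emeasure_interval_measure_Iic measure_interval_measure_Iic, rule F_mono, assumption, rule F_right, rule F_bot)+

lemma measure_\<mu>_Ioc: "s \<le> t \<Longrightarrow> measure (\<mu> x) {s<..t} = F x t - F x s"
  unfolding \<mu>_def by (rule measure_interval_measure_Ioc) (auto intro: F_mono F_right)

lemma emeasure_\<mu>_gt1: "emeasure (\<mu> x) {1<..} = 0"
proof -
  have "emeasure (\<mu> x) {1<..1 + real n} = 0" for n
    unfolding \<mu>_def
    by (subst emeasure_interval_measure_Ioc, simp, rule F_mono, assumption, rule F_right)
       (simp add: F_def G_ge1)
  hence "emeasure (\<mu> x) (\<Union>n. {1<..1 + real n}) = 0"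
    by (intro emeasure_UN_eq_0) auto
  moreover have "(\<Union>n. {1<..1 + real n}) = {1<..}"
  proof (intro equalityI subsetI)
    fix r :: real assume "r \<in> {1<..}"
    moreover obtain n where "r \<le> real n" using real_arch_simple by blast
    ultimately show "r \<in> (\<Union>n. {1<..1 + real n})" by (auto intro!: exI[of _ n])
  qed auto
  ultimately show ?thesis by simp
qed

lemma emeasure_\<mu>_UNIV: "emeasure (\<mu> x) UNIV = ennreal ((norm (Q x))\<^sup>2)"
proof -
  have "emeasure (\<mu> x) ({..1} \<union> {1<..}) = emeasure (\<mu> x) {..1} + emeasure (\<mu> x) {1<..}"
    by (intro plus_emeasure[symmetric]) auto
  moreover have "{..1} \<union> {1<..} = (UNIV :: real set)" by auto
  ultimately show ?thesis by (simp add: emeasure_\<mu>_gt1 emeasure_\<mu>_Iic F_def G_ge1)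
qed

lemma finite_\<mu>: "finite_measure (\<mu> x)"
  by (rule finite_measureI) (simp add: emeasure_\<mu>_UNIV)

lemma measure_\<mu>_UNIV: "measure (\<mu> x) UNIV = (norm (Q x))\<^sup>2"
  by (simp add: measure_def emeasure_\<mu>_UNIV)

lemma measure_\<mu>_le: "measure (\<mu> x) N \<le> (norm (Q x))\<^sup>2"
  using finite_measure.bounded_measure[OF finite_\<mu>, of x N] by (simp add: measure_\<mu>_UNIV)

lemma AE_\<mu>: "AE r in \<mu> x. r \<in> {0..1}"
proof -
  \<comment> \<open>The null rays stop short of 0, which may be an atom.\<close>
  have "emeasure (\<mu> x) {..- 1 / (real n + 1)} = 0" for n
    by (simp add: emeasure_\<mu>_Iic F_def G_neg)
  hence "AE r in \<mu> x. \<not> r \<le> - 1 / (real n + 1)" for n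
    by (intro AE_I[of _ _ "{..- 1 / (real n + 1)}"]) auto
  hence "AE r in \<mu> x. \<forall>n. \<not> r \<le> - 1 / (real n + 1)" by (simp add: AE_all_countable)
  moreover have "AE r in \<mu> x. \<not> 1 < r"
    by (intro AE_I[of _ _ "{1<..}"]) (auto simp: emeasure_\<mu>_gt1)
  ultimately show ?thesis
  proof eventually_elim
    case (elim r)
    have "0 \<le> r"
    proof (rule ccontr)
      assume "\<not> 0 \<le> r"
      then obtain n where "1 / (real n + 1) < - r"
        using reals_Archimedean[of "- r"] by (auto simp: inverse_eq_divide add.commute)
      thus False using elim(1) by (auto simp: not_le dest!: spec[of _ n])
    qed
    thus ?case using elim(2) by auto
  qed
qed

text \<open>The sets that carry a projection form a Dynkin system, because increasing sequences of
  projections converge.\<close>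

lemma projection_of_set:
  assumes "N \<in> sets borel"
  shows "\<exists>E. is_proj E \<and> (\<forall>x. (norm (E x))\<^sup>2 = measure (\<mu> x) N)"
proof -
  have "Int_stable (range (atMost :: real \<Rightarrow> real set))"
    by (auto simp: Int_stable_def)
  moreover have "range (atMost :: real \<Rightarrow> real set) \<subseteq> Pow UNIV" by auto
  moreover have "N \<in> sigma_sets UNIV (range atMost)"
    using assms by (simp add: borel_eq_atMost)
  ultimately show ?thesis
  proof (induction rule: sigma_sets_induct_disjoint)
    case (basic A)
    then obtain t where "A = {..t}" by auto
    thus ?case using proj_G by (auto simp: measure_\<mu>_Iic F_def)
  next
    case empty
    show ?case by (rule exI[of _ "\<lambda>x. 0"]) (simp add: is_proj_zero)
  next
    case (compl A)
    then obtain E where E: "is_proj E" "\<And>x. (norm (E x))\<^sup>2 = measure (\<mu> x) A" by blast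
    have A: "A \<in> sets borel" using compl(1) by (simp add: borel_eq_atMost)
    \<comment> \<open>The whole line corresponds to \<open>Q\<close>, so complements are taken below
      \<open>Q\<close>.\<close>
    have le: "norm (E x) \<le> norm (Q x)" for x
      using measure_\<mu>_le[of x A] E(2) by (metis norm_ge_zero power2_le_imp_le)
    have "measure (\<mu> x) (UNIV - A) = measure (\<mu> x) UNIV - measure (\<mu> x) A" for x
      using finite_measure.finite_measure_compl[OF finite_\<mu>, of A x] A by simp
    with is_proj_diff[OF E(1) proj_Q le] show ?case
      by (intro exI[of _ "\<lambda>x. Q x - E x"]) (simp add: E(2) measure_\<mu>_UNIV)
  next
    case (union A)
    have A: "A i \<in> sets borel" for i using union(2) by (auto simp: borel_eq_atMost)
    from union(3) obtain E where E: "\<And>i. is_proj (E i)" "\<And>i x. (norm (E i x))\<^sup>2 = measure (\<mu> x) (A i)"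
      by metis
    define S where "S n x = (\<Sum>i<n. E i x)" for n x
    have meas: "measure (\<mu> x) (\<Union>i<Suc n. A i) = measure (\<mu> x) (\<Union>i<n. A i) + measure (\<mu> x) (A n)" for n x
    proof -
      have "(\<Union>i<n. A i) \<inter> A n = {}"
        using disjoint_family_onD[OF union(1)] by (auto simp: disjoint_iff) (metis UNIV_I disjoint_iff less_irrefl)
      hence "measure (\<mu> x) ((\<Union>i<n. A i) \<union> A n) = measure (\<mu> x) (\<Union>i<n. A i) + measure (\<mu> x) (A n)"
        using A by (intro finite_measure.finite_measure_Union[OF finite_\<mu>]) auto
      thus ?thesis by (simp add: lessThan_Suc Un_commute)
    qed
    have S: "is_proj (S n) \<and> (\<forall>x. (norm (S n x))\<^sup>2 = measure (\<mu> x) (\<Union>i<n. A i))" for n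
    proof (induction n)
      case 0
      show ?case by (simp add: S_def is_proj_zero)
    next
      case (Suc n)
      have eq: "S (Suc n) = (\<lambda>x. S n x + E n x)" by (simp add: S_def fun_eq_iff)
      \<comment> \<open>Disjointness enters through this bound: it makes the new range orthogonal to
        the previous ones.\<close>
      have le: "(norm (S n x))\<^sup>2 + (norm (E n x))\<^sup>2 \<le> (norm x)\<^sup>2" for x
      proof -
        have "(norm (S n x))\<^sup>2 + (norm (E n x))\<^sup>2 = measure (\<mu> x) (\<Union>i<Suc n. A i)"
          by (simp only: meas) (simp add: Suc E)
        also have "\<dots> \<le> (norm (Q x))\<^sup>2" by (rule measure_\<mu>_le)
        also have "\<dots> \<le> (norm x)\<^sup>2" by (simp add: is_proj_norm_le[OF proj_Q] power_mono)
        finally show ?thesis .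
      qed
      have P: "is_proj (S (Suc n))" unfolding eq using is_proj_add(1)[OF _ E(1) le] Suc by auto
      have "(norm (S (Suc n) x))\<^sup>2 = measure (\<mu> x) (\<Union>i<Suc n. A i)" for x
      proof -
        have "(norm (S (Suc n) x))\<^sup>2 = inner x (S n x) + inner x (E n x)"
          using is_proj_inner[OF P, of x] by (simp add: eq inner_add_right)
        also have "\<dots> = measure (\<mu> x) (\<Union>i<Suc n. A i)"
          using Suc E(1) by (simp only: meas) (simp add: is_proj_inner E)
        finally show ?thesis .
      qed
      thus ?case using P by auto
    qed
    have mono: "norm (S n x) \<le> norm (S (Suc n) x)" for n x
    proof -
      have "(norm (S n x))\<^sup>2 \<le> (norm (S (Suc n) x))\<^sup>2"
        using S[of n] S[of "Suc n"] meas[of x n] by simp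
      thus ?thesis by (simp add: power2_le_iff_abs_le)
    qed
    obtain P where P: "is_proj P" "\<And>x. (\<lambda>n. S n x) \<longlonglongrightarrow> P x"
      using is_proj_limit[of S] S mono by blast
    have "(norm (P x))\<^sup>2 = measure (\<mu> x) (\<Union>i. A i)" for x
    proof (rule LIMSEQ_unique)
      show "(\<lambda>n. (norm (S n x))\<^sup>2) \<longlonglongrightarrow> (norm (P x))\<^sup>2" by (intro tendsto_intros P)
      have "(\<lambda>i. measure (\<mu> x) (A i)) sums measure (\<mu> x) (\<Union>i. A i)"
        using A union(1) by (intro finite_measure.finite_measure_UNION[OF finite_\<mu>]) auto
      moreover have "(norm (S n x))\<^sup>2 = (\<Sum>i<n. measure (\<mu> x) (A i))" for n
      proof -
        have "measure (\<mu> x) (\<Union>i<n. A i) = (\<Sum>i<n. measure (\<mu> x) (A i))"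
          by (induction n) (simp, simp only: meas sum.lessThan_Suc)
        thus ?thesis using S by simp
      qed
      ultimately show "(\<lambda>n. (norm (S n x))\<^sup>2) \<longlonglongrightarrow> measure (\<mu> x) (\<Union>i. A i)"
        by (simp add: sums_def)
    qed
    thus ?case using P by blast
  qed
qed

end

text \<open>The projection for the half-line up to \<open>t\<close>, described by forms and
  commutation in place of a functional calculus: the form is at most \<open>t\<close> on the range,
  and no nonzero vector of the orthogonal complement has this property.\<close>

definition spectral_proj :: "('a::complex_hilbert_space \<Rightarrow> 'a) \<Rightarrow> real \<Rightarrow> ('a \<Rightarrow> 'a) \<Rightarrow> bool" where
  "spectral_proj R t P \<longleftrightarrow> is_proj P \<and>
    (\<forall>Y x. selfadj Y \<longrightarrow> (\<forall>x. Y (R x) = R (Y x)) \<longrightarrow> P (Y x) = Y (P x)) \<and>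
    (\<forall>x. P x = x \<longrightarrow> inner x (R x) \<le> t * (norm x)\<^sup>2) \<and>
    (\<forall>x. P x = 0 \<longrightarrow> inner x (R x) \<le> t * (norm x)\<^sup>2 \<longrightarrow> x = 0)"

lemma spectral_proj_exists:
  assumes R: "selfadj R"
  shows "\<exists>P. spectral_proj R t P"
proof -
  have "selfadj (\<lambda>x. R x - t *\<^sub>R x)" by (intro selfadj_intros R)
  from spectral_projection[OF this] obtain P where P: "is_proj P"
    "\<forall>Y x. selfadj Y \<longrightarrow> (\<forall>x. Y (R x - t *\<^sub>R x) = R (Y x) - t *\<^sub>R Y x) \<longrightarrow> P (Y x) = Y (P x)"
    "\<forall>x. P x = x \<longrightarrow> inner x (R x - t *\<^sub>R x) \<le> 0"
    "\<forall>x. P x = 0 \<longrightarrow> inner x (R x - t *\<^sub>R x) \<le> 0 \<longrightarrow> x = 0" by blast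
  have "P (Y x) = Y (P x)" if Y: "selfadj Y" "\<forall>x. Y (R x) = R (Y x)" for Y x
  proof -
    have "\<forall>x. Y (R x - t *\<^sub>R x) = R (Y x) - t *\<^sub>R Y x"
      using Y by (simp add: op_simps selfadj_op)
    thus ?thesis using P(2) Y(1) by blast
  qed
  moreover have "inner x (R x - t *\<^sub>R x) = inner x (R x) - t * (norm x)\<^sup>2" for x
    by (simp add: inner_diff_right power2_norm_eq_inner)
  ultimately have "spectral_proj R t P" using P(1,3,4) by (auto simp: spectral_proj_def)
  thus ?thesis by (intro exI[of _ P])
qed

theorem spectral_measure_exists:
  assumes M: "closed_csub M" and RM: "op_on M R" and R: "positive_op R"
    and R1: "\<And>x. inner x (R x) \<le> (norm x)\<^sup>2"
  shows "\<exists>E. is_spectral_measure M R E"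
proof -
  note sR = positive_selfadj[OF R] and Rop = positive_op_op[OF R]
  define Q where "Q = proj M"
  have Q: "is_proj Q" unfolding Q_def by (rule is_proj_proj[OF M])
  have QR: "Q (R x) = R (Q x)" for x using op_on_proj[OF RM M] by (simp add: Q_def)
  obtain P where sp: "\<And>t. spectral_proj R t (P t)"
    using spectral_proj_exists[OF sR] by metis
  have P: "is_proj (P t)" for t using sp[of t] by (simp add: spectral_proj_def)
  have comm: "P t (Y x) = Y (P t x)" if "selfadj Y" "\<And>x. Y (R x) = R (Y x)" for t Y x
    using sp[of t] that by (simp add: spectral_proj_def)
  have up: "inner x (R x) \<le> t * (norm x)\<^sup>2" if "P t x = x" for t x
    using sp[of t] that by (simp add: spectral_proj_def)
  have low: "x = 0" if "P t x = 0" "inner x (R x) \<le> t * (norm x)\<^sup>2" for t x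
    using sp[of t] that by (simp add: spectral_proj_def)
  note Pop = is_proj_op[OF P]
  have PR: "P t (R x) = R (P t x)" for t x by (rule comm[OF sR]) simp
  have PQ: "P t (Q x) = Q (P t x)" for t x by (rule comm[OF is_proj_selfadj[OF Q] QR])
  have PP: "P s (P t x) = P t (P s x)" for s t x by (rule comm[OF is_proj_selfadj[OF P] PR])
  \<comment> \<open>\<open>y\<close> lies in the range of \<open>P s\<close>, so its form is bounded
    with the factor \<open>s\<close> and hence with \<open>t\<close>; being annihilated by
    \<open>P t\<close>, it is zero.\<close>
  have abs: "P t (P s x) = P s x" if "s \<le> t" for s t x
  proof -
    define y where "y = P s x - P t (P s x)"
    have "P s y = y" by (simp add: y_def bounded_op_diff[OF Pop] PP[of s t] is_proj_idem[OF P])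
    hence "inner y (R y) \<le> s * (norm y)\<^sup>2" by (rule up)
    also have "\<dots> \<le> t * (norm y)\<^sup>2" using that by (simp add: mult_right_mono)
    finally have "inner y (R y) \<le> t * (norm y)\<^sup>2" .
    moreover have "P t y = 0" by (simp add: y_def bounded_op_diff[OF Pop] is_proj_idem[OF P])
    ultimately have "y = 0" by (rule low[rotated])
    thus ?thesis by (simp add: y_def)
  qed
  have neg: "P t x = 0" if "t < 0" for t x
  proof -
    have "inner (P t x) (R (P t x)) \<le> t * (norm (P t x))\<^sup>2"
      by (rule up) (rule is_proj_idem[OF P])
    hence "0 \<le> t * (norm (P t x))\<^sup>2" using positive_inner[OF R, of "P t x"] by simp
    thus ?thesis using that by (simp add: zero_le_mult_iff)
  qed
  have ge1: "P t x = x" if "1 \<le> t" for t x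
  proof -
    define y where "y = x - P t x"
    have "inner y (R y) \<le> 1 * (norm y)\<^sup>2" using R1 by simp
    also have "\<dots> \<le> t * (norm y)\<^sup>2" using that by (intro mult_right_mono) auto
    finally have "inner y (R y) \<le> t * (norm y)\<^sup>2" .
    moreover have "P t y = 0" by (simp add: y_def bounded_op_diff[OF Pop] is_proj_idem[OF P])
    ultimately have "y = 0" by (rule low[rotated])
    thus ?thesis by (simp add: y_def)
  qed
  have mono: "norm (P s x) \<le> norm (P t x)" if "s \<le> t" for s t x
  proof -
    have "P s x = P s (P t x)" using abs[OF that, of x] PP[of s t x] by simp
    thus ?thesis using is_proj_norm_le[OF P, of s "P t x"] by simp
  qed
  \<comment> \<open>The decreasing projections converge, and the difference \<open>y\<close> of the
    limit and \<open>P s x\<close> is fixed by every \<open>P (t n)\<close> and annihilated by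
    \<open>P s\<close>. Letting \<open>t n\<close> tend to \<open>s\<close> in the form bound gives
    \<open>y = 0\<close>.\<close>
  have right: "(\<lambda>n. P (s + 1 / (real n + 1)) x) \<longlonglongrightarrow> P s x" for s x
  proof -
    define t where "t n = s + 1 / (real n + 1)" for n
    have tdec: "t m \<le> t n" if "n \<le> m" for n m
      using that by (auto simp: t_def intro!: divide_left_mono)
    have "is_proj (\<lambda>x. x - P (t n) x)" for n by (rule is_proj_compl[OF P])
    moreover have "norm (x - P (t n) x) \<le> norm (x - P (t (Suc n)) x)" for n x
    proof -
      have "(norm (x - P u x))\<^sup>2 = (norm x)\<^sup>2 - (norm (P u x))\<^sup>2" for u
        by (rule is_proj_diff(2)[OF P is_proj_id is_proj_norm_le[OF P]])
      moreover have "(norm (P (t (Suc n)) x))\<^sup>2 \<le> (norm (P (t n) x))\<^sup>2"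
        by (intro power_mono mono tdec) auto
      ultimately have "(norm (x - P (t n) x))\<^sup>2 \<le> (norm (x - P (t (Suc n)) x))\<^sup>2" by simp
      thus ?thesis by (simp add: power2_le_iff_abs_le)
    qed
    ultimately obtain L where L: "is_proj L" "\<And>x. (\<lambda>n. x - P (t n) x) \<longlonglongrightarrow> L x"
      using is_proj_limit[of "\<lambda>n x. x - P (t n) x"] by blast
    define z where "z = x - L x"
    have z: "(\<lambda>n. P (t n) x) \<longlonglongrightarrow> z"
      using tendsto_diff[OF tendsto_const[of x] L(2)[of x]] by (simp add: z_def)
    define y where "y = z - P s x"
    have tlim: "t \<longlonglongrightarrow> s"
      using LIMSEQ_inverse_real_of_nat_add[of s] by (simp add: t_def[abs_def] inverse_eq_divide add.commute)
    have Pn: "P (t n) y = y" for n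
    proof -
      have "P (t n) z = z"
      proof (rule LIMSEQ_unique)
        show "(\<lambda>m. P (t n) (P (t m) x)) \<longlonglongrightarrow> P (t n) z" by (rule bounded_op_tendsto[OF Pop z])
        have "(\<lambda>m. P (t n) (P (t m) x)) \<longlonglongrightarrow> z \<longleftrightarrow> (\<lambda>m. P (t m) x) \<longlonglongrightarrow> z"
          by (rule tendsto_cong, rule eventually_sequentiallyI[of n]) (simp add: abs tdec)
        thus "(\<lambda>m. P (t n) (P (t m) x)) \<longlonglongrightarrow> z" using z by simp
      qed
      thus ?thesis by (simp add: y_def bounded_op_diff[OF Pop] abs t_def)
    qed
    have "P s y = 0"
    proof -
      have "P s z = P s x"
      proof (rule LIMSEQ_unique)
        show "(\<lambda>m. P s (P (t m) x)) \<longlonglongrightarrow> P s z" by (rule bounded_op_tendsto[OF Pop z])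
        have "P s (P (t m) x) = P s x" for m using abs[of s "t m" x] PP[of s "t m" x] by (simp add: t_def)
        thus "(\<lambda>m. P s (P (t m) x)) \<longlonglongrightarrow> P s x" by simp
      qed
      thus ?thesis by (simp add: y_def bounded_op_diff[OF Pop] is_proj_idem[OF P])
    qed
    moreover have "inner y (R y) \<le> s * (norm y)\<^sup>2"
      by (rule LIMSEQ_le_const[of "\<lambda>n. t n * (norm y)\<^sup>2"])
         (use up[OF Pn] tlim in \<open>auto intro!: tendsto_intros\<close>)
    ultimately have "y = 0" by (rule low)
    thus ?thesis using z by (simp add: y_def t_def)
  qed
  \<comment> \<open>\<open>P t\<close> is the identity of the whole space for \<open>t\<close> at
    least 1, so the family is cut down by \<open>Q\<close> to live on \<open>M\<close>.\<close>
  interpret spectral_family "\<lambda>t x. P t (Q x)" Q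
  proof
    show "is_proj (\<lambda>x. P t (Q x))" for t 
      using is_proj_comp[of "P t" Q] P Q PQ by blast
    show "norm (P s (Q x)) \<le> norm (P t (Q x))" if "s \<le> t" for s t x using that by (rule mono)
    show "P t (Q x) = 0" if "t < 0" for t x using that by (rule neg)
    show "P t (Q x) = Q x" if "1 \<le> t" for t x using that by (rule ge1)
    show "(\<lambda>n. P (s + 1 / (real n + 1)) (Q x)) \<longlonglongrightarrow> P s (Q x)" for s x by (rule right)
  qed (rule Q)
  have "\<exists>E. \<forall>N. N \<in> sets borel \<longrightarrow> is_proj (E N) \<and> (\<forall>x. (norm (E N x))\<^sup>2 = measure (\<mu> x) N)"
    by (intro choice allI) (use projection_of_set in blast)
  then obtain E where E: "\<And>N. N \<in> sets borel \<Longrightarrow> is_proj (E N)"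
    and Em: "\<And>N x. N \<in> sets borel \<Longrightarrow> (norm (E N x))\<^sup>2 = measure (\<mu> x) N" by blast
  have Ei: "inner x (E N x) = measure (\<mu> x) N" if "N \<in> sets borel" for N x
    using Em[OF that] is_proj_inner[OF E[OF that]] by simp
  have leQ: "norm (E N x) \<le> norm (Q x)" if "N \<in> sets borel" for N x
    using measure_\<mu>_le[of x N] Em[OF that] by (metis norm_ge_zero power2_le_imp_le)
  have QM: "Q x \<in> M" and Qfix: "x \<in> M \<Longrightarrow> Q x = x" for x
    unfolding Q_def by (auto intro: proj_in[OF M] proj_fix[OF M])
  have int: "integrable (\<mu> x) (\<lambda>r. r) \<and> (\<integral>r. r \<partial>\<mu> x) = inner x (R x)" if x: "x \<in> M" for x
  proof -
    interpret finite_measure "\<mu> x" by (rule finite_\<mu>)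
    have integ: "integrable (\<mu> x) (\<lambda>r. r)"
      by (rule integrable_const_bound[where B=1])
         (use AE_\<mu>[of x] in \<open>auto simp: borel_measurable_if_I measurable_def\<close>)
    define N2 where "N2 = (norm x)\<^sup>2"
    have Fx: "F x t = (norm (P t x))\<^sup>2" for t by (simp add: F_def Qfix[OF x])
    \<comment> \<open>Riemann sum on cells of length \<open>1 / n\<close>: replacing
      \<open>r\<close> by the right end of its cell, and \<open>R\<close> by that value on the range
      of the increment, costs at most \<open>N2 / n\<close> each.\<close>
    have bound: "\<bar>(\<integral>r. r \<partial>\<mu> x) - inner x (R x)\<bar> \<le> 2 * N2 / real n" if n: "0 < n" for n :: nat
    proof -
      define p where "p k = real k / real n" for k
      define q where "q k = (real k - 1) / real n" for k
      have qp: "q k \<le> p k" "q (Suc k) = p k" "p k - q k = 1 / real n" for k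
        using n by (auto simp: p_def q_def field_simps)
      define I where "I k = {q k<..p k}" for k
      define d where "d k = P (p k) x - P (q k) x" for k
      \<comment> \<open>The sum starts at \<open>k = 0\<close>: the cell from \<open>-1 / n\<close>
        to 0 catches a possible atom at 0.\<close>
      define s where "s r = (\<Sum>k\<le>n. p k * indicator (I k) r)" for r :: real
      have Isets: "I k \<in> sets borel" for k by (simp add: I_def)
      have mI: "measure (\<mu> x) (I k) = (norm (d k))\<^sup>2" for k
        using is_proj_diff(2)[OF P P mono[OF qp(1)], of k x]
        by (simp add: I_def measure_\<mu>_Ioc[OF qp(1)] Fx d_def)
      have sd: "(\<Sum>k\<le>m. d k) = P (p m) x" for m
      proof (induction m)
        case 0
        have "q 0 < 0" using n by (simp add: q_def)
        thus ?case by (simp add: d_def neg)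
      next
        case (Suc m)
        thus ?case by (simp add: d_def qp)
      qed
      have p_n: "p n = 1" using n by (simp add: p_def)
      have sumd: "(\<Sum>k\<le>n. d k) = x" by (simp add: sd p_n ge1)
      have sumN: "(\<Sum>k\<le>n. (norm (d k))\<^sup>2) = N2"
      proof -
        have "(\<Sum>k\<le>n. (norm (d k))\<^sup>2) = (\<Sum>k\<le>n. inner x (d k))"
          using is_proj_inner[OF is_proj_diff(1)[OF P P mono[OF qp(1)]], of x] by (simp add: d_def)
        also have "\<dots> = inner x (\<Sum>k\<le>n. d k)" by (simp add: inner_sum_right)
        finally show ?thesis by (simp add: sumd N2_def power2_norm_eq_inner)
      qed
      have ints: "(\<integral>r. s r \<partial>\<mu> x) = (\<Sum>k\<le>n. p k * (norm (d k))\<^sup>2)"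
      proof -
        have "(\<integral>r. s r \<partial>\<mu> x) = (\<Sum>k\<le>n. \<integral>r. p k * indicator (I k) r \<partial>\<mu> x)"
          unfolding s_def by (intro Bochner_Integration.integral_sum) (simp add: Isets less_top[symmetric])
        thus ?thesis by (simp add: Isets mI)
      qed
      have sint: "integrable (\<mu> x) s"
        unfolding s_def[abs_def] by (intro Bochner_Integration.integrable_sum) (simp add: Isets less_top[symmetric])
      have sr: "\<bar>s r - r\<bar> \<le> 1 / real n" if r: "r \<in> {0..1}" for r
      proof -
        define k where "k = nat \<lceil>real n * r\<rceil>"
        have k: "real k - 1 < real n * r" "real n * r \<le> real k"
          using r ceiling_correct[of "real n * r"] by (auto simp: k_def)
        have "real n * r \<le> real n" using r mult_left_mono[of r 1 "real n"] by simp
        hence "real k - 1 < real n" using k(1) by linarith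
        hence kn: "k \<le> n" by linarith
        have ind: "indicator (I j) r = (if j = k then 1 else 0 :: real)" for j
        proof -
          have "r \<in> I j \<longleftrightarrow> real j - 1 < real n * r \<and> real n * r \<le> real j"
            using n by (auto simp: I_def p_def q_def field_simps)
          also have "\<dots> \<longleftrightarrow> j = k" using k by (auto; linarith)
          finally show ?thesis by (simp add: indicator_def)
        qed
        have "s r = p k" by (simp add: s_def ind kn if_distrib[of "\<lambda>v. _ * v"] cong: if_cong)
        moreover have "r \<le> p k" "p k - 1 / real n < r"
          using k n by (auto simp: p_def field_simps)
        ultimately show ?thesis by (simp add: abs_le_iff)
      qed
      have 1: "\<bar>(\<integral>r. s r \<partial>\<mu> x) - (\<integral>r. r \<partial>\<mu> x)\<bar> \<le> N2 / real n"
      proof -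
        have "\<bar>(\<integral>r. s r \<partial>\<mu> x) - (\<integral>r. r \<partial>\<mu> x)\<bar> = \<bar>\<integral>r. s r - r \<partial>\<mu> x\<bar>"
          by (simp add: sint integ)
        also have "\<dots> \<le> (\<integral>r. \<bar>s r - r\<bar> \<partial>\<mu> x)" by (rule integral_abs_bound)
        also have "\<dots> \<le> (\<integral>r. 1 / real n \<partial>\<mu> x)"
          by (rule integral_mono_AE) (use AE_\<mu>[of x] sr sint integ in \<open>auto intro!: integrable_abs\<close>)
        also have "\<dots> = N2 / real n" by (simp add: measure_\<mu>_UNIV Qfix[OF x] N2_def)
        finally show ?thesis .
      qed
      \<comment> \<open>The increment of projections commutes with \<open>R\<close>, so the cross
        terms between different cells vanish.\<close>
      have dR: "inner x (R (d k)) = inner (d k) (R (d k))" for k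
      proof -
        note D = is_proj_diff(1)[OF P P mono[OF qp(1)], of k]
        have "R (d k) = P (p k) (R (d k)) - P (q k) (R (d k))"
        proof -
          have "P (p k) (d k) - P (q k) (d k) = d k" using is_proj_idem[OF D, of x] by (simp add: d_def)
          moreover have "P (p k) (R (d k)) - P (q k) (R (d k)) = R (P (p k) (d k) - P (q k) (d k))"
            by (simp only: bounded_op_diff[OF Rop] PR)
          ultimately show ?thesis by simp
        qed
        hence "inner x (R (d k)) = inner x (P (p k) (R (d k)) - P (q k) (R (d k)))" by simp
        also have "\<dots> = inner (d k) (R (d k))"
          using selfadj_inner[OF is_proj_selfadj[OF D], of x "R (d k)"] by (simp add: d_def)
        finally show ?thesis .
      qed
      have dk: "\<bar>inner (d k) (R (d k)) - p k * (norm (d k))\<^sup>2\<bar> \<le> (norm (d k))\<^sup>2 / real n" for k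
      proof -
        have "P (p k) (d k) = d k"
          by (simp add: d_def bounded_op_diff[OF Pop] is_proj_idem[OF P] abs qp)
        hence 1: "inner (d k) (R (d k)) \<le> p k * (norm (d k))\<^sup>2" by (rule up)
        have Pq: "P (q k) (d k) = 0"
          using abs[of "q k" "p k" x] PP[of "q k" "p k" x]
          by (simp add: d_def bounded_op_diff[OF Pop] is_proj_idem[OF P] qp)
        \<comment> \<open>A vector annihilated by \<open>P (q k)\<close> and violating this bound
          would be zero, but the zero vector satisfies the bound.\<close>
        have "q k * (norm (d k))\<^sup>2 \<le> inner (d k) (R (d k))"
        proof (rule ccontr)
          assume *: "\<not> ?thesis"
          hence "d k = 0" by (intro low[OF Pq]) simp
          thus False using * by (simp add: bounded_op_0[OF Rop])
        qed
        moreover have "p k * (norm (d k))\<^sup>2 - q k * (norm (d k))\<^sup>2 = (norm (d k))\<^sup>2 / real n"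
          by (simp only: left_diff_distrib[symmetric] qp) simp
        ultimately show ?thesis using 1 by (simp add: abs_le_iff)
      qed
      have "inner x (R x) = (\<Sum>k\<le>n. inner x (R (d k)))"
        using bounded_op_sum[OF Rop, of d "{..n}"] sumd by (simp add: inner_sum_right)
      hence "\<bar>inner x (R x) - (\<integral>r. s r \<partial>\<mu> x)\<bar> = \<bar>\<Sum>k\<le>n. inner (d k) (R (d k)) - p k * (norm (d k))\<^sup>2\<bar>"
        by (simp add: ints dR sum_subtractf)
      also have "\<dots> \<le> (\<Sum>k\<le>n. \<bar>inner (d k) (R (d k)) - p k * (norm (d k))\<^sup>2\<bar>)" by (rule sum_abs)
      also have "\<dots> \<le> (\<Sum>k\<le>n. (norm (d k))\<^sup>2 / real n)" by (intro sum_mono dk)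
      also have "\<dots> = N2 / real n" by (simp add: sum_divide_distrib[symmetric] sumN)
      finally show ?thesis using 1 by simp
    qed
    have "\<bar>(\<integral>r. r \<partial>\<mu> x) - inner x (R x)\<bar> \<le> 0"
    proof (rule LIMSEQ_le_const)
      show "(\<lambda>n. 2 * N2 / real n) \<longlonglongrightarrow> 0" by (rule lim_const_over_n)
      show "\<exists>N. \<forall>n\<ge>N. \<bar>(\<integral>r. r \<partial>\<mu> x) - inner x (R x)\<bar> \<le> 2 * N2 / real n"
        using bound by (intro exI[of _ 1]) auto
    qed
    thus ?thesis using integ by simp
  qed
  have vm: "vector_measure E x = \<mu> x" for x
    unfolding vector_measure_def
    by (rule measure_of_emeasure)
       (auto simp: inner_eq_Re_cinner[symmetric] Ei finite_measure.emeasure_eq_measure[OF finite_\<mu>])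
  have "is_spectral_measure M R E"
    unfolding is_spectral_measure_def
  proof (intro conjI ballI allI impI; (elim conjE)?)
    fix N :: "real set" assume N: "N \<in> sets borel"
    show "op_on M (E N)"
    proof (rule op_onI[OF M is_proj_op[OF E[OF N]]])
      show "E N x \<in> M" for x using is_proj_le(2)[OF E[OF N] Q leQ[OF N], of x] QM[of "E N x"] by simp
      show "E N x = 0" if "\<And>y. y \<in> M \<Longrightarrow> inner y x = 0" for x
        using leQ[OF N, of x] proj_orth_eq_0[OF M that] by (simp add: Q_def)
    qed
    show "positive_op (E N)" by (rule is_proj_positive[OF E[OF N]])
    show "E N \<circ> E N = E N" using is_proj_idem[OF E[OF N]] by (simp add: fun_eq_iff)
  next
    fix x assume x: "x \<in> M"
    have "E UNIV x = Q x"
      by (rule selfadj_eqI) (auto intro!: is_proj_selfadj E Q simp: Ei measure_\<mu>_UNIV is_proj_inner[OF Q])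
    thus "E UNIV x = x" using Qfix[OF x] by simp
    show "integrable (vector_measure E x) (\<lambda>r. r)" using int[OF x] by (simp add: vm)
    have "cinner x (R x) = complex_of_real (inner x (R x))"
      using R by (auto simp: positive_op_def less_eq_complex_def complex_eq_iff inner_eq_Re_cinner)
    thus "cinner x (R x) = complex_of_real (\<integral>r. r \<partial>vector_measure E x)"
      using int[OF x] by (simp add: vm)
  next
    fix A :: "nat \<Rightarrow> real set" and x
    assume A: "range A \<subseteq> sets borel" "disjoint_family A"
    hence Ab: "A i \<in> sets borel" for i by auto
    define U where "U n = (\<Union>i<n. A i)" for n
    have Ub: "U n \<in> sets borel" "(\<Union>i. A i) \<in> sets borel" for n using Ab by (auto simp: U_def)
    \<comment> \<open>The projections \<open>E N\<close> were picked set by set through their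
      quadratic forms. Additivity follows because a form determines its self-adjoint
      operator.\<close>
    have part: "(\<Sum>i<n. E (A i) y) = E (U n) y" for n y
    proof (induction n arbitrary: y)
      case 0
      show ?case using Em[of "{}" y] by (simp add: U_def)
    next
      case (Suc n)
      have "U n \<inter> A n = {}"
        using disjoint_family_onD[OF A(2)] by (auto simp: disjoint_iff U_def) (metis UNIV_I disjoint_iff less_irrefl)
      hence "measure (\<mu> y) (U (Suc n)) = measure (\<mu> y) (U n) + measure (\<mu> y) (A n)" for y
        using finite_measure.finite_measure_Union[OF finite_\<mu>, of "U n" y "A n"] Ub Ab
        by (simp add: U_def lessThan_Suc Un_commute)
      hence "E (U n) y + E (A n) y = E (U (Suc n)) y"
        using selfadj_eqI[of "\<lambda>y. E (U n) y + E (A n) y" "E (U (Suc n))"] E Ub Ab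
        by (simp add: selfadj_plus is_proj_selfadj Ei inner_add_right)
      thus ?case by (simp add: Suc)
    qed
    have m: "(\<lambda>n. measure (\<mu> x) (U n)) \<longlonglongrightarrow> measure (\<mu> x) (\<Union>i. A i)"
    proof -
      have "(\<lambda>n. measure (\<mu> x) (U n)) \<longlonglongrightarrow> measure (\<mu> x) (\<Union>n. U n)"
        using Ub by (intro finite_measure.finite_Lim_measure_incseq[OF finite_\<mu>])
          (auto simp: incseq_def U_def intro: less_le_trans)
      moreover have "(\<Union>n. U n) = (\<Union>i. A i)" by (auto simp: U_def)
      ultimately show ?thesis by simp
    qed
    \<comment> \<open>The projections of the partial unions are ordered, so the squared distance to
      the limit is a difference of measures.\<close>
    have "norm (E (U n) y) \<le> norm (E (\<Union>i. A i) y)" for n y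
    proof -
      have "measure (\<mu> y) (U n) \<le> measure (\<mu> y) (\<Union>i. A i)"
        using Ub by (intro finite_measure.finite_measure_mono[OF finite_\<mu>]) (auto simp: U_def)
      hence "(norm (E (U n) y))\<^sup>2 \<le> (norm (E (\<Union>i. A i) y))\<^sup>2" using Em Ub by simp
      thus ?thesis by (simp add: power2_le_iff_abs_le)
    qed
    from is_proj_diff(2)[OF E[OF Ub(1)] E[OF Ub(2)] this]
    have "(norm (E (\<Union>i. A i) x - E (U n) x))\<^sup>2 = measure (\<mu> x) (\<Union>i. A i) - measure (\<mu> x) (U n)" for n
      using Em Ub by simp
    moreover have "(\<lambda>n. measure (\<mu> x) (\<Union>i. A i) - measure (\<mu> x) (U n)) \<longlonglongrightarrow> 0"
      using tendsto_diff[OF tendsto_const[of "measure (\<mu> x) (\<Union>i. A i)"] m] by simp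
    ultimately have "(\<lambda>n. (norm (E (\<Union>i. A i) x - E (U n) x))\<^sup>2) \<longlonglongrightarrow> 0" by simp
    hence "(\<lambda>n. norm (E (\<Union>i. A i) x - E (U n) x)) \<longlonglongrightarrow> 0"
      using tendsto_real_sqrt by fastforce
    hence "(\<lambda>n. E (U n) x) \<longlonglongrightarrow> E (\<Union>i. A i) x"
      using LIM_zero_cancel[of "\<lambda>n. E (U n) x"] by (simp add: tendsto_norm_zero_iff norm_minus_commute)
    thus "(\<lambda>i. E (A i) x) sums E (\<Union>i. A i) x" by (simp add: sums_def part)
  qed
  thus ?thesis by blast
qed

subsection \<open>Calculus with a spectral measure\<close>

text \<open>The index set may be uncountable, as an orthonormal basis may be; the sum is therefore
  an integral against the counting measure, which still commutes with increasing limits.\<close>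

lemma nn_integral_measure_family:
  assumes sets: "\<And>i. sets (\<nu> i) = sets M"
    and em: "\<And>N. N \<in> sets M \<Longrightarrow> emeasure M N = (\<integral>\<^sup>+i. emeasure (\<nu> i) N \<partial>count_space I)"
    and g: "g \<in> borel_measurable M"
  shows "(\<integral>\<^sup>+r. g r \<partial>M) = (\<integral>\<^sup>+i. (\<integral>\<^sup>+r. g r \<partial>\<nu> i) \<partial>count_space I)"
  using g
proof (induction rule: borel_measurable_induct)
  case (cong f g)
  have sp: "space (\<nu> i) = space M" for i using sets by (rule sets_eq_imp_space_eq)
  have "(\<integral>\<^sup>+r. f r \<partial>M) = (\<integral>\<^sup>+r. g r \<partial>M)" using cong by (intro nn_integral_cong) auto
  moreover have "(\<integral>\<^sup>+r. f r \<partial>\<nu> i) = (\<integral>\<^sup>+r. g r \<partial>\<nu> i)" for i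
    using cong sp by (intro nn_integral_cong) auto
  ultimately show ?case using cong by simp
next
  case (set A)
  thus ?case by (simp add: em sets)
next
  case (mult u c)
  have "u \<in> borel_measurable (\<nu> i)" for i using mult(2) by (simp add: measurable_cong_sets[OF sets refl])
  thus ?case using mult by (simp add: nn_integral_cmult)
next
  case (add u v)
  have "u \<in> borel_measurable (\<nu> i)" "v \<in> borel_measurable (\<nu> i)" for i
    using add by (simp_all add: measurable_cong_sets[OF sets refl])
  thus ?case using add by (simp add: nn_integral_add)
next
  case (seq U)
  have m: "U j \<in> borel_measurable (\<nu> i)" for i j
    using seq by (simp add: measurable_cong_sets[OF sets refl])
  have inc: "incseq U" by fact
  have eq: "(SUP i. U i) r = (SUP i. U i r)" for r by (rule SUP_apply)
  have "(\<integral>\<^sup>+r. (SUP i. U i) r \<partial>M) = (SUP j. \<integral>\<^sup>+r. U j r \<partial>M)"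
    unfolding eq by (rule nn_integral_monotone_convergence_SUP) (use seq in auto)
  also have "\<dots> = (SUP j. \<integral>\<^sup>+i. (\<integral>\<^sup>+r. U j r \<partial>\<nu> i) \<partial>count_space I)"
    using seq by simp
  also have "\<dots> = (\<integral>\<^sup>+i. (SUP j. \<integral>\<^sup>+r. U j r \<partial>\<nu> i) \<partial>count_space I)"
    using inc by (intro nn_integral_monotone_convergence_SUP[symmetric])
      (auto simp: incseq_def le_fun_def intro!: nn_integral_mono)
  also have "\<dots> = (\<integral>\<^sup>+i. (\<integral>\<^sup>+r. (SUP i. U i) r \<partial>\<nu> i) \<partial>count_space I)"
    unfolding eq using seq m by (simp add: nn_integral_monotone_convergence_SUP)
  finally show ?case .
qed

lemma nn_integral_add_measure:
  assumes sets: "sets M1 = sets M" "sets M2 = sets M"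
    and em: "\<And>N. N \<in> sets M \<Longrightarrow> emeasure M N = emeasure M1 N + emeasure M2 N"
    and g: "g \<in> borel_measurable M"
  shows "(\<integral>\<^sup>+r. g r \<partial>M) = (\<integral>\<^sup>+r. g r \<partial>M1) + (\<integral>\<^sup>+r. g r \<partial>M2)"
proof -
  have "(\<integral>\<^sup>+r. g r \<partial>M) = (\<integral>\<^sup>+i. (\<integral>\<^sup>+r. g r \<partial>(if i then M1 else M2)) \<partial>count_space UNIV)"
    by (rule nn_integral_measure_family)
       (use sets g em in \<open>auto simp: nn_integral_count_space_finite UNIV_bool add.commute\<close>)
  thus ?thesis by (simp add: nn_integral_count_space_finite UNIV_bool add.commute)
qed

text \<open>\<open>spectral_measure\<close> is a choice among the admissible \<open>E\<close>, so
  what follows is derived for any \<open>E\<close> from the defining clauses alone.\<close>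

locale spectral_meas =
  fixes M :: "'a::complex_hilbert_space set" and R :: "'a \<Rightarrow> 'a" and E :: "real set \<Rightarrow> 'a \<Rightarrow> 'a"
  assumes M: "closed_csub M" and RM: "op_on M R" and R: "positive_op R"
    and R1: "\<And>x. inner x (R x) \<le> (norm x)\<^sup>2" and E: "is_spectral_measure M R E"
begin

lemma sR: "selfadj R" by (rule positive_selfadj[OF R])
lemma Rop: "bounded_op R" by (rule positive_op_op[OF R])

lemma RinM: "R x \<in> M" using RM by (auto simp: op_on_def)

lemma E_props:
  assumes "N \<in> sets borel"
  shows Eproj: "is_proj (E N)" and EinM: "E N x \<in> M"
proof -
  have "op_on M (E N)" "positive_op (E N)" "E N \<circ> E N = E N"
    using E assms by (auto simp: is_spectral_measure_def)
  thus "is_proj (E N)" "E N x \<in> M"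
    by (auto simp: is_proj_def positive_selfadj op_on_def dest: fun_cong)
qed

lemma E_UNIV: "x \<in> M \<Longrightarrow> E UNIV x = x"
  using E by (auto simp: is_spectral_measure_def)

lemma E_sums: "range F \<subseteq> sets borel \<Longrightarrow> disjoint_family F \<Longrightarrow> (\<lambda>i::nat. E (F i) x) sums E (\<Union>i. F i) x"
  using E unfolding is_spectral_measure_def by blast

lemma E_empty: "E {} x = 0"
proof -
  have "(\<lambda>i::nat. E {} x) sums E (\<Union>i::nat. {}) x"
    by (rule E_sums[of "\<lambda>i. {}"]) (auto simp: disjoint_family_on_def)
  hence "(\<lambda>i::nat. E {} x) \<longlonglongrightarrow> 0" by (intro summable_LIMSEQ_zero) (auto simp: sums_iff)
  thus ?thesis by (simp add: LIMSEQ_const_iff)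
qed

lemma E_Un:
  assumes "A \<in> sets borel" "B \<in> sets borel" "A \<inter> B = {}"
  shows "E (A \<union> B) x = E A x + E B x"
proof -
  have "(\<lambda>i. E (binaryset A B i) x) sums E (\<Union>i. binaryset A B i) x"
    by (rule E_sums) (use assms in \<open>auto simp: range_binaryset_eq disjoint_family_on_def binaryset_def\<close>)
  moreover have "(\<lambda>i. E (binaryset A B i) x) sums (E A x + E B x)"
    by (rule binaryset_sums) (rule E_empty)
  ultimately show ?thesis using sums_unique2 by (auto simp: UN_binaryset_eq)
qed

text \<open>Multiplicativity is not among the defining clauses. It is recovered from additivity:
  \<open>E A + E B\<close> is again a projection of the family, hence a contraction, which forces
  orthogonal ranges.\<close>

lemma E_disjoint:
  assumes "A \<in> sets borel" "B \<in> sets borel" "A \<inter> B = {}"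
  shows "E A (E B x) = 0"
proof (rule is_proj_add(2)[OF Eproj Eproj])
  fix x
  have "(norm (E A x))\<^sup>2 + (norm (E B x))\<^sup>2 = inner x (E (A \<union> B) x)"
    using assms by (simp add: E_Un inner_add_right is_proj_inner[OF Eproj])
  also have "\<dots> \<le> (norm x)\<^sup>2"
    using assms by (simp add: is_proj_inner[OF Eproj] is_proj_norm_le[OF Eproj] power_mono)
  finally show "(norm (E A x))\<^sup>2 + (norm (E B x))\<^sup>2 \<le> (norm x)\<^sup>2" .
qed (use assms in auto)

lemma E_Int:
  assumes A: "A \<in> sets borel" and B: "B \<in> sets borel"
  shows "E A (E B x) = E (A \<inter> B) x"
proof -
  have AB: "A \<inter> B \<in> sets borel" "A - B \<in> sets borel" "B - A \<in> sets borel" using A B by auto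
  have eA: "E A y = E (A \<inter> B) y + E (A - B) y" for y
    using E_Un[OF AB(1,2), of y] by (simp add: Int_Diff_Un Int_Diff disjoint_iff)
  have eB: "E B y = E (A \<inter> B) y + E (B - A) y" for y
    using E_Un[OF AB(1,3), of y] by (simp add: Int_commute[of A] Int_Diff_Un disjoint_iff)
  have "E A (E B x) = E A (E (A \<inter> B) x) + E A (E (B - A) x)"
    unfolding eB by (rule bounded_op_add[OF is_proj_op[OF Eproj[OF A]]])
  also have "E A (E (B - A) x) = 0" by (rule E_disjoint[OF A AB(3)]) auto
  also have "E A (E (A \<inter> B) x) = E (A \<inter> B) (E (A \<inter> B) x) + E (A - B) (E (A \<inter> B) x)" by (rule eA)
  also have "E (A - B) (E (A \<inter> B) x) = 0" by (rule E_disjoint[OF AB(2,1)]) auto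
  finally show ?thesis by (simp add: is_proj_idem[OF Eproj[OF AB(1)]])
qed

definition m :: "'a \<Rightarrow> real measure" where "m x = vector_measure E x"

lemma sets_m [simp, measurable_cong]: "sets (m x) = sets borel" and space_m [simp]: "space (m x) = UNIV"
  unfolding m_def vector_measure_def
  by (simp_all add: sets.sigma_sets_eq[of "borel :: real measure", simplified])

lemma emeasure_m:
  assumes "N \<in> sets borel"
  shows "emeasure (m x) N = ennreal ((norm (E N x))\<^sup>2)"
proof -
  have eq: "Re (cinner x (E N x)) = (norm (E N x))\<^sup>2" if "N \<in> sets borel" for N
    using that by (simp add: inner_eq_Re_cinner[symmetric] is_proj_inner[OF Eproj])
  have "emeasure (measure_of UNIV (sets borel) (\<lambda>N. ennreal (Re (cinner x (E N x))))) N
      = ennreal (Re (cinner x (E N x)))"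
  proof (rule emeasure_measure_of_sigma)
    show "sigma_algebra UNIV (sets (borel :: real measure))"
      using sets.sigma_algebra_axioms[of "borel :: real measure"] by simp
    show "positive (sets borel) (\<lambda>N. ennreal (Re (cinner x (E N x))))"
      by (simp add: positive_def E_empty)
    show "countably_additive (sets borel) (\<lambda>N. ennreal (Re (cinner x (E N x))))"
      unfolding countably_additive_def
    proof (intro allI impI)
      fix A :: "nat \<Rightarrow> real set"
      assume A: "range A \<subseteq> sets borel" "disjoint_family A" "\<Union> (range A) \<in> sets borel"
      have "(\<lambda>i. inner x (E (A i) x)) sums inner x (E (\<Union>i. A i) x)"
        by (intro bounded_linear.sums[OF bounded_linear_inner_right] E_sums A)
      thus "(\<Sum>i. ennreal (Re (cinner x (E (A i) x)))) = ennreal (Re (cinner x (E (\<Union> (range A)) x)))"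
        using A(1) by (intro suminf_ennreal_eq) (auto simp: eq inner_eq_Re_cinner range_subsetD)
    qed
  qed (use assms in auto)
  thus ?thesis by (simp add: m_def vector_measure_def eq assms)
qed

lemma finite_m: "finite_measure (m x)"
  by (rule finite_measureI) (simp add: emeasure_m)

lemma m_E:
  assumes "A \<in> sets borel"
  shows "m (E A x) = density (m x) (indicator A)"
proof (rule measure_eqI)
  fix N assume N: "N \<in> sets (m (E A x))"
  have "emeasure (density (m x) (indicator A)) N = emeasure (m x) (A \<inter> N)"
    using assms N by (simp add: emeasure_density indicator_inter_arith[symmetric])
  thus "emeasure (m (E A x)) N = emeasure (density (m x) (indicator A)) N"
    using assms N by (simp add: emeasure_m E_Int Int_commute)
qed simp

lemma nn_integral_m_E:
  assumes "A \<in> sets borel" "g \<in> borel_measurable borel"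
  shows "(\<integral>\<^sup>+r. g r \<partial>m (E A x)) = (\<integral>\<^sup>+r. g r * indicator A r \<partial>m x)"
  using assms by (simp add: m_E nn_integral_density mult.commute)

lemma measure_m_UNIV: "x \<in> M \<Longrightarrow> measure (m x) UNIV = (norm x)\<^sup>2"
  by (simp add: measure_def emeasure_m E_UNIV)

lemma integral_m:
  assumes "x \<in> M"
  shows "integrable (m x) (\<lambda>r. r)" "(\<integral>r. r \<partial>m x) = inner x (R x)"
proof -
  have "integrable (m x) (\<lambda>r. r) \<and> cinner x (R x) = complex_of_real (\<integral>r. r \<partial>m x)"
    using E assms by (auto simp: is_spectral_measure_def m_def)
  thus "integrable (m x) (\<lambda>r. r)" "(\<integral>r. r \<partial>m x) = inner x (R x)"
    by (auto simp: inner_eq_Re_cinner)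
qed

lemma AE_m_E: "A \<in> sets borel \<Longrightarrow> AE r in m (E A x). r \<in> A"
  by (rule AE_I[of _ _ "- A"]) (auto simp: emeasure_m E_Int E_empty)

text \<open>The measure of \<open>y = E A x\<close> lives on \<open>A\<close>, where the affine
  function is negative, yet its integral is the nonnegative form at \<open>y\<close>. So
  \<open>y = 0\<close>. Two instances confine the measures to [0,1].\<close>

lemma null_of_sign:
  assumes A: "A \<in> sets borel" and neg: "\<And>r. r \<in> A \<Longrightarrow> c + s * r < 0"
    and nn: "\<And>y. 0 \<le> c * (norm y)\<^sup>2 + s * inner y (R y)"
  shows "AE r in m x. r \<notin> A"
proof -
  define y where "y = E A x"
  interpret finite_measure "m y" by (rule finite_m)
  have y: "y \<in> M" unfolding y_def by (rule EinM[OF A])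
  have int: "integrable (m y) (\<lambda>r. - (c + s * r))" using integral_m[OF y] by auto
  have "(\<integral>r. - (c + s * r) \<partial>m y) = - (c * (norm y)\<^sup>2 + s * inner y (R y))"
    using integral_m[OF y] by (simp add: measure_m_UNIV[OF y])
  hence le: "(\<integral>r. - (c + s * r) \<partial>m y) \<le> 0" using nn[of y] by simp
  have AE: "AE r in m y. r \<in> A" unfolding y_def by (rule AE_m_E[OF A])
  hence pos: "AE r in m y. 0 < - (c + s * r)" by eventually_elim (use neg in fastforce)
  hence pos': "AE r in m y. 0 \<le> - (c + s * r)" by eventually_elim simp
  hence "(\<integral>r. - (c + s * r) \<partial>m y) = 0" using le integral_nonneg_AE[OF pos'] by linarith
  hence "AE r in m y. - (c + s * r) = 0" using integral_nonneg_eq_0_iff_AE[OF int pos'] by simp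
  with pos have "AE r in m y. False" by eventually_elim simp
  hence "emeasure (m y) UNIV = 0" using AE_iff_measurable[of UNIV "m y" "\<lambda>r. False"] by simp
  hence "emeasure (m x) A = 0"
    using A EinM[OF A] by (simp add: emeasure_m y_def E_UNIV)
  thus ?thesis using A by (intro AE_I[of _ _ A]) auto
qed

lemma AE_m: "AE r in m x. r \<in> {0..1}"
proof -
  have "AE r in m x. r \<notin> {..<0}"
    by (rule null_of_sign[of _ 0 1]) (use positive_inner[OF R] in auto)
  moreover have "AE r in m x. r \<notin> {1<..}"
    by (rule null_of_sign[of _ 1 "-1"]) (use R1 in auto)
  ultimately show ?thesis by eventually_elim auto
qed

lemma nn_integral_m: "x \<in> M \<Longrightarrow> (\<integral>\<^sup>+r. ennreal r \<partial>m x) = ennreal (inner x (R x))"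
  using AE_m[of x] integral_m[of x] by (subst nn_integral_eq_integral) auto

text \<open>\<open>R\<close> is known only through its form on \<open>M\<close>. Since the measure
  of \<open>y\<close> is the sum of those of \<open>E A y\<close> and \<open>E (- A) y\<close>, the
  forms add up as well, and the cross term of \<open>R\<close> between the two parts
  vanishes.\<close>

lemma E_R:
  assumes A: "A \<in> sets borel"
  shows "E A (R x) = R (E A x)"
proof -
  have A': "- A \<in> sets borel" using A by auto
  note op = is_proj_op[OF Eproj[OF A]] is_proj_op[OF Eproj[OF A']] Rop
  have split: "E A y + E (- A) y = y" if "y \<in> M" for y
    using E_Un[OF A A', of y] that by (simp add: E_UNIV)
  have orth: "inner (E A y) (R (E (- A) y)) = 0" if y: "y \<in> M" for y
  proof -
    have "(\<integral>\<^sup>+r. ennreal r \<partial>m y) = (\<integral>\<^sup>+r. ennreal r \<partial>m (E A y)) + (\<integral>\<^sup>+r. ennreal r \<partial>m (E (- A) y))"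
    proof (rule nn_integral_add_measure)
      fix N assume "N \<in> sets (m y)"
      hence N: "N \<in> sets borel" by simp
      have "E N y = E N (E A y) + E N (E (- A) y)"
        using split[OF y] by (metis bounded_op_add is_proj_op[OF Eproj[OF N]])
      moreover have "(norm (E N y))\<^sup>2 = inner y (E N y)"
        by (simp add: is_proj_inner[OF Eproj[OF N]])
      ultimately have "(norm (E N y))\<^sup>2 = inner y (E N (E A y)) + inner y (E N (E (- A) y))"
        by (simp only: inner_add_right)
      also have "\<dots> = (norm (E N (E A y)))\<^sup>2 + (norm (E N (E (- A) y)))\<^sup>2"
        using A A' N by (simp add: E_Int is_proj_inner[OF Eproj])
      finally show "emeasure (m y) N = emeasure (m (E A y)) N + emeasure (m (E (- A) y)) N"
        using N by (simp add: emeasure_m ennreal_plus[symmetric] del: ennreal_plus)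
    qed auto
    hence "inner y (R y) = inner (E A y) (R (E A y)) + inner (E (- A) y) (R (E (- A) y))"
      by (simp add: nn_integral_m y EinM A A' ennreal_plus[symmetric] positive_inner[OF R] del: ennreal_plus)
    moreover have "inner y (R y) = inner (E A y + E (- A) y) (R (E A y + E (- A) y))"
      by (simp add: split[OF y])
    moreover have "inner (E (- A) y) (R (E A y)) = inner (E A y) (R (E (- A) y))"
      by (metis inner_commute selfadj_inner[OF sR])
    ultimately show ?thesis
      by (simp add: bounded_op_add[OF Rop] inner_add_left inner_add_right)
  qed
  \<comment> \<open>Applying \<open>orth\<close> to the sum of one vector from each part makes the
    two arguments independent.\<close>
  have orth2: "inner (E A a) (R (E (- A) b)) = 0" for a b
  proof -
    have "E A a + E (- A) b \<in> M" using A A' by (intro closed_csub_arith(2)[OF M] EinM)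
    from orth[OF this] show ?thesis
      by (simp add: bounded_op_add[OF op(1)] bounded_op_add[OF op(2)] E_Int A A' E_empty)
  qed
  have RE: "E A (R (E A x)) = R (E A x)" for x
  proof -
    have "inner b (E (- A) (R (E A x))) = 0" for b
    proof -
      have "inner b (E (- A) (R (E A x))) = inner (E (- A) b) (R (E A x))"
        by (rule selfadj_inner[OF is_proj_selfadj[OF Eproj[OF A']], symmetric])
      also have "\<dots> = inner (R (E (- A) b)) (E A x)" by (rule selfadj_inner[OF sR, symmetric])
      also have "\<dots> = inner (E A x) (R (E (- A) b))" by (rule inner_commute)
      finally show ?thesis by (simp add: orth2)
    qed
    hence "E (- A) (R (E A x)) = 0" by (metis inner_eq_zero_iff)
    thus ?thesis using split[OF RinM, of "E A x"] by simp
  qed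
  have "inner y (E A (R x)) = inner y (R (E A x))" for y
  proof -
    have "inner y (E A (R x)) = inner (R (E A y)) x"
      by (simp only: selfadj_inner[OF is_proj_selfadj[OF Eproj[OF A]]] selfadj_inner[OF sR])
    also have "\<dots> = inner (E A (R (E A y))) x" by (simp add: RE)
    also have "\<dots> = inner y (E A (R (E A x)))"
      by (simp only: selfadj_inner[OF is_proj_selfadj[OF Eproj[OF A]]] selfadj_inner[OF sR])
    finally show ?thesis by (simp add: RE)
  qed
  hence "inner y (E A (R x) - R (E A x)) = 0" for y by (simp add: inner_diff_right)
  thus ?thesis by (metis inner_eq_zero_iff right_minus_eq)
qed

text \<open>Polarisation: the measures of \<open>x + R x\<close> and \<open>x - R x\<close> differ by \<open>4 r\<close> times that of \<open>x\<close>.\<close>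

lemma nn_integral_m_sq:
  assumes x: "x \<in> M"
  shows "(\<integral>\<^sup>+r. ennreal (r\<^sup>2) \<partial>m x) = ennreal ((norm (R x))\<^sup>2)"
proof -
  define z where "z = R x"
  have z: "z \<in> M" "x + z \<in> M" "x - z \<in> M"
    using RinM x closed_csub_arith[OF M] by (auto simp: z_def)
  have "(\<integral>\<^sup>+r. ennreal r \<partial>m (x + z))
      = (\<integral>\<^sup>+r. ennreal r \<partial>m (x - z)) + (\<integral>\<^sup>+r. ennreal r \<partial>density (m x) (\<lambda>r. 4 * ennreal r))"
  proof (rule nn_integral_add_measure)
    fix N assume "N \<in> sets (m (x + z))"
    hence N: "N \<in> sets borel" by simp
    note op = is_proj_op[OF Eproj[OF N]]
    have "(norm (E N (x + z)))\<^sup>2 - (norm (E N (x - z)))\<^sup>2 = 4 * inner (E N x) (E N z)"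
      by (simp add: op_simps op power2_norm_eq_inner inner_add_left inner_add_right
          inner_diff_left inner_diff_right inner_commute)
    also have "E N z = R (E N x)" unfolding z_def by (rule E_R[OF N])
    finally have *: "(norm (E N (x + z)))\<^sup>2 = (norm (E N (x - z)))\<^sup>2 + 4 * inner (E N x) (R (E N x))" by simp
    have "emeasure (density (m x) (\<lambda>r. 4 * ennreal r)) N = 4 * (\<integral>\<^sup>+r. ennreal r * indicator N r \<partial>m x)"
      using N by (simp add: emeasure_density mult.assoc nn_integral_cmult)
    also have "\<dots> = 4 * ennreal (inner (E N x) (R (E N x)))"
      using N by (simp add: nn_integral_m_E[symmetric] nn_integral_m EinM)
    also have "\<dots> = ennreal (4 * inner (E N x) (R (E N x)))"
      by (simp add: ennreal_mult positive_inner[OF R])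
    finally show "emeasure (m (x + z)) N = emeasure (m (x - z)) N + emeasure (density (m x) (\<lambda>r. 4 * ennreal r)) N"
      using N by (simp add: emeasure_m * ennreal_plus[symmetric] positive_inner[OF R] del: ennreal_plus)
  qed auto
  also have "(\<integral>\<^sup>+r. ennreal r \<partial>density (m x) (\<lambda>r. 4 * ennreal r)) = 4 * (\<integral>\<^sup>+r. ennreal (r\<^sup>2) \<partial>m x)"
  proof -
    have "(\<integral>\<^sup>+r. ennreal r \<partial>density (m x) (\<lambda>r. 4 * ennreal r)) = (\<integral>\<^sup>+r. 4 * ennreal (r\<^sup>2) \<partial>m x)"
      by (subst nn_integral_density, simp, simp, rule nn_integral_cong_AE)
         (use AE_m[of x] in eventually_elim, simp add: ennreal_mult power2_eq_square mult.assoc)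
    thus ?thesis by (simp add: nn_integral_cmult)
  qed
  finally have eq: "ennreal (inner (x + z) (R (x + z))) = ennreal (inner (x - z) (R (x - z))) + 4 * (\<integral>\<^sup>+r. ennreal (r\<^sup>2) \<partial>m x)"
    by (simp add: nn_integral_m z)
  have "inner (x + z) (R (x + z)) = inner (x - z) (R (x - z)) + 4 * (norm z)\<^sup>2"
  proof -
    have "inner z (R x) = (norm z)\<^sup>2" by (simp add: z_def power2_norm_eq_inner)
    moreover have "inner x (R z) = (norm z)\<^sup>2"
      by (simp add: z_def power2_norm_eq_inner selfadj_inner[OF sR])
    ultimately show ?thesis
      by (simp add: op_simps Rop inner_add_left inner_add_right inner_diff_left inner_diff_right)
  qed
  hence "ennreal (inner (x - z) (R (x - z))) + 4 * (\<integral>\<^sup>+r. ennreal (r\<^sup>2) \<partial>m x)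
      = ennreal (inner (x - z) (R (x - z))) + 4 * ennreal ((norm z)\<^sup>2)"
    using eq by (simp add: ennreal_plus ennreal_mult positive_inner[OF R])
  hence "4 * (\<integral>\<^sup>+r. ennreal (r\<^sup>2) \<partial>m x) = 4 * ennreal ((norm z)\<^sup>2)"
    by (simp add: ennreal_add_left_cancel)
  thus ?thesis by (simp add: ennreal_mult_cancel_left z_def)
qed

lemma integral_m_sq:
  assumes x: "x \<in> M"
  shows "integrable (m x) (\<lambda>r. r\<^sup>2)" "(\<integral>r. r\<^sup>2 \<partial>m x) = (norm (R x))\<^sup>2"
proof -
  have "has_bochner_integral (m x) (\<lambda>r. r\<^sup>2) ((norm (R x))\<^sup>2)"
    by (rule has_bochner_integral_nn_integral) (use nn_integral_m_sq[OF x] in auto)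
  thus "integrable (m x) (\<lambda>r. r\<^sup>2)" "(\<integral>r. r\<^sup>2 \<partial>m x) = (norm (R x))\<^sup>2"
    by (auto simp: has_bochner_integral_iff)
qed

text \<open>On a Borel set \<open>N\<close> both sides are the squared norm of the affine image of
  \<open>y = E N x\<close>: on the left because \<open>E N\<close> commutes with \<open>R\<close>,
  on the right by the moments of \<open>m y\<close> up to degree two. It serves as a change of
  variables for the rational kernel.\<close>

lemma m_affine:
  assumes x: "x \<in> M"
  shows "m (\<alpha> *\<^sub>R R x + \<beta> *\<^sub>R x) = density (m x) (\<lambda>r. ennreal ((\<alpha> * r + \<beta>)\<^sup>2))"
proof (rule measure_eqI)
  fix N assume "N \<in> sets (m (\<alpha> *\<^sub>R R x + \<beta> *\<^sub>R x))"
  hence N: "N \<in> sets borel" by simp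
  define y where "y = E N x"
  have y: "y \<in> M" unfolding y_def by (rule EinM[OF N])
  interpret finite_measure "m y" by (rule finite_m)
  have q: "(\<alpha> * r + \<beta>)\<^sup>2 = \<alpha>\<^sup>2 * r\<^sup>2 + 2 * \<alpha> * \<beta> * r + \<beta>\<^sup>2" for r
    by (simp add: power2_eq_square algebra_simps)
  have int: "integrable (m y) (\<lambda>r. (\<alpha> * r + \<beta>)\<^sup>2)"
    unfolding q using integral_m[OF y] integral_m_sq[OF y] by auto
  have "(\<integral>r. (\<alpha> * r + \<beta>)\<^sup>2 \<partial>m y) = \<alpha>\<^sup>2 * (norm (R y))\<^sup>2 + 2 * \<alpha> * \<beta> * inner y (R y) + \<beta>\<^sup>2 * (norm y)\<^sup>2"
    unfolding q using integral_m[OF y] integral_m_sq[OF y] by (simp add: measure_m_UNIV[OF y])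
  also have "\<dots> = (norm (\<alpha> *\<^sub>R R y + \<beta> *\<^sub>R y))\<^sup>2"
    by (simp add: power2_norm_eq_inner inner_add_left inner_add_right inner_commute)
       (simp add: power2_eq_square algebra_simps)
  also have "\<alpha> *\<^sub>R R y + \<beta> *\<^sub>R y = E N (\<alpha> *\<^sub>R R x + \<beta> *\<^sub>R x)"
    by (simp add: y_def op_simps is_proj_op[OF Eproj[OF N]] E_R[OF N])
  finally have "ennreal ((norm (E N (\<alpha> *\<^sub>R R x + \<beta> *\<^sub>R x)))\<^sup>2) = (\<integral>\<^sup>+r. ennreal ((\<alpha> * r + \<beta>)\<^sup>2) \<partial>m y)"
    using int by (simp add: nn_integral_eq_integral)
  also have "\<dots> = (\<integral>\<^sup>+r. ennreal ((\<alpha> * r + \<beta>)\<^sup>2) * indicator N r \<partial>m x)"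
    unfolding y_def by (rule nn_integral_m_E[OF N]) simp
  finally show "emeasure (m (\<alpha> *\<^sub>R R x + \<beta> *\<^sub>R x)) N = emeasure (density (m x) (\<lambda>r. ennreal ((\<alpha> * r + \<beta>)\<^sup>2))) N"
    using N by (simp add: emeasure_m emeasure_density)
qed simp

text \<open>Writing the vector as \<open>w = K u\<close> with \<open>K = R + l (1 - R)\<close> gives
  its measure the density \<open>(k r)^2\<close> with respect to \<open>m u\<close>. One factor
  \<open>k r\<close> cancels the denominator, and the remaining cubic polynomial needs only moments,
  so no functional calculus for rational functions is required.\<close>

lemma nn_integral_harmonic:
  assumes u: "u \<in> M" and l: "0 < l"
  defines "w \<equiv> R u + l *\<^sub>R (u - R u)"
  shows "(\<integral>\<^sup>+r. ennreal (l * r * (1 - r) / (r + l * (1 - r))) \<partial>m w) = ennreal (l * inner w (R (u - R u)))"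
proof -
  define k where "k r = (1 - l) * r + l" for r :: real
  have k: "k r = r + l * (1 - r)" for r by (simp add: k_def algebra_simps)
  have kpos: "0 < k r" if "r \<in> {0..1}" for r
    using that l by (cases "r = 0") (auto simp: k intro!: add_pos_nonneg)
  have w: "w = (1 - l) *\<^sub>R R u + l *\<^sub>R u" by (simp add: w_def algebra_simps)
  interpret finite_measure "m u" by (rule finite_m)
  have "(\<integral>\<^sup>+r. ennreal (l * r * (1 - r) / (r + l * (1 - r))) \<partial>m w)
      = (\<integral>\<^sup>+r. ennreal ((k r)\<^sup>2) * ennreal (l * r * (1 - r) / k r) \<partial>m u)"
    unfolding w m_affine[OF u] k_def[symmetric] k[symmetric]
    by (rule nn_integral_density) (simp_all add: k_def)
  also have "\<dots> = (\<integral>\<^sup>+r. ennreal (l * (r * (1 - r) * k r)) \<partial>m u)"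
  proof (rule nn_integral_cong_AE, use AE_m[of u] in eventually_elim)
    fix r :: real assume r: "r \<in> {0..1}"
    have "(k r)\<^sup>2 * (l * r * (1 - r) / k r) = l * (r * (1 - r) * k r)"
      using kpos[OF r] by (simp add: power2_eq_square)
    thus "ennreal ((k r)\<^sup>2) * ennreal (l * r * (1 - r) / k r) = ennreal (l * (r * (1 - r) * k r))"
      by (simp add: ennreal_mult'[symmetric])
  qed
  also have "\<dots> = ennreal (\<integral>r. l * (r * (1 - r) * k r) \<partial>m u)"
  proof (rule nn_integral_eq_integral)
    have "AE r in m u. norm (l * (r * (1 - r) * k r)) \<le> l * (1 * (1 + l))"
      using AE_m[of u]
    proof eventually_elim
      case (elim r)
      have 1: "r * (1 - r) \<le> 1" "0 \<le> r * (1 - r)"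
        using elim mult_mono[of r 1 "1 - r" 1] by auto
      have "l * (1 - r) \<le> l" using elim l by (simp add: algebra_simps)
      hence "k r \<le> 1 + l" using elim by (simp add: k)
      with 1 kpos[OF elim] l have "l * (r * (1 - r) * k r) \<le> l * (1 * (1 + l))"
        by (intro mult_left_mono mult_mono) auto
      moreover have "0 \<le> l * (r * (1 - r) * k r)"
        by (rule mult_nonneg_nonneg[OF less_imp_le[OF l] mult_nonneg_nonneg[OF 1(2) less_imp_le[OF kpos[OF elim]]]])
      ultimately show ?case by (simp only: real_norm_def abs_of_nonneg)
    qed
    thus "integrable (m u) (\<lambda>r. l * (r * (1 - r) * k r))"
      by (rule integrable_const_bound) (simp add: k_def)
    show "AE r in m u. 0 \<le> l * (r * (1 - r) * k r)"
      using AE_m[of u]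
    proof eventually_elim
      case (elim r)
      hence "0 \<le> r * (1 - r)" by auto
      from mult_nonneg_nonneg[OF this less_imp_le[OF kpos[OF elim]]] show ?case
        by (rule mult_nonneg_nonneg[OF less_imp_le[OF l]])
    qed
  qed
  also have "(\<integral>r. l * (r * (1 - r) * k r) \<partial>m u) = l * inner w (R (u - R u))"
  proof -
    \<comment> \<open>The first moment of \<open>m (R u)\<close> is the third moment of
      \<open>m u\<close>.\<close>
    have Ru: "m (R u) = density (m u) (\<lambda>r. ennreal (r\<^sup>2))" using m_affine[OF u, of 1 0] by simp
    have i3: "integrable (m u) (\<lambda>r. r\<^sup>2 * r)" and c3: "(\<integral>r. r\<^sup>2 * r \<partial>m u) = inner (R u) (R (R u))"
      using integral_m[OF RinM, of u] unfolding Ru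
      by (simp_all add: integrable_density integral_density)
    have "(\<integral>r. l * (r * (1 - r) * k r) \<partial>m u) = (\<integral>r. l * (l * r + (1 - 2 * l) * r\<^sup>2 - (1 - l) * (r\<^sup>2 * r)) \<partial>m u)"
      by (intro Bochner_Integration.integral_cong refl) (simp add: k_def power2_eq_square algebra_simps)
    also have "\<dots> = l * (l * inner u (R u) + (1 - 2 * l) * (norm (R u))\<^sup>2 - (1 - l) * inner (R u) (R (R u)))"
      using integral_m[OF u] integral_m_sq[OF u] i3 c3 by simp
    also have "\<dots> = l * inner w (R (u - R u))"
    proof -
      have "inner u (R (R u)) = (norm (R u))\<^sup>2"
        by (simp add: power2_norm_eq_inner selfadj_inner[OF sR])
      moreover have "inner (R u) (R u) = (norm (R u))\<^sup>2" by (simp add: power2_norm_eq_inner)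
      ultimately show ?thesis
        by (simp add: w op_simps Rop inner_add_left inner_diff_right) (simp add: algebra_simps)
    qed
    finally show ?thesis .
  qed
  finally show ?thesis .
qed

end

section \<open>The parallel sum\<close>

text \<open>Completing the square: moving away from the split \<open>y1 + y2\<close> by
  \<open>h\<close> adds \<open>inner h (P h) + inner h (Q h)\<close>, the linear terms cancelling
  because \<open>P y1 = Q y2\<close>. An optimal split is thus recognized without inverting
  anything.\<close>

lemma parallel_form:
  assumes P: "positive_op P" and Q: "positive_op Q" and z: "P y1 = z" "Q y2 = z"
  shows parallel_form_eq: "inner (y1 + y2) z = inner y1 (P y1) + inner y2 (Q y2)"
    and parallel_form_le: "inner (y1 + y2) z \<le> inner y (P y) + inner (y1 + y2 - y) (Q (y1 + y2 - y))"
proof -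
  show eq: "inner (y1 + y2) z = inner y1 (P y1) + inner y2 (Q y2)"
    by (simp add: z inner_add_left)
  define h where "h = y - y1"
  have y: "y = y1 + h" "y1 + y2 - y = y2 - h" by (auto simp: h_def)
  have s: "inner y1 (P h) = inner h z" "inner y2 (Q h) = inner h z"
    using selfadj_inner[OF positive_selfadj[OF P], of y1 h] selfadj_inner[OF positive_selfadj[OF Q], of y2 h]
    by (simp_all add: z inner_commute)
  have "inner y (P y) + inner (y1 + y2 - y) (Q (y1 + y2 - y))
      = inner (y1 + y2) z + (inner h (P h) + inner h (Q h))"
    unfolding y eq by (simp add: op_simps positive_op_op P Q inner_add_left inner_add_right
        inner_diff_left inner_diff_right z s)
  thus "inner (y1 + y2) z \<le> inner y (P y) + inner (y1 + y2 - y) (Q (y1 + y2 - y))"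
    using positive_inner[OF P, of h] positive_inner[OF Q, of h] by simp
qed

text \<open>\<open>positive_norm_sq\<close> at the preimage of \<open>x\<close> bounds the form
  below by the squared norm over \<open>K\<close>. This makes the sum of two inverses invertible
  again.\<close>

lemma positive_inv_lower:
  assumes P: "positive_op P" and "0 < \<delta>" and \<delta>: "\<And>x. \<delta> * (norm x)\<^sup>2 \<le> inner x (P x)"
  shows "\<exists>c>0. \<forall>x. c * (norm x)\<^sup>2 \<le> inner x (inv_into UNIV P x)"
proof -
  obtain K where K: "0 < K" "\<And>x. norm (P x) \<le> K * norm x"
    using bounded_op_bound[OF positive_op_op[OF P]] by auto
  have "1 / K * (norm x)\<^sup>2 \<le> inner x (inv_into UNIV P x)" for x
    using positive_norm_sq[OF P K(2), of "inv_into UNIV P x"] K(1)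
    by (simp add: positive_f_inv[OF assms] inner_commute field_simps)
  thus ?thesis using K(1) by (intro exI[of _ "1 / K"]) auto
qed

text \<open>With \<open>z = Z x\<close>, the split of \<open>x\<close> into the preimages
  \<open>y1\<close> and \<open>y2\<close> of \<open>z\<close> is optimal for \<open>A + e\<close>
  and \<open>B + e\<close>. Dropping the \<open>e\<close> terms gives the lower estimate, keeping
  them the upper one.\<close>

lemma regularized_parallel_sum:
  fixes A B :: "'a::complex_hilbert_space \<Rightarrow> 'a"
  assumes A: "positive_op A" and B: "positive_op B" and e: "0 < e"
  defines "Z \<equiv> inv_into UNIV (\<lambda>y. inv_into UNIV (\<lambda>z. A z + e *\<^sub>R z) y + inv_into UNIV (\<lambda>z. B z + e *\<^sub>R z) y)"
  shows "positive_op Z"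
    and "\<exists>y. inner y (A y) + inner (x - y) (B (x - y)) \<le> inner x (Z x)"
    and "inner x (Z x) \<le> inner y (A y) + inner (x - y) (B (x - y)) + e * ((norm y)\<^sup>2 + (norm (x - y))\<^sup>2)"
proof -
  define P where "P z = A z + e *\<^sub>R z" for z
  define Q where "Q z = B z + e *\<^sub>R z" for z
  have id: "positive_op (\<lambda>x::'a. x)" by (intro positive_opI selfadj_id) simp
  have P: "positive_op P" "\<And>x. e * (norm x)\<^sup>2 \<le> inner x (P x)"
    unfolding P_def using positive_plus[OF A positive_scale[OF id, of e]] e positive_inner[OF A]
    by (auto simp: inner_add_right power2_norm_eq_inner)
  have Q: "positive_op Q" "\<And>x. e * (norm x)\<^sup>2 \<le> inner x (Q x)"
    unfolding Q_def using positive_plus[OF B positive_scale[OF id, of e]] e positive_inner[OF B]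
    by (auto simp: inner_add_right power2_norm_eq_inner)
  define W where "W y = inv_into UNIV P y + inv_into UNIV Q y" for y
  have Pi: "positive_op (inv_into UNIV P)" by (rule positive_inv[OF P(1) e P(2)])
  have Qi: "positive_op (inv_into UNIV Q)" by (rule positive_inv[OF Q(1) e Q(2)])
  have W: "positive_op W" unfolding W_def[abs_def] by (intro positive_plus Pi Qi)
  obtain c where c: "0 < c" "\<And>x. c * (norm x)\<^sup>2 \<le> inner x (inv_into UNIV P x)"
    using positive_inv_lower[OF P(1) e P(2)] by blast
  have Wc: "c * (norm x)\<^sup>2 \<le> inner x (W x)" for x
    using c(2)[of x] positive_inner[OF Qi, of x] by (simp add: W_def inner_add_right)
  have Z: "Z = inv_into UNIV W" by (simp add: Z_def W_def[abs_def] P_def[abs_def] Q_def[abs_def])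
  show "positive_op Z" unfolding Z by (rule positive_inv[OF W c(1) Wc])
  define z where "z = Z x"
  define y1 where "y1 = inv_into UNIV P z"
  define y2 where "y2 = inv_into UNIV Q z"
  have "W (Z x) = x" using positive_f_inv[OF W c(1) Wc, of x] by (simp only: Z)
  hence sum: "y1 + y2 = x" by (simp only: y1_def y2_def z_def W_def)
  have yz: "P y1 = z" "Q y2 = z"
    by (simp_all add: y1_def y2_def positive_f_inv[OF P(1) e P(2)] positive_f_inv[OF Q(1) e Q(2)])
  have Pf: "inner v (P v) = inner v (A v) + e * (norm v)\<^sup>2" and Qf: "inner v (Q v) = inner v (B v) + e * (norm v)\<^sup>2" for v
    by (simp_all add: P_def Q_def inner_add_right power2_norm_eq_inner)
  show "inner x (Z x) \<le> inner y (A y) + inner (x - y) (B (x - y)) + e * ((norm y)\<^sup>2 + (norm (x - y))\<^sup>2)"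
    using parallel_form_le[OF P(1) Q(1) yz, of y] unfolding sum Pf Qf z_def by (simp add: algebra_simps)
  have "x - y1 = y2" using sum by auto
  hence "inner y1 (A y1) + inner (x - y1) (B (x - y1)) \<le> inner x (Z x)"
    using parallel_form_eq[OF P(1) Q(1) yz] e unfolding sum Pf Qf z_def by simp
  thus "\<exists>y. inner y (A y) + inner (x - y) (B (x - y)) \<le> inner x (Z x)" ..
qed

text \<open>The variational characterization of a candidate \<open>Z\<close> for the parallel sum forces the strong
  convergence of the regularizations to \<open>Z\<close>.\<close>

lemma parallel_sum_eqI:
  assumes A: "positive_op A" and B: "positive_op B" and Z: "positive_op Z"
    and low: "\<And>x y. inner x (Z x) \<le> inner y (A y) + inner (x - y) (B (x - y))"
    and up: "\<And>x e. 0 < e \<Longrightarrow> \<exists>y. inner y (A y) + inner (x - y) (B (x - y)) < inner x (Z x) + e"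
  shows "parallel_sum A B = Z"
proof
  fix x
  define Y where "Y e = inv_into UNIV (\<lambda>y. inv_into UNIV (\<lambda>z. A z + e *\<^sub>R z) y + inv_into UNIV (\<lambda>z. B z + e *\<^sub>R z) y)" for e
  obtain K where K: "0 < K" "\<And>x. norm (A x) \<le> K * norm x"
    using bounded_op_bound[OF positive_op_op[OF A]] by auto
  \<comment> \<open>The regularized sums lie above \<open>Z\<close>, since each dominates the
    unregularized form at some split.\<close>
  have D: "positive_op (\<lambda>x. Y e x - Z x)" if e: "0 < e" for e
  proof (rule positive_opI)
    show "selfadj (\<lambda>x. Y e x - Z x)"
      unfolding Y_def by (intro selfadj_sub positive_selfadj regularized_parallel_sum(1) A B Z e)
    show "0 \<le> inner x (Y e x - Z x)" for x
    proof -
      obtain y where "inner y (A y) + inner (x - y) (B (x - y)) \<le> inner x (Y e x)"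
        using regularized_parallel_sum(2)[OF A B e, of x] unfolding Y_def by blast
      thus ?thesis using low[of x y] by (simp add: inner_diff_right)
    qed
  qed
  \<comment> \<open>For \<open>e < 1\<close> the differences have the common bound
    \<open>K + 1\<close>, found by testing with the split \<open>y = x\<close>. Convergence of the
    forms then gives convergence of the vectors.\<close>
  have Dsq: "(norm (Y e x - Z x))\<^sup>2 \<le> (K + 1) * (inner x (Y e x) - inner x (Z x))" if e: "0 < e" "e < 1" for e
  proof -
    have "inner x (Y e x - Z x) \<le> (K + 1) * (norm x)\<^sup>2" for x
    proof -
      have "inner x (Y e x - Z x) \<le> inner x (Y e x)"
        using positive_inner[OF Z, of x] by (simp add: inner_diff_right)
      also have "\<dots> \<le> inner x (A x) + inner (x - x) (B (x - x)) + e * ((norm x)\<^sup>2 + (norm (x - x))\<^sup>2)"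
        unfolding Y_def by (rule regularized_parallel_sum(3)[OF A B e(1)])
      also have "\<dots> \<le> norm x * (K * norm x) + 1 * (norm x)\<^sup>2"
        using order_trans[OF norm_cauchy_schwarz mult_left_mono[OF K(2)], of x x] e
          mult_right_mono[of e 1 "(norm x)\<^sup>2"]
        by (intro add_mono) auto
      finally show ?thesis by (simp add: power2_eq_square algebra_simps)
    qed
    hence "norm (Y e x - Z x) \<le> (K + 1) * norm x" for x
      using K(1) by (intro norm_le_of_form[OF D[OF e(1)]]) auto
    from positive_norm_sq[OF D[OF e(1)] this] show ?thesis by (simp add: inner_diff_right)
  qed
  have "((\<lambda>e. inner x (Y e x)) \<longlongrightarrow> inner x (Z x)) (at_right 0)"
  proof (rule order_tendstoI)
    fix a assume a: "a < inner x (Z x)"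
    have "\<forall>\<^sub>F e in at_right 0. (0::real) < e" by (rule eventually_at_right_less)
    thus "\<forall>\<^sub>F e in at_right 0. a < inner x (Y e x)"
      by eventually_elim (use a D[THEN positive_inner, of _ x] in \<open>fastforce simp: inner_diff_right\<close>)
  next
    fix a assume a: "inner x (Z x) < a"
    obtain y where y: "inner y (A y) + inner (x - y) (B (x - y)) < a"
      using up[of "a - inner x (Z x)" x] a by auto
    have "((\<lambda>e. inner y (A y) + inner (x - y) (B (x - y)) + e * ((norm y)\<^sup>2 + (norm (x - y))\<^sup>2))
        \<longlongrightarrow> inner y (A y) + inner (x - y) (B (x - y)) + 0 * ((norm y)\<^sup>2 + (norm (x - y))\<^sup>2)) (at_right 0)"
      by (intro tendsto_intros)
    hence "\<forall>\<^sub>F e in at_right 0. inner y (A y) + inner (x - y) (B (x - y)) + e * ((norm y)\<^sup>2 + (norm (x - y))\<^sup>2) < a"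
      using y by (intro order_tendstoD(2)) auto
    moreover have "\<forall>\<^sub>F e in at_right 0. (0::real) < e" by (rule eventually_at_right_less)
    ultimately show "\<forall>\<^sub>F e in at_right 0. inner x (Y e x) < a"
      by eventually_elim (use regularized_parallel_sum(3)[OF A B, of _ x y] in \<open>force simp: Y_def\<close>)
  qed
  hence "((\<lambda>e. (K + 1) * (inner x (Y e x) - inner x (Z x))) \<longlongrightarrow> (K + 1) * (inner x (Z x) - inner x (Z x))) (at_right 0)"
    by (rule tendsto_mult[OF tendsto_const tendsto_diff[OF _ tendsto_const]])
  hence lim: "((\<lambda>e. (K + 1) * (inner x (Y e x) - inner x (Z x))) \<longlongrightarrow> 0) (at_right 0)"
    by (simp only: diff_self mult_zero_right)
  have "((\<lambda>e. (norm (Y e x - Z x))\<^sup>2) \<longlongrightarrow> 0) (at_right 0)"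
  proof (rule tendsto_sandwich[OF _ _ tendsto_const lim])
    have "\<forall>\<^sub>F e in at_right 0. e \<in> {0<..<1::real}" by (rule eventually_at_right_real) simp
    thus "\<forall>\<^sub>F e in at_right 0. (norm (Y e x - Z x))\<^sup>2 \<le> (K + 1) * (inner x (Y e x) - inner x (Z x))"
      by eventually_elim (use Dsq in auto)
  qed simp
  hence "((\<lambda>e. sqrt ((norm (Y e x - Z x))\<^sup>2)) \<longlongrightarrow> sqrt 0) (at_right 0)" by (rule tendsto_real_sqrt)
  hence "((\<lambda>e. norm (Y e x - Z x)) \<longlongrightarrow> 0) (at_right 0)" by (simp only: real_sqrt_abs abs_norm_cancel real_sqrt_zero)
  hence "((\<lambda>e. Y e x - Z x) \<longlongrightarrow> 0) (at_right 0)" by (rule tendsto_norm_zero_cancel)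
  hence "((\<lambda>e. Y e x) \<longlongrightarrow> Z x) (at_right 0)" by (rule LIM_zero_cancel)
  thus "parallel_sum A B x = Z x"
    unfolding parallel_sum_def Y_def by (intro tendsto_Lim) auto
qed

text \<open>The candidate is \<open>T C T\<close>, where \<open>C = l R S (R + l S)^(-1)\<close> is
  the parallel sum of the commuting operators \<open>R\<close> and \<open>l S\<close>, with
  \<open>S = 1 - R\<close>. The vector \<open>u\<close> of the second claim is the preimage of
  \<open>T x\<close> under \<open>R + l S\<close>, the form in which
  \<open>nn_integral_harmonic\<close> accepts it.\<close>

lemma parallel_sum_via_R:
  fixes A B :: "'a::complex_hilbert_space \<Rightarrow> 'a"
  assumes A: "positive_op A" and B: "positive_op B" and l: "0 < l"
  defines "T \<equiv> T_op A B" and "R \<equiv> R_op A B"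
  shows positive_parallel_sum: "positive_op (parallel_sum A (\<lambda>x. l *\<^sub>R B x))"
    and parallel_sum_form: "\<exists>u\<in>H_sp A B. R u + l *\<^sub>R (u - R u) = T x \<and>
      inner x (parallel_sum A (\<lambda>x. l *\<^sub>R B x) x) = l * inner (T x) (R (u - R u))"
    and parallel_sum_le: "inner x (parallel_sum A (\<lambda>x. l *\<^sub>R B x) x) \<le> inner y (A y) + l * inner (x - y) (B (x - y))"
    and parallel_sum_approx: "0 < e \<Longrightarrow> \<exists>y. inner y (A y) + l * inner (x - y) (B (x - y))
      < inner x (parallel_sum A (\<lambda>x. l *\<^sub>R B x) x) + e"
proof -
  let ?M = "H_sp A B"
  note T = selfadj_T_op[OF A B, folded T_def] and R = positive_R_op[OF A B, folded R_def]
    and R1 = R_op_le[OF A B, folded R_def] and RM = op_on_R_op[OF A B, folded R_def]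
    and M = closed_csub_H_sp[OF A B]
  note sR = positive_selfadj[OF R] and Rop = positive_op_op[OF R] and Top = selfadj_op[OF T]
  have A_eq: "A x = T (R (T x))" and B_eq: "B x = T (T x - R (T x))" for x
    using A_eq_T_R_T[OF A B] B_eq_T_S_T[OF A B] by (simp_all add: T_def R_def)
  have RinM: "R x \<in> ?M" for x using RM by (auto simp: op_on_def)
  have TinM: "T x \<in> ?M" for x unfolding T_def by (rule T_op_in_H_sp[OF A B])
  define S where "S x = x - R x" for x
  have S: "positive_op S"
    unfolding S_def by (intro positive_opI selfadj_intros sR)
      (use R1 in \<open>simp add: inner_diff_right power2_norm_eq_inner[symmetric]\<close>)
  note sS = positive_selfadj[OF S] and Sop = positive_op_op[OF S]
  have lS: "positive_op (\<lambda>x. l *\<^sub>R S x)" using l by (intro positive_scale S) auto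
  define K where "K x = R x + l *\<^sub>R S x" for x
  have K: "positive_op K" unfolding K_def[abs_def] by (intro positive_plus R lS)
  have Kmin: "min 1 l * (norm x)\<^sup>2 \<le> inner x (K x)" for x
  proof -
    have "min 1 l * (norm x)\<^sup>2 = min 1 l * inner x (R x) + min 1 l * inner x (S x)"
      by (simp add: S_def inner_diff_right power2_norm_eq_inner algebra_simps)
    also have "\<dots> \<le> 1 * inner x (R x) + l * inner x (S x)"
      by (intro add_mono mult_right_mono positive_inner R S) auto
    finally show ?thesis by (simp add: K_def inner_add_right)
  qed
  have min0: "0 < min 1 l" using l by simp
  define G where "G = inv_into UNIV K"
  have G: "positive_op G" unfolding G_def by (rule positive_inv[OF K min0 Kmin])
  have KG: "K (G w) = w" and GK: "G (K w) = w" for w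
    unfolding G_def by (rule positive_f_inv[OF K min0 Kmin] positive_inv_f[OF K min0 Kmin])+
  note sG = positive_selfadj[OF G]
  have RS: "R (S x) = S (R x)" for x by (simp add: S_def op_simps Rop)
  have RK: "R (K x) = K (R x)" for x by (simp add: K_def op_simps Rop RS)
  have RG: "R (G x) = G (R x)" for x using RK[of "G x"] GK[of "R (G x)"] by (simp add: KG)
  have SG: "S (G x) = G (S x)" for x by (simp add: S_def RG op_simps selfadj_op[OF sG])
  define C where "C w = l *\<^sub>R R (S (G w))" for w
  have sC: "selfadj C"
  proof -
    have "selfadj (\<lambda>w. S (G w))" by (rule selfadj_comp[OF sS sG SG])
    hence "selfadj (\<lambda>w. R (S (G w)))" by (rule selfadj_comp[OF sR]) (simp add: RS RG SG)
    thus ?thesis unfolding C_def[abs_def] by (rule selfadj_scale)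
  qed
  \<comment> \<open>The optimal split of \<open>w\<close>: \<open>v w\<close> and its complement
    \<open>R (G w)\<close> are both mapped to \<open>C w\<close>, by \<open>R\<close> and
    \<open>l S\<close> respectively.\<close>
  define v where "v w = l *\<^sub>R S (G w)" for w
  have vR: "v w + R (G w) = w" for w using KG[of w] by (simp add: v_def K_def add.commute)
  have RvC: "R (v w) = C w" "l *\<^sub>R S (R (G w)) = C w" for w
    by (simp_all add: v_def C_def op_simps Rop RS)
  have Ceq: "inner w (C w) = inner (v w) (R (v w)) + l * inner (w - v w) (S (w - v w))" for w
  proof -
    have "w - v w = R (G w)" using vR[of w] by (metis add_diff_cancel_left')
    thus ?thesis using parallel_form_eq[OF R lS RvC(1) RvC(2), of w] by (simp add: vR)
  qed
  have Cle: "inner w (C w) \<le> inner y (R y) + l * inner (w - y) (S (w - y))" for w y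
    using parallel_form_le[OF R lS RvC(1) RvC(2), of w y] by (simp add: vR)
  have C: "positive_op C"
  proof (rule positive_opI[OF sC])
    show "0 \<le> inner w (C w)" for w
      unfolding Ceq using l by (intro add_nonneg_nonneg mult_nonneg_nonneg positive_inner R S) auto
  qed
  define Z where "Z x = T (C (T x))" for x
  have Z: "positive_op Z" unfolding Z_def[abs_def] by (rule positive_conj[OF T C])
  have Zf: "inner x (Z x) = inner (T x) (C (T x))" for x by (simp add: Z_def selfadj_inner[OF T])
  have AB: "inner y (A y) + inner (x - y) (l *\<^sub>R B (x - y))
      = inner (T y) (R (T y)) + l * inner (T x - T y) (S (T x - T y))" for x y
    by (simp add: A_eq B_eq selfadj_inner[OF T, symmetric] S_def bounded_op_diff[OF Top, symmetric])
  \<comment> \<open>\<open>K (G w) = w\<close> can be solved for \<open>l G w\<close> in terms of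
    \<open>w\<close> and \<open>R (G w)\<close>, which both lie in \<open>H_sp\<close>.\<close>
  have GinM: "G w \<in> ?M" if "w \<in> ?M" for w
  proof -
    have "l *\<^sub>R G w = w - (1 - l) *\<^sub>R R (G w)"
      using KG[of w] by (simp add: K_def S_def algebra_simps)
    moreover have "w - (1 - l) *\<^sub>R R (G w) \<in> ?M"
      using that RinM by (intro closed_csub_arith(3,4)[OF M]) auto
    ultimately have "l *\<^sub>R G w \<in> ?M" by simp
    from closed_csub_arith(4)[OF M this, of "1 / l"] show ?thesis using l by simp
  qed
  have vM: "v w \<in> ?M" if "w \<in> ?M" for w
    unfolding v_def S_def by (intro closed_csub_arith(3,4)[OF M] GinM that RinM)
  \<comment> \<open>The optimal \<open>v (T x)\<close> lies in the closure of the range of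
    \<open>T\<close> but need not be some \<open>T y\<close>; the infimum is approached and perhaps
    not attained.\<close>
  have up: "\<exists>y. inner y (A y) + inner (x - y) (l *\<^sub>R B (x - y)) < inner x (Z x) + e" if e: "0 < e" for x e
  proof -
    define q where "q s = inner s (R s) + l * inner (T x - s) (S (T x - s))" for s
    have "v (T x) \<in> closure (range T)"
      using vM[OF TinM] H_sp_subset[OF A B] by (auto simp: T_def)
    then obtain f where f: "\<And>n. f n \<in> range T" "f \<longlonglongrightarrow> v (T x)" by (metis closure_sequential)
    have "(\<lambda>n. q (f n)) \<longlonglongrightarrow> q (v (T x))"
      unfolding q_def by (intro tendsto_intros f(2) bounded_op_tendsto[OF Rop] bounded_op_tendsto[OF Sop])
    hence "\<forall>\<^sub>F n in sequentially. q (f n) < inner x (Z x) + e"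
      using e by (intro order_tendstoD(2)) (auto simp: Zf Ceq q_def)
    then obtain n where "q (f n) < inner x (Z x) + e" by (auto simp: eventually_sequentially)
    moreover obtain y where "f n = T y" using f(1)[of n] by auto
    ultimately show ?thesis unfolding AB q_def by auto
  qed
  have low: "inner x (Z x) \<le> inner y (A y) + inner (x - y) (l *\<^sub>R B (x - y))" for x y
    unfolding AB Zf by (rule Cle)
  have eq: "parallel_sum A (\<lambda>x. l *\<^sub>R B x) = Z"
    by (rule parallel_sum_eqI[OF A _ Z low up]) (use l B in \<open>auto intro: positive_scale\<close>)
  show "positive_op (parallel_sum A (\<lambda>x. l *\<^sub>R B x))" unfolding eq by (rule Z)
  show "inner x (parallel_sum A (\<lambda>x. l *\<^sub>R B x) x) \<le> inner y (A y) + l * inner (x - y) (B (x - y))"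
    unfolding eq using low[of x y] by simp
  show "\<exists>y. inner y (A y) + l * inner (x - y) (B (x - y))
      < inner x (parallel_sum A (\<lambda>x. l *\<^sub>R B x) x) + e" if "0 < e"
    unfolding eq using up[OF that, of x] by simp
  show "\<exists>u\<in>?M. R u + l *\<^sub>R (u - R u) = T x \<and>
      inner x (parallel_sum A (\<lambda>x. l *\<^sub>R B x) x) = l * inner (T x) (R (u - R u))"
    unfolding eq
    by (rule bexI[OF _ GinM[OF TinM[of x]]])
       (use KG[of "T x"] in \<open>simp add: K_def S_def Zf C_def\<close>)
qed

text \<open>Both sides are infima of the same quadratic form.\<close>

lemma parallel_sum_swap:
  assumes A: "positive_op A" and B: "positive_op B" and l: "0 < l"
  shows "inner x (parallel_sum B (\<lambda>x. l *\<^sub>R A x) x) = l * inner x (parallel_sum A (\<lambda>x. (1 / l) *\<^sub>R B x) x)"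
proof -
  have l': "0 < 1 / l" using l by simp
  define p where "p = inner x (parallel_sum B (\<lambda>x. l *\<^sub>R A x) x)"
  define q where "q = inner x (parallel_sum A (\<lambda>x. (1 / l) *\<^sub>R B x) x)"
  have "p \<le> l * q + e" if "0 < e" for e
  proof -
    have "0 < e / l" using that l by simp
    then obtain y where y: "inner y (A y) + 1 / l * inner (x - y) (B (x - y)) < q + e / l"
      using parallel_sum_approx[OF A B l', of "e / l" x] by (auto simp: q_def)
    \<comment> \<open>A split of \<open>x\<close> with part \<open>y\<close> for one pair is a split
      with part \<open>x - y\<close> for the exchanged pair.\<close>
    have "p \<le> inner (x - y) (B (x - y)) + l * inner (x - (x - y)) (A (x - (x - y)))"
      unfolding p_def by (rule parallel_sum_le[OF B A l])
    also have "\<dots> = l * (inner y (A y) + 1 / l * inner (x - y) (B (x - y)))"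
      using l by (simp add: field_simps)
    also have "\<dots> \<le> l * (q + e / l)" using y l by (intro mult_left_mono) auto
    also have "\<dots> = l * q + e" using l by (simp add: distrib_left)
    finally show ?thesis .
  qed
  hence 1: "p \<le> l * q" by (rule field_le_epsilon)
  have "l * q \<le> p + e" if e: "0 < e" for e
  proof -
    obtain y where y: "inner y (B y) + l * inner (x - y) (A (x - y)) < p + e"
      using parallel_sum_approx[OF B A l e, of x] by (auto simp: p_def)
    have "q \<le> inner (x - y) (A (x - y)) + 1 / l * inner (x - (x - y)) (B (x - (x - y)))"
      unfolding q_def by (rule parallel_sum_le[OF A B l'])
    hence "l * q \<le> l * (inner (x - y) (A (x - y)) + 1 / l * inner y (B y))"
      using l by (intro mult_left_mono) auto
    also have "\<dots> = inner y (B y) + l * inner (x - y) (A (x - y))"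
      using l by (simp add: field_simps)
    finally show ?thesis using y by simp
  qed
  hence "l * q \<le> p" by (rule field_le_epsilon)
  thus ?thesis using 1 by (simp add: p_def q_def)
qed

section \<open>Normal functionals as sums of vector functionals\<close>

lemma onb_exists: "\<exists>B::'a::complex_hilbert_space set. is_onb B"
proof -
  define \<A> where "\<A> = {B::'a set. (\<forall>e\<in>B. norm e = 1) \<and> (\<forall>e\<in>B. \<forall>e'\<in>B. e \<noteq> e' \<longrightarrow> cinner e e' = 0)}"
  have "\<exists>B\<in>\<A>. \<forall>X\<in>\<A>. B \<subseteq> X \<longrightarrow> X = B"
  proof (rule subset_Zorn')
    fix C assume C: "subset.chain \<A> C"
    have sub: "C \<subseteq> \<A>" using C by (simp add: subset.chain_def)
    have "cinner e e' = 0" if "e \<in> X" "X \<in> C" "e' \<in> Y" "Y \<in> C" "e \<noteq> e'" for e e' X Y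
    proof -
      have "X \<subseteq> Y \<or> Y \<subseteq> X" using C that by (simp add: subset_chain_def)
      moreover have "X \<in> \<A>" "Y \<in> \<A>" using sub that by auto
      ultimately show ?thesis using that unfolding \<A>_def by blast
    qed
    thus "\<Union>C \<in> \<A>" using sub unfolding \<A>_def by blast
  qed
  then obtain B where B: "B \<in> \<A>" "\<And>X. X \<in> \<A> \<Longrightarrow> B \<subseteq> X \<Longrightarrow> X = B" by blast
  have "x = 0" if x: "\<And>e. e \<in> B \<Longrightarrow> cinner e x = 0" for x
  proof (rule ccontr)
    assume "x \<noteq> 0"
    define y where "y = scaleC (complex_of_real (1 / norm x)) x"
    have y: "norm y = 1" "\<And>e. e \<in> B \<Longrightarrow> cinner e y = 0"
      using x \<open>x \<noteq> 0\<close> by (auto simp: y_def norm_scaleC cinner_scaleC_right norm_divide)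
    have y': "cinner y e = 0" if "e \<in> B" for e
      using y(2)[OF that] by (subst cinner_commute) simp
    have "insert y B \<in> \<A>" using B(1) y y' unfolding \<A>_def by auto
    hence "y \<in> B" using B(2) by blast
    hence "cinner y y = 0" using y by blast
    thus False using y(1) by (simp add: cinner_self)
  qed
  hence "is_onb B" using B(1) by (auto simp: is_onb_def \<A>_def)
  thus ?thesis ..
qed

lemma is_onb_the_onb: "is_onb (the_onb :: 'a::complex_hilbert_space set)"
  unfolding the_onb_def by (rule someI_ex[OF onb_exists])

lemma bounded_linear_cinner: "bounded_linear (cinner (x::'a::complex_hilbert_space))"
proof (rule bounded_linear_intro[where K="norm x"])
  show "cinner x (r *\<^sub>R y) = r *\<^sub>R cinner x y" for r y
    by (simp add: scaleC_of_real[symmetric] cinner_scaleC_right scaleR_conv_of_real)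
  show "norm (cinner x y) \<le> norm y * norm x" for y
    using cmod_cinner_le[of x y] by (simp add: mult.commute)
qed (rule cinner_add_right)

section \<open>Expansion in an orthonormal basis\<close>

locale onb =
  fixes B :: "'a::complex_hilbert_space set"
  assumes onb: "is_onb B"
begin

lemma cinner_B: "e \<in> B \<Longrightarrow> e' \<in> B \<Longrightarrow> cinner e e' = (if e = e' then 1 else 0)"
  using onb by (auto simp: is_onb_def cinner_self)

definition part :: "'a set \<Rightarrow> 'a \<Rightarrow> 'a" where
  "part F x = (\<Sum>e\<in>F. scaleC (cinner e x) e)"

lemma cinner_part: "finite F \<Longrightarrow> F \<subseteq> B \<Longrightarrow> e \<in> F \<Longrightarrow> cinner e (x - part F x) = 0"
proof -
  assume F: "finite F" "F \<subseteq> B" "e \<in> F"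
  have "cinner e (part F x) = (\<Sum>g\<in>F. cinner g x * cinner e g)"
    by (simp add: part_def cinner_sum_right cinner_scaleC_right)
  also have "\<dots> = (\<Sum>g\<in>F. if g = e then cinner e x else 0)"
    by (rule sum.cong) (use F in \<open>auto simp: cinner_B subset_iff\<close>)
  finally show ?thesis using F by (simp add: cinner_diff_right)
qed

text \<open>Best approximation makes the error monotone in \<open>F\<close>; one good finite set
  then controls all larger ones, which is convergence of the net of partial sums.\<close>

lemma norm_part_best:
  assumes F: "finite F" "F \<subseteq> B"
  shows "norm (x - part F x) \<le> norm (x - (\<Sum>e\<in>F. scaleC (c e) e))"
proof -
  define p where "p = part F x - (\<Sum>e\<in>F. scaleC (c e) e)"
  have p: "p = (\<Sum>e\<in>F. scaleC (cinner e x) e - scaleC (c e) e)"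
    by (simp add: p_def part_def sum_subtractf)
  have "cinner (x - part F x) e = 0" if "e \<in> F" for e
    using cinner_part[OF F that, of x] by (subst cinner_commute) simp
  hence "cinner (x - part F x) p = 0"
    by (simp add: p cinner_sum_right cinner_diff_right cinner_scaleC_right)
  hence "inner (x - part F x) p = 0" by (simp add: inner_eq_Re_cinner)
  hence "(norm (x - part F x + p))\<^sup>2 = (norm (x - part F x))\<^sup>2 + (norm p)\<^sup>2"
    by (simp add: power2_norm_eq_inner inner_add_left inner_add_right inner_commute)
  hence "(norm (x - part F x))\<^sup>2 \<le> (norm (x - part F x + p))\<^sup>2" by simp
  hence "norm (x - part F x) \<le> norm (x - part F x + p)" by (simp add: power2_le_iff_abs_le)
  thus ?thesis by (simp add: p_def)
qed

lemma norm_part_le: "finite F \<Longrightarrow> F \<subseteq> B \<Longrightarrow> norm (x - part F x) \<le> norm x"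
  using norm_part_best[of F x "\<lambda>_. 0"] by (simp add: scaleC_eq)

lemma norm_part_mono:
  assumes "finite F'" "F \<subseteq> F'" "F' \<subseteq> B"
  shows "norm (x - part F' x) \<le> norm (x - part F x)"
proof -
  have "part F x = (\<Sum>e\<in>F'. scaleC (if e \<in> F then cinner e x else 0) e)"
    unfolding part_def using assms by (intro sum.mono_neutral_cong_left) (auto simp: scaleC_eq)
  thus ?thesis using norm_part_best[OF assms(1,3), of x] by metis
qed

lemma part_add: "part F (x + y) = part F x + part F y"
  by (simp add: part_def cinner_add_right scaleC_add_left sum.distrib)

lemma part_scaleC: "part F (scaleC u x) = scaleC u (part F x)"
proof -
  have "linear (scaleC u :: 'a \<Rightarrow> 'a)"
    by (rule linearI) (simp_all add: scaleC_add_right scaleC_of_real[symmetric] scaleC_scaleC mult.commute)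
  thus ?thesis by (simp add: part_def cinner_scaleC_right linear_sum scaleC_scaleC)
qed

text \<open>The vectors approximable in this way form a closed complex subspace containing the
  basis, and a vector orthogonal to that subspace is orthogonal to the basis, hence zero.\<close>

lemma part_approx: "0 < \<epsilon> \<Longrightarrow> \<exists>F. finite F \<and> F \<subseteq> B \<and> norm (x - part F x) < \<epsilon>"
proof -
  define V where "V = {x. \<forall>\<epsilon>>0. \<exists>F. finite F \<and> F \<subseteq> B \<and> norm (x - part F x) < \<epsilon>}"
  have scale: "scaleC u x \<in> V" if "x \<in> V" for u x
    unfolding V_def
  proof (intro CollectI allI impI)
    fix \<epsilon> :: real assume "0 < \<epsilon>"
    \<comment> \<open>Adding 1 covers the case \<open>u = 0\<close>.\<close>
    hence "0 < \<epsilon> / (cmod u + 1)" by (simp add: add_nonneg_pos)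
    then obtain F where F: "finite F" "F \<subseteq> B" "norm (x - part F x) < \<epsilon> / (cmod u + 1)"
      using \<open>x \<in> V\<close> unfolding V_def by blast
    have "scaleC u x - part F (scaleC u x) = scaleC u (x - part F x)"
    proof -
      have "scaleC u x = scaleC u (x - part F x) + scaleC u (part F x)"
        by (simp add: scaleC_add_right[symmetric])
      thus ?thesis unfolding part_scaleC by (metis add_diff_cancel_right')
    qed
    hence "norm (scaleC u x - part F (scaleC u x)) = cmod u * norm (x - part F x)"
      by (simp add: norm_scaleC)
    also have "\<dots> \<le> (cmod u + 1) * norm (x - part F x)" by (intro mult_right_mono) auto
    also have "\<dots> < \<epsilon>" using F(3) by (simp add: pos_less_divide_eq add_nonneg_pos mult.commute)
    finally show "\<exists>F. finite F \<and> F \<subseteq> B \<and> norm (scaleC u x - part F (scaleC u x)) < \<epsilon>" using F by blast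
  qed
  have V: "closed_csub V"
  proof (rule closed_csubI)
    show "0 \<in> V" unfolding V_def by (auto intro!: exI[of _ "{}"] simp: part_def)
    show "r *\<^sub>R x \<in> V" if "x \<in> V" for r x using scale[OF that, of "complex_of_real r"] by (simp add: scaleC_of_real)
    show "iC x \<in> V" if "x \<in> V" for x using scale[OF that, of \<i>] by (simp add: iC_def)
    show "x + y \<in> V" if xy: "x \<in> V" "y \<in> V" for x y
      unfolding V_def
    proof (intro CollectI allI impI)
      fix \<epsilon> :: real assume "0 < \<epsilon>"
      hence "0 < \<epsilon> / 2" by simp
      with xy obtain F G where F: "finite F" "F \<subseteq> B" "norm (x - part F x) < \<epsilon> / 2"
        and G: "finite G" "G \<subseteq> B" "norm (y - part G y) < \<epsilon> / 2" unfolding V_def by blast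
      have "norm (x - part (F \<union> G) x) < \<epsilon> / 2" "norm (y - part (F \<union> G) y) < \<epsilon> / 2"
        using norm_part_mono[of "F \<union> G" F x] norm_part_mono[of "F \<union> G" G y] F G by auto
      hence "norm ((x - part (F \<union> G) x) + (y - part (F \<union> G) y)) < \<epsilon>"
        by (intro norm_triangle_lt) simp
      moreover have "(x - part (F \<union> G) x) + (y - part (F \<union> G) y) = (x + y) - part (F \<union> G) (x + y)"
        by (simp add: part_add)
      ultimately show "\<exists>F. finite F \<and> F \<subseteq> B \<and> norm (x + y - part F (x + y)) < \<epsilon>"
        using F G by (intro exI[of _ "F \<union> G"]) auto
    qed
    show "closed V"
      unfolding closed_sequential_limits
    proof (intro allI impI, elim conjE)
      fix f x assume f: "\<forall>n. f n \<in> V" "f \<longlonglongrightarrow> x"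
      show "x \<in> V" unfolding V_def
      proof (intro CollectI allI impI)
        fix \<epsilon> :: real assume "0 < \<epsilon>"
        hence e: "0 < \<epsilon> / 2" by simp
        obtain n where n: "norm (f n - x) < \<epsilon> / 2"
          using f(2) e unfolding LIMSEQ_iff by blast
        obtain F where F: "finite F" "F \<subseteq> B" "norm (f n - part F (f n)) < \<epsilon> / 2"
          using spec[OF f(1), of n] e unfolding V_def by blast
        have "part F x = part F (x - f n) + part F (f n)" using part_add[of F "x - f n" "f n"] by simp
        hence "x - part F x = ((x - f n) - part F (x - f n)) + (f n - part F (f n))" by simp
        moreover have "norm ((x - f n) - part F (x - f n)) < \<epsilon> / 2"
          using norm_part_le[OF F(1,2), of "x - f n"] n by (simp add: norm_minus_commute)
        ultimately have "norm (x - part F x) < \<epsilon>" using F(3) norm_triangle_lt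
          by (metis add_strict_mono field_sum_of_halves)
        thus "\<exists>F. finite F \<and> F \<subseteq> B \<and> norm (x - part F x) < \<epsilon>" using F by blast
      qed
    qed
  qed
  have BV: "e \<in> V" if "e \<in> B" for e
    unfolding V_def using that
    by (auto intro!: exI[of _ "{e}"] simp: part_def cinner_B scaleC_eq)
  have "x = proj V x"
  proof -
    have "cinner e (x - proj V x) = 0" if "e \<in> B" for e
      using proj_orth[OF V BV[OF that], of x] proj_orth[OF V closed_csub_arith(5)[OF V BV[OF that]], of x]
      by (simp add: cinner_eq complex_eq_iff inner_iC_left)
    hence "x - proj V x = 0" using onb unfolding is_onb_def by blast
    thus ?thesis by simp
  qed
  hence "x \<in> V" using proj_in[OF V, of x] by simp
  thus "0 < \<epsilon> \<Longrightarrow> \<exists>F. finite F \<and> F \<subseteq> B \<and> norm (x - part F x) < \<epsilon>" unfolding V_def by blast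
qed

lemma part_tendsto: "((\<lambda>F. part F x) \<longlongrightarrow> x) (finite_subsets_at_top B)"
proof (rule tendstoI)
  fix \<epsilon> :: real assume "0 < \<epsilon>"
  then obtain F where F: "finite F" "F \<subseteq> B" "norm (x - part F x) < \<epsilon>" using part_approx by blast
  have "dist (part G x) x < \<epsilon>" if "finite G" "F \<subseteq> G" "G \<subseteq> B" for G
    using norm_part_mono[OF that, of x] F(3) by (simp add: dist_norm norm_minus_commute)
  thus "\<forall>\<^sub>F G in finite_subsets_at_top B. dist (part G x) x < \<epsilon>"
    unfolding eventually_finite_subsets_at_top using F by blast
qed

text \<open>The operator inside makes the rows and the columns of the double series in the trace
  computation direct instances.\<close>

lemma has_sum_parseval:
  assumes W: "bounded_op W"
  shows "((\<lambda>e. cinner y (W e) * cinner e x) has_sum cinner y (W x)) B"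
proof -
  have "((\<lambda>F. cinner y (W (part F x))) \<longlongrightarrow> cinner y (W x)) (finite_subsets_at_top B)"
    by (intro bounded_linear.tendsto[OF bounded_linear_cinner] bounded_op_tendsto[OF W] part_tendsto)
  moreover have "cinner y (W (part F x)) = (\<Sum>e\<in>F. cinner y (W e) * cinner e x)" for F
    using W by (simp add: part_def bounded_op_sum[OF W] bounded_op_def cinner_sum_right
        cinner_scaleC_right mult.commute)
  ultimately show ?thesis by (simp add: has_sum_def)
qed

lemma has_sum_norm_sq: "((\<lambda>e. (cmod (cinner e x))\<^sup>2) has_sum (norm x)\<^sup>2) B"
proof -
  have "((\<lambda>e. Re (cinner x e * cinner e x)) has_sum Re (cinner x x)) B"
    using has_sum_parseval[OF bounded_op_id, of x x] by (rule has_sum_Re)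
  moreover have "Re (cinner x e * cinner e x) = (cmod (cinner e x))\<^sup>2" for e
  proof -
    have "cinner x e * cinner e x = complex_of_real ((cmod (cinner e x))\<^sup>2)"
      by (subst cinner_commute[of x e]) (simp add: mult.commute complex_norm_square[symmetric])
    thus ?thesis by simp
  qed
  ultimately show ?thesis by (simp add: cinner_self)
qed

end

text \<open>With \<open>D = S S\<close>, cyclicity of the trace on the Hilbert--Schmidt operators \<open>S\<close> and \<open>X S\<close>.\<close>

lemma positive_normal_has_sum:
  fixes \<rho> :: "('a::complex_hilbert_space \<Rightarrow> 'a) \<Rightarrow> complex"
  assumes "positive_normal \<rho>"
  shows "\<exists>I \<xi>. \<forall>X. bounded_op X \<longrightarrow> ((\<lambda>e::'a. inner (\<xi> e) (X (\<xi> e))) has_sum Re (\<rho> X)) I"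
proof -
  interpret onb "the_onb :: 'a set" by standard (rule is_onb_the_onb)
  let ?B = "the_onb :: 'a set"
  obtain D where D: "positive_op D" "(\<lambda>e. cinner e (D e)) summable_on ?B"
    and \<rho>: "\<And>X. bounded_op X \<Longrightarrow> \<rho> X = trace_op (X \<circ> D)"
    using assms by (auto simp: positive_normal_def positive_trace_class_def)
  define S where "S = sqrt_op D"
  have S: "positive_op S" and SS: "S (S x) = D x" and nS: "(norm (S x))\<^sup>2 = inner x (D x)" for x
    unfolding S_def by (rule positive_sqrt_op[OF D(1)] sqrt_op_sqrt_op[OF D(1)] norm_sqrt_op[OF D(1)])+
  note sS = positive_selfadj[OF S]
  have sumS: "(\<lambda>e. (norm (S e))\<^sup>2) summable_on ?B"
    using summable_on_Re[OF D(2)] by (simp add: nS inner_eq_Re_cinner)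
  have "((\<lambda>e. inner (S e) (X (S e))) has_sum Re (\<rho> X)) ?B" if X: "bounded_op X" for X
  proof -
    obtain K where K: "0 < K" "\<And>x. norm (X x) \<le> K * norm x" using bounded_op_bound[OF X] by auto
    \<comment> \<open>Summing \<open>f\<close> over \<open>g\<close> gives the diagonal entries of
      \<open>X D\<close>, summing over \<open>e\<close> gives the vector functionals at
      \<open>S g\<close>; the trace is one iterated sum and the claim is the other.\<close>
    define f where "f e g = cinner e (X (S g)) * cinner g (S e)" for e g
    have XS: "bounded_op (\<lambda>x. X (S x))" by (rule bounded_op_comp[OF X positive_op_op[OF S]])
    have row: "((\<lambda>g. f e g) has_sum cinner e (X (D e))) ?B" for e
      using has_sum_parseval[OF XS, of e "S e"] by (simp add: f_def SS)
    have col: "((\<lambda>e. f e g) has_sum cinner (S g) (X (S g))) ?B" for g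
      using has_sum_parseval[OF bounded_op_id, of "S g" "X (S g)"]
      by (simp add: f_def mult.commute selfadj_cinner[OF sS])
    \<comment> \<open>Both factors of \<open>f\<close> are square summable over pairs. The product
      is bounded by the sum of the squares, so the order of summation may be changed.\<close>
    have h1: "(\<lambda>(g, e). (cmod (cinner e (X (S g))))\<^sup>2) summable_on ?B \<times> ?B"
    proof (rule summable_on_SigmaI)
      show "((\<lambda>e. case (g, e) of (g, e) \<Rightarrow> (cmod (cinner e (X (S g))))\<^sup>2) has_sum (norm (X (S g)))\<^sup>2) ?B" for g
        by (simp add: has_sum_norm_sq)
      have "(\<lambda>g. K\<^sup>2 * (norm (S g))\<^sup>2) summable_on ?B" by (intro summable_on_cmult_right sumS)
      thus "(\<lambda>g. (norm (X (S g)))\<^sup>2) summable_on ?B"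
      proof (rule summable_on_comparison_test)
        show "(norm (X (S g)))\<^sup>2 \<le> K\<^sup>2 * (norm (S g))\<^sup>2" for g
          using power_mono[OF K(2)[of "S g"], of 2] by (simp add: power_mult_distrib)
      qed auto
    qed auto
    have h1': "(\<lambda>(e, g). (cmod (cinner e (X (S g))))\<^sup>2) summable_on ?B \<times> ?B"
      using h1 by (subst summable_on_swap) (simp add: case_prod_unfold)
    have h2: "(\<lambda>(e, g). (cmod (cinner g (S e)))\<^sup>2) summable_on ?B \<times> ?B"
    proof (rule summable_on_SigmaI)
      show "((\<lambda>g. case (e, g) of (e, g) \<Rightarrow> (cmod (cinner g (S e)))\<^sup>2) has_sum (norm (S e))\<^sup>2) ?B" for e
        by (simp add: has_sum_norm_sq)
    qed (use sumS in auto)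
    have "(\<lambda>p. (case p of (e, g) \<Rightarrow> (cmod (cinner e (X (S g))))\<^sup>2) + (case p of (e, g) \<Rightarrow> (cmod (cinner g (S e)))\<^sup>2)) summable_on ?B \<times> ?B"
      by (rule summable_on_add[OF h1' h2])
    hence "(\<lambda>p. norm (case p of (e, g) \<Rightarrow> f e g)) summable_on ?B \<times> ?B"
    proof (rule summable_on_comparison_test)
      fix p :: "'a \<times> 'a"
      obtain e g where p: "p = (e, g)" by force
      have "2 * (cmod (cinner e (X (S g))) * cmod (cinner g (S e)))
          \<le> (cmod (cinner e (X (S g))))\<^sup>2 + (cmod (cinner g (S e)))\<^sup>2"
        using sum_squares_bound[of "cmod (cinner e (X (S g)))" "cmod (cinner g (S e))"] by simp
      moreover have "0 \<le> cmod (cinner e (X (S g))) * cmod (cinner g (S e))" by simp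
      ultimately show "norm (case p of (e, g) \<Rightarrow> f e g) \<le> (case p of (e, g) \<Rightarrow> (cmod (cinner e (X (S g))))\<^sup>2)
          + (case p of (e, g) \<Rightarrow> (cmod (cinner g (S e)))\<^sup>2)"
        unfolding p f_def prod.case norm_mult by linarith
    qed auto
    hence summ: "(\<lambda>(e, g). f e g) summable_on ?B \<times> ?B"
      by (rule abs_summable_summable)
    have "\<rho> X = infsum (\<lambda>e. infsum (\<lambda>g. f e g) ?B) ?B"
      using infsumI[OF row] by (simp add: \<rho>[OF X] trace_op_def)
    also have "\<dots> = infsum (\<lambda>g. infsum (\<lambda>e. f e g) ?B) ?B"
      by (rule infsum_swap_banach[OF summ])
    also have "\<dots> = infsum (\<lambda>g. cinner (S g) (X (S g))) ?B"
      using infsumI[OF col] by simp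
    finally have eq: "\<rho> X = infsum (\<lambda>g. cinner (S g) (X (S g))) ?B" .
    have "(\<lambda>g. K * (norm (S g))\<^sup>2) summable_on ?B" by (intro summable_on_cmult_right sumS)
    hence "(\<lambda>g. norm (cinner (S g) (X (S g)))) summable_on ?B"
    proof (rule summable_on_comparison_test)
      show "norm (cinner (S g) (X (S g))) \<le> K * (norm (S g))\<^sup>2" for g
        using cmod_cinner_le[of "S g" "X (S g)"] mult_left_mono[OF K(2)[of "S g"], of "norm (S g)"]
        by (simp add: power2_eq_square mult.left_commute)
    qed auto
    hence "(\<lambda>g. cinner (S g) (X (S g))) summable_on ?B" by (rule abs_summable_summable)
    hence "((\<lambda>g. cinner (S g) (X (S g))) has_sum \<rho> X) ?B" unfolding eq by (rule has_sum_infsum)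
    from has_sum_Re[OF this] show ?thesis by (simp add: inner_eq_Re_cinner)
  qed
  thus ?thesis by (intro exI[of _ ?B] exI[of _ S]) blast
qed

lemma nn_integral_count_space_has_sum:
  fixes h :: "'b \<Rightarrow> real"
  assumes "(h has_sum c) I" "\<And>i. 0 \<le> h i"
  shows "(\<integral>\<^sup>+i. ennreal (h i) \<partial>count_space I) = ennreal c"
proof -
  have "h summable_on I" using assms(1) by (rule has_sum_imp_summable)
  hence "(\<lambda>i. norm (h i)) summable_on I" using assms(2) by simp
  hence "Infinite_Set_Sum.abs_summable_on h I" using abs_summable_equivalent by blast
  thus ?thesis
    using assms nn_integral_conv_infsetsum[of h I] infsetsum_infsum[of h I] infsumI[OF assms(1)] by simp
qed

section \<open>The measure of a pair of operators and a functional\<close>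

lemma sum_measure:
  fixes \<nu> :: "'i \<Rightarrow> real measure" and I :: "'i set"
  assumes \<nu>: "\<And>i. sets (\<nu> i) = sets borel"
  defines "L \<equiv> measure_of UNIV (sets borel) (\<lambda>N. \<integral>\<^sup>+i. emeasure (\<nu> i) N \<partial>count_space I)"
  shows sets_sum_measure: "sets L = sets borel" and space_sum_measure: "space L = UNIV"
    and emeasure_sum_measure: "N \<in> sets borel \<Longrightarrow> emeasure L N = (\<integral>\<^sup>+i. emeasure (\<nu> i) N \<partial>count_space I)"
proof -
  show "sets L = sets borel" "space L = UNIV"
    unfolding L_def by (simp_all add: sets.sigma_sets_eq[of "borel :: real measure", simplified])
  show "emeasure L N = (\<integral>\<^sup>+i. emeasure (\<nu> i) N \<partial>count_space I)" if N: "N \<in> sets borel"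
    unfolding L_def
  proof (rule emeasure_measure_of_sigma[OF _ _ _ N])
    show "sigma_algebra UNIV (sets (borel :: real measure))"
      using sets.sigma_algebra_axioms[of "borel :: real measure"] by simp
    show "positive (sets borel) (\<lambda>N. \<integral>\<^sup>+i. emeasure (\<nu> i) N \<partial>count_space I)"
      by (simp add: positive_def)
    show "countably_additive (sets borel) (\<lambda>N. \<integral>\<^sup>+i. emeasure (\<nu> i) N \<partial>count_space I)"
      unfolding countably_additive_def
    proof (intro allI impI)
      fix A :: "nat \<Rightarrow> real set"
      assume A: "range A \<subseteq> sets borel" "disjoint_family A"
      have "(\<Sum>j. \<integral>\<^sup>+i. emeasure (\<nu> i) (A j) \<partial>count_space I) = (\<integral>\<^sup>+i. (\<Sum>j. emeasure (\<nu> i) (A j)) \<partial>count_space I)"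
        by (rule nn_integral_suminf[symmetric]) simp
      also have "\<dots> = (\<integral>\<^sup>+i. emeasure (\<nu> i) (\<Union>j. A j) \<partial>count_space I)"
        using A \<nu> by (simp add: suminf_emeasure)
      finally show "(\<Sum>j. \<integral>\<^sup>+i. emeasure (\<nu> i) (A j) \<partial>count_space I) = (\<integral>\<^sup>+i. emeasure (\<nu> i) (\<Union> (range A)) \<partial>count_space I)" .
    qed
  qed
qed

lemma positive_normal_nonneg:
  fixes X :: "'a::complex_hilbert_space \<Rightarrow> 'a"
  assumes \<rho>: "positive_normal \<rho>" and X: "positive_op X"
  shows "0 \<le> Re (\<rho> X)"
proof -
  from positive_normal_has_sum[OF \<rho>] obtain I and \<xi> :: "'a \<Rightarrow> 'a"
    where "\<forall>X. bounded_op X \<longrightarrow> ((\<lambda>e. inner (\<xi> e) (X (\<xi> e))) has_sum Re (\<rho> X)) I"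
    by (elim exE)
  hence "((\<lambda>e. inner (\<xi> e) (X (\<xi> e))) has_sum Re (\<rho> X)) I"
    using positive_op_op[OF X] by simp
  thus ?thesis by (rule has_sum_nonneg) (simp add: positive_inner[OF X])
qed

definition pair_measure_of ::
  "('a::complex_hilbert_space \<Rightarrow> 'a) \<Rightarrow> ('a \<Rightarrow> 'a) \<Rightarrow> (('a \<Rightarrow> 'a) \<Rightarrow> complex) \<Rightarrow> real measure" where
  "pair_measure_of A B \<rho> = restrict_space
     (functional_measure \<rho> (T_op A B) (spectral_measure (H_sp A B) (R_op A B))) {0..1}"

text \<open>\<open>\<rho>\<close> is a sum of vector functionals, so the measure is the sum of the
  measures \<open>m (T (\<xi> e))\<close> and each claim reduces to a single vector. This also shows
  that the set function inside \<open>functional_measure\<close> is countably additive; otherwise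
  \<open>measure_of\<close> would return the zero measure.\<close>

lemma pair_measure_of:
  fixes A B :: "'a::complex_hilbert_space \<Rightarrow> 'a"
  assumes A: "positive_op A" and B: "positive_op B" and \<rho>: "positive_normal \<rho>"
  shows sets_pair_measure_of: "sets (pair_measure_of A B \<rho>) = sets (restrict_space borel {0..1})"
    and nn_integral_pair_A: "(\<integral>\<^sup>+r. ennreal r \<partial>pair_measure_of A B \<rho>) = ennreal (Re (\<rho> A))"
    and nn_integral_pair_B: "(\<integral>\<^sup>+r. ennreal (1 - r) \<partial>pair_measure_of A B \<rho>) = ennreal (Re (\<rho> B))"
    and nn_integral_pair_parallel: "0 < l \<Longrightarrow>
      (\<integral>\<^sup>+r. ennreal (l * r * (1 - r) / (r + l * (1 - r))) \<partial>pair_measure_of A B \<rho>)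
        = ennreal (Re (\<rho> (parallel_sum A (\<lambda>x. l *\<^sub>R B x))))"
proof -
  define T where "T = T_op A B"
  define R where "R = R_op A B"
  define E where "E = spectral_measure (H_sp A B) R"
  note RM = op_on_R_op[OF A B, folded R_def] and R = positive_R_op[OF A B, folded R_def]
    and R1 = R_op_le[OF A B, folded R_def] and M = closed_csub_H_sp[OF A B]
  have "is_spectral_measure (H_sp A B) R E"
    unfolding E_def spectral_measure_def by (rule someI_ex[OF spectral_measure_exists[OF M RM R R1]])
  then interpret spectral_meas "H_sp A B" R E
    using M RM R R1 by unfold_locales
  note sT = selfadj_T_op[OF A B, folded T_def] and Tin = T_op_in_H_sp[OF A B, folded T_def]
  note Top = selfadj_op[OF sT]
  from positive_normal_has_sum[OF \<rho>] obtain I and \<xi> :: "'a \<Rightarrow> 'a"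
    where "\<forall>X. bounded_op X \<longrightarrow> ((\<lambda>e. inner (\<xi> e) (X (\<xi> e))) has_sum Re (\<rho> X)) I"
    by (elim exE)
  hence \<xi>: "((\<lambda>e. inner (\<xi> e) (X (\<xi> e))) has_sum Re (\<rho> X)) I" if "bounded_op X" for X
    using that by simp
  define L where "L = measure_of UNIV (sets borel) (\<lambda>N. \<integral>\<^sup>+e. emeasure (m (T (\<xi> e))) N \<partial>count_space I)"
  note L = sum_measure[where \<nu>="\<lambda>e. m (T (\<xi> e))" and I=I, folded L_def, simplified]
  have fm: "functional_measure \<rho> T E = L"
    unfolding functional_measure_def
  proof (rule measure_of_emeasure[OF L(1,2)])
    fix N :: "real set" assume N: "N \<in> sets borel"
    have op: "bounded_op (adj T \<circ> E N \<circ> T)"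
      unfolding adj_selfadj[OF sT] by (intro bounded_op_compose Top is_proj_op[OF Eproj[OF N]])
    have eq: "inner x ((adj T \<circ> E N \<circ> T) x) = (norm (E N (T x)))\<^sup>2" for x
      by (simp add: adj_selfadj[OF sT] selfadj_inner[OF sT, symmetric] is_proj_inner[OF Eproj[OF N]])
    have "((\<lambda>e. (norm (E N (T (\<xi> e))))\<^sup>2) has_sum Re (\<rho> (adj T \<circ> E N \<circ> T))) I"
      using \<xi>[OF op] unfolding eq .
    from nn_integral_count_space_has_sum[OF this]
    show "emeasure L N = ennreal (Re (\<rho> (adj T \<circ> E N \<circ> T)))"
      using N by (simp add: L(3) emeasure_m)
  qed
  have pm: "pair_measure_of A B \<rho> = restrict_space L {0..1}"
    unfolding pair_measure_of_def fm[symmetric] by (simp add: T_def E_def R_def)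
  show "sets (pair_measure_of A B \<rho>) = sets (restrict_space borel {0..1})"
    unfolding pm by (rule sets_restrict_space_cong[OF L(1)])
  \<comment> \<open>The restriction to [0,1] loses no mass, because every \<open>m w\<close> is
    carried by this interval.\<close>
  have nn: "(\<integral>\<^sup>+r. g r \<partial>pair_measure_of A B \<rho>) = (\<integral>\<^sup>+e. (\<integral>\<^sup>+r. g r \<partial>m (T (\<xi> e))) \<partial>count_space I)"
    if g: "g \<in> borel_measurable borel" for g
  proof -
    have "(\<integral>\<^sup>+r. g r \<partial>pair_measure_of A B \<rho>) = (\<integral>\<^sup>+r. g r * indicator {0..1} r \<partial>L)"
      unfolding pm using L by (subst nn_integral_restrict_space) auto
    also have "\<dots> = (\<integral>\<^sup>+e. (\<integral>\<^sup>+r. g r * indicator {0..1} r \<partial>m (T (\<xi> e))) \<partial>count_space I)"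
    proof (rule nn_integral_measure_family)
      show "(\<lambda>r. g r * indicator {0..1} r) \<in> borel_measurable L"
        using g by (simp add: measurable_cong_sets[OF L(1) refl])
    qed (use L in auto)
    also have "\<dots> = (\<integral>\<^sup>+e. (\<integral>\<^sup>+r. g r \<partial>m (T (\<xi> e))) \<partial>count_space I)"
    proof (rule nn_integral_cong, rule nn_integral_cong_AE)
      show "AE r in m (T (\<xi> e)). g r * indicator {0..1} r = g r" for e
        using AE_m by eventually_elim simp
    qed
    finally show ?thesis .
  qed
  have vals: "inner x (A x) = inner (T x) (R (T x))" "inner x (B x) = (norm (T x))\<^sup>2 - inner (T x) (R (T x))" for x
  proof -
    have "inner x (A x) = inner x (T (R (T x)))"
      using A_eq_T_R_T[OF A B, of x] by (simp add: T_def R_def)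
    thus 1: "inner x (A x) = inner (T x) (R (T x))" by (simp add: selfadj_inner[OF sT])
    show "inner x (B x) = (norm (T x))\<^sup>2 - inner (T x) (R (T x))"
      using norm_T_op[OF A B, of x] 1 by (simp add: T_def)
  qed
  have "(\<integral>\<^sup>+r. ennreal r \<partial>pair_measure_of A B \<rho>) = (\<integral>\<^sup>+e. ennreal (inner (\<xi> e) (A (\<xi> e))) \<partial>count_space I)"
    by (subst nn) (simp_all add: nn_integral_m[OF Tin] vals)
  also have "\<dots> = ennreal (Re (\<rho> A))"
    by (rule nn_integral_count_space_has_sum[OF \<xi>[OF positive_op_op[OF A]]]) (simp add: positive_inner[OF A])
  finally show "(\<integral>\<^sup>+r. ennreal r \<partial>pair_measure_of A B \<rho>) = ennreal (Re (\<rho> A))" .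
  have one: "(\<integral>\<^sup>+r. ennreal (1 - r) \<partial>m w) = ennreal ((norm w)\<^sup>2 - inner w (R w))" if w: "w \<in> H_sp A B" for w
  proof -
    interpret finite_measure "m w" by (rule finite_m)
    have "AE r in m w. 0 \<le> 1 - r" using AE_m by eventually_elim simp
    hence "(\<integral>\<^sup>+r. ennreal (1 - r) \<partial>m w) = ennreal (\<integral>r. 1 - r \<partial>m w)"
      using integral_m[OF w] by (intro nn_integral_eq_integral) auto
    thus ?thesis using integral_m[OF w] by (simp add: measure_m_UNIV[OF w])
  qed
  have "(\<integral>\<^sup>+r. ennreal (1 - r) \<partial>pair_measure_of A B \<rho>) = (\<integral>\<^sup>+e. ennreal (inner (\<xi> e) (B (\<xi> e))) \<partial>count_space I)"
    by (subst nn) (simp_all add: one[OF Tin] vals)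
  also have "\<dots> = ennreal (Re (\<rho> B))"
    by (rule nn_integral_count_space_has_sum[OF \<xi>[OF positive_op_op[OF B]]]) (simp add: positive_inner[OF B])
  finally show "(\<integral>\<^sup>+r. ennreal (1 - r) \<partial>pair_measure_of A B \<rho>) = ennreal (Re (\<rho> B))" .
  show "(\<integral>\<^sup>+r. ennreal (l * r * (1 - r) / (r + l * (1 - r))) \<partial>pair_measure_of A B \<rho>)
        = ennreal (Re (\<rho> (parallel_sum A (\<lambda>x. l *\<^sub>R B x))))" if l: "0 < l"
  proof -
    define Z where "Z = parallel_sum A (\<lambda>x. l *\<^sub>R B x)"
    have Z: "positive_op Z" unfolding Z_def by (rule positive_parallel_sum[OF A B l])
    have "(\<integral>\<^sup>+r. ennreal (l * r * (1 - r) / (r + l * (1 - r))) \<partial>m (T x)) = ennreal (inner x (Z x))" for x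
    proof -
      obtain u where u: "u \<in> H_sp A B" "R u + l *\<^sub>R (u - R u) = T x"
        "inner x (Z x) = l * inner (T x) (R (u - R u))"
        using parallel_sum_form[OF A B l, of x] by (auto simp: T_def R_def Z_def)
      show ?thesis using nn_integral_harmonic[OF u(1) l] by (simp only: u(2,3))
    qed
    hence "(\<integral>\<^sup>+r. ennreal (l * r * (1 - r) / (r + l * (1 - r))) \<partial>pair_measure_of A B \<rho>)
      = (\<integral>\<^sup>+e. ennreal (inner (\<xi> e) (Z (\<xi> e))) \<partial>count_space I)"
      by (subst nn) simp_all
    also have "\<dots> = ennreal (Re (\<rho> Z))"
      by (rule nn_integral_count_space_has_sum[OF \<xi>[OF positive_op_op[OF Z]]]) (simp add: positive_inner[OF Z])
    finally show ?thesis by (simp add: Z_def)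
  qed
qed

lemma positive_normal_parallel_swap:
  fixes A B :: "'a::complex_hilbert_space \<Rightarrow> 'a"
  assumes A: "positive_op A" and B: "positive_op B" and \<rho>: "positive_normal \<rho>" and l: "0 < l"
  shows "Re (\<rho> (parallel_sum B (\<lambda>x. l *\<^sub>R A x))) = l * Re (\<rho> (parallel_sum A (\<lambda>x. (1 / l) *\<^sub>R B x)))"
proof -
  have l': "0 < 1 / l" using l by simp
  from positive_normal_has_sum[OF \<rho>] obtain I and \<xi> :: "'a \<Rightarrow> 'a"
    where "\<forall>X. bounded_op X \<longrightarrow> ((\<lambda>e. inner (\<xi> e) (X (\<xi> e))) has_sum Re (\<rho> X)) I"
    by (elim exE)
  hence \<xi>: "((\<lambda>e. inner (\<xi> e) (X (\<xi> e))) has_sum Re (\<rho> X)) I" if "bounded_op X" for X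
    using that by simp
  note op = positive_op_op[OF positive_parallel_sum[OF B A l]] positive_op_op[OF positive_parallel_sum[OF A B l']]
  show ?thesis
    using has_sum_unique[OF \<xi>[OF op(1)]] has_sum_cmult_right[OF \<xi>[OF op(2)], of l]
    by (simp only: parallel_sum_swap[OF A B l])
qed

section \<open>The scalar perspective\<close>

lemma ennreal_add_eqD:
  assumes "x + ennreal b = ennreal a" "0 \<le> a" "0 \<le> b"
  shows "x = ennreal (a - b)" "b \<le> a"
proof -
  have "ennreal b \<le> ennreal a" using assms(1) by (metis le_iff_add add.commute)
  thus "b \<le> a" using assms by simp
  have "x = x + ennreal b - ennreal b" by simp
  thus "x = ennreal (a - b)" using assms by (simp add: ennreal_minus)
qed

text \<open>Fatou gives the lower bound and domination by the limit itself the upper one. The limit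
  may have an infinite integral, which dominated convergence would exclude.\<close>

lemma nn_integral_tendsto_of_le:
  assumes u: "\<And>n. u n \<in> borel_measurable M" and le: "\<And>n x. x \<in> space M \<Longrightarrow> u n x \<le> v x"
    and lim: "\<And>x. x \<in> space M \<Longrightarrow> (\<lambda>n. u n x) \<longlonglongrightarrow> v x"
  shows "(\<lambda>n. \<integral>\<^sup>+x. u n x \<partial>M) \<longlonglongrightarrow> (\<integral>\<^sup>+x. v x \<partial>M)"
proof -
  have "(\<integral>\<^sup>+x. v x \<partial>M) = (\<integral>\<^sup>+x. liminf (\<lambda>n. u n x) \<partial>M)"
    by (rule nn_integral_cong) (rule lim_imp_Liminf[OF trivial_limit_sequentially lim, symmetric])
  also have "\<dots> \<le> liminf (\<lambda>n. \<integral>\<^sup>+x. u n x \<partial>M)" by (rule nn_integral_liminf[OF u])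
  finally have 1: "(\<integral>\<^sup>+x. v x \<partial>M) \<le> liminf (\<lambda>n. \<integral>\<^sup>+x. u n x \<partial>M)" .
  have 2: "limsup (\<lambda>n. \<integral>\<^sup>+x. u n x \<partial>M) \<le> (\<integral>\<^sup>+x. v x \<partial>M)"
    by (rule Limsup_bounded) (intro always_eventually allI nn_integral_mono le)
  have 3: "liminf (\<lambda>n. \<integral>\<^sup>+x. u n x \<partial>M) \<le> limsup (\<lambda>n. \<integral>\<^sup>+x. u n x \<partial>M)"
    by (rule Liminf_le_Limsup) simp
  show ?thesis
    by (rule Liminf_eq_Limsup) (use 1 2 3 in auto)
qed

text \<open>\<open>H r\<close> may be infinite, so the positive and negative parts \<open>p\<close>
  and \<open>q\<close> are compared by an identity free of subtraction,
  \<open>p + k^- = H + k^+ + q\<close>. Integrating it gives the claim, the integral of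
  \<open>q\<close> being finite by \<open>q \<le> k^-\<close>.\<close>

lemma ereal_integral_add_nonneg:
  fixes k :: "'b \<Rightarrow> real"
  assumes k: "integrable N k" and H: "H \<in> borel_measurable N"
  shows "ereal_integral N (\<lambda>r. ereal (k r) + enn2ereal (H r)) = ereal (\<integral>r. k r \<partial>N) + enn2ereal (\<integral>\<^sup>+r. H r \<partial>N)"
proof -
  define p where "p r = e2ennreal (ereal (k r) + enn2ereal (H r))" for r
  define q where "q r = e2ennreal (- (ereal (k r) + enn2ereal (H r)))" for r
  have km: "k \<in> borel_measurable N" using k by auto
  have pm: "p \<in> borel_measurable N" "q \<in> borel_measurable N"
    unfolding p_def[abs_def] q_def[abs_def] using km H by measurable
  have pt: "p r + ennreal (- k r) = H r + ennreal (k r) + q r" and qle: "q r \<le> ennreal (- k r)" for r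
  proof -
    have "p r + ennreal (- k r) = H r + ennreal (k r) + q r \<and> q r \<le> ennreal (- k r)"
    proof (cases "H r")
      case (real h)
      have "ereal (k r) + enn2ereal (H r) = ereal (k r + h)"
        using real by (simp add: enn2ereal_ennreal)
      hence "p r = ennreal (k r + h)" "q r = ennreal (- (k r + h))"
        by (simp_all add: p_def q_def ennreal.rep_eq e2ennreal_ereal del: uminus_ereal.simps) (simp_all add: e2ennreal_ereal)
      thus ?thesis using real
        by (cases "0 \<le> k r"; cases "0 \<le> k r + h")
           (auto simp: ennreal_neg ennreal_plus[symmetric] simp del: ennreal_plus intro!: ennreal_leI)
    next
      case top
      thus ?thesis by (simp add: p_def q_def e2ennreal_neg)
    qed
    thus "p r + ennreal (- k r) = H r + ennreal (k r) + q r" "q r \<le> ennreal (- k r)" by auto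
  qed
  define x where "x = (\<integral>\<^sup>+r. ennreal (k r) \<partial>N)"
  define y where "y = (\<integral>\<^sup>+r. ennreal (- k r) \<partial>N)"
  have xy: "x \<noteq> \<infinity>" "y \<noteq> \<infinity>" using k unfolding real_integrable_def x_def y_def by auto
  have ik: "(\<integral>r. k r \<partial>N) = enn2real x - enn2real y"
    unfolding x_def y_def by (rule real_lebesgue_integral_def[OF k])
  have "(\<integral>\<^sup>+r. q r \<partial>N) \<le> y" unfolding y_def by (intro nn_integral_mono qle)
  hence z: "(\<integral>\<^sup>+r. q r \<partial>N) \<noteq> \<infinity>" using xy by (auto simp: top_unique)
  have "(\<integral>\<^sup>+r. p r + ennreal (- k r) \<partial>N) = (\<integral>\<^sup>+r. H r + ennreal (k r) + q r \<partial>N)"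
    by (simp only: pt)
  hence eq: "(\<integral>\<^sup>+r. p r \<partial>N) + y = (\<integral>\<^sup>+r. H r \<partial>N) + x + (\<integral>\<^sup>+r. q r \<partial>N)"
    using pm km H by (simp add: nn_integral_add x_def y_def)
  define P where "P = (\<integral>\<^sup>+r. p r \<partial>N)"
  define Q where "Q = (\<integral>\<^sup>+r. q r \<partial>N)"
  define h where "h = (\<integral>\<^sup>+r. H r \<partial>N)"
  have "enn2ereal P - enn2ereal Q = ereal (enn2real x - enn2real y) + enn2ereal h"
  proof -
    obtain x' where x': "x = ennreal x'" "0 \<le> x'" using xy(1) by (cases x) auto
    obtain y' where y': "y = ennreal y'" "0 \<le> y'" using xy(2) by (cases y) auto
    obtain z' where z': "Q = ennreal z'" "0 \<le> z'" using z by (cases Q) (auto simp: Q_def)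
    have eq': "P + ennreal y' = h + ennreal x' + ennreal z'"
      using eq by (simp add: P_def Q_def[symmetric] h_def x' y' z')
    show ?thesis
    proof (cases h)
      case top
      hence "P = \<infinity>" using eq' by (cases P) (auto simp: ennreal_plus[symmetric] simp del: ennreal_plus)
      thus ?thesis using top z' by (simp add: enn2ereal_ennreal)
    next
      case (real h')
      then obtain p' where p': "P = ennreal p'" "0 \<le> p'" using eq' x' y' z'
        by (cases P) (auto simp: ennreal_plus[symmetric] simp del: ennreal_plus)
      have "p' + y' = h' + x' + z'"
        using eq' real p' x' y' z' by (simp add: ennreal_plus[symmetric] del: ennreal_plus)
      thus ?thesis using real p' x' y' z' by (simp add: enn2ereal_ennreal)
    qed
  qed
  thus ?thesis by (simp add: ereal_integral_def ik P_def Q_def h_def p_def q_def)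
qed

lemma ereal_integral_nonneg:
  "ereal_integral N (\<lambda>r. enn2ereal (H r)) = enn2ereal (\<integral>\<^sup>+r. H r \<partial>N)"
proof -
  have "e2ennreal (- enn2ereal x) = 0" for x by (simp add: e2ennreal_neg)
  thus ?thesis by (simp add: ereal_integral_def zero_ennreal.rep_eq)
qed

lemma ereal_integral_cong:
  "(\<And>x. x \<in> space N \<Longrightarrow> g x = h x) \<Longrightarrow> ereal_integral N g = ereal_integral N h"
  unfolding ereal_integral_def by (intro arg_cong2[where f=minus] arg_cong[where f=enn2ereal] nn_integral_cong) auto

text \<open>At \<open>r = 1\<close> the quotient would be 0 by the convention for division; the
  value set there is the slope of \<open>t^2\<close> at infinity.\<close>

definition persp_sq :: "real \<Rightarrow> ennreal" where
  "persp_sq r = (if r = 1 then \<infinity> else ennreal (r\<^sup>2 / (1 - r)))"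

lemma persp_sq_measurable [measurable]: "persp_sq \<in> borel_measurable borel"
  unfolding persp_sq_def[abs_def] by measurable

lemma persp_square:
  assumes "r \<in> {0..1}"
  shows "persp (\<lambda>t. t\<^sup>2) r (1 - r) = enn2ereal (persp_sq r)"
proof -
  have "((\<lambda>t. ereal (t\<^sup>2 / t)) \<longlongrightarrow> \<infinity>) at_top"
  proof -
    have "((\<lambda>t::real. ereal t) \<longlongrightarrow> \<infinity>) at_top"
      by (simp add: tendsto_PInfty eventually_gt_at_top)
    moreover have "\<forall>\<^sub>F t::real in at_top. ereal t = ereal (t\<^sup>2 / t)"
      using eventually_gt_at_top[of 0] by eventually_elim (simp add: power2_eq_square)
    ultimately show ?thesis by (rule Lim_transform_eventually)
  qed
  hence 1: "slope_at_infinity (\<lambda>t. t\<^sup>2) = \<infinity>"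
    unfolding slope_at_infinity_def by (intro tendsto_Lim) auto
  have "((\<lambda>t::real. ereal (t\<^sup>2)) \<longlongrightarrow> ereal (0\<^sup>2)) (at_right 0)"
    by (intro tendsto_intros)
  hence 2: "value_at_0 (\<lambda>t. t\<^sup>2) = 0"
    unfolding value_at_0_def by (intro tendsto_Lim) (auto simp: zero_ereal_def)
  show ?thesis
    using assms by (auto simp: persp_def persp_sq_def 1 2 enn2ereal_ennreal power_divide)
       (simp add: power2_eq_square)
qed

section \<open>The perspective of \<open>f\<close> on the unit interval\<close>

locale convex_representation =
  fixes f :: "real \<Rightarrow> real" and a b c d :: real and \<mu> :: "real measure"
  assumes c: "0 \<le> c" and d: "0 \<le> d"
    and sets_\<mu>: "sets \<mu> = sets (restrict_space borel {0<..})"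
    and int_\<mu>: "integrable \<mu> (\<lambda>l. 1 / (1 + l))"
    and f: "\<And>t. 0 < t \<Longrightarrow> f t = a + b * (t - 1) + c * (t - 1)^2 + d * ((t - 1)^2 / t)
           + (\<integral>l. (t - 1)^2 / (t + l) \<partial>\<mu>)"
begin

lemma space_\<mu>: "space \<mu> = {0<..}"
  using sets_eq_imp_space_eq[OF sets_\<mu>] by (simp add: space_restrict_space)

lemma id_\<mu> [measurable]: "(\<lambda>l. l) \<in> borel_measurable \<mu>"
  unfolding measurable_cong_sets[OF sets_\<mu> refl] by (intro measurable_restrict_space1) simp

text \<open>Markov's inequality on \<open>l < n\<close>, where \<open>1 + n\<close> dominates
  \<open>1 + l\<close>. Sigma-finiteness is what the later exchange of the two integrals relies
  on.\<close>

lemma sigma_finite_\<mu>: "sigma_finite_measure \<mu>"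
proof
  define A where "A n = {l \<in> space \<mu>. l < real n}" for n :: nat
  have A: "A n \<in> sets \<mu>" for n unfolding A_def by measurable
  have "emeasure \<mu> (A n) \<noteq> \<infinity>" for n
  proof -
    have "emeasure \<mu> (A n) = (\<integral>\<^sup>+l. indicator (A n) l \<partial>\<mu>)" using A by simp
    also have "\<dots> \<le> (\<integral>\<^sup>+l. ennreal ((1 + real n) * (1 / (1 + l))) \<partial>\<mu>)"
    proof (rule nn_integral_mono)
      fix l assume "l \<in> space \<mu>"
      hence "0 < l" by (simp add: space_\<mu>)
      thus "indicator (A n) l \<le> ennreal ((1 + real n) * (1 / (1 + l)))"
        by (auto simp: indicator_def A_def simp flip: ennreal_1 intro!: ennreal_leI)
    qed
    also have "\<dots> = ennreal (\<integral>l. (1 + real n) * (1 / (1 + l)) \<partial>\<mu>)"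
      by (rule nn_integral_eq_integral[OF integrable_mult_right[OF int_\<mu>]]) (auto simp: space_\<mu>)
    also have "\<dots> < \<infinity>" by simp
    finally show ?thesis by simp
  qed
  moreover have "(\<Union>n. A n) = space \<mu>"
    by (auto simp: A_def intro: reals_Archimedean2)
  ultimately show "\<exists>A. countable A \<and> A \<subseteq> sets \<mu> \<and> \<Union> A = space \<mu> \<and> (\<forall>a\<in>A. emeasure \<mu> a \<noteq> \<infinity>)"
    using A by (intro exI[of _ "range A"]) auto
qed

lemma integral_kernel:
  assumes t: "0 < t"
  shows "integrable \<mu> (\<lambda>l. (t - 1)^2 / (t + l))"
    and "(\<integral>\<^sup>+l. ennreal ((t - 1)^2 / (t + l)) \<partial>\<mu>) = ennreal (\<integral>l. (t - 1)^2 / (t + l) \<partial>\<mu>)"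
proof -
  show int: "integrable \<mu> (\<lambda>l. (t - 1)^2 / (t + l))"
  proof (rule Bochner_Integration.integrable_bound)
    show "integrable \<mu> (\<lambda>l. ((t - 1)^2 * (1 + 1 / t)) * (1 / (1 + l)))"
      by (rule integrable_mult_right[OF int_\<mu>])
    show "AE l in \<mu>. norm ((t - 1)\<^sup>2 / (t + l)) \<le> norm ((t - 1)\<^sup>2 * (1 + 1 / t) * (1 / (1 + l)))"
    proof (rule AE_I2)
      fix l assume "l \<in> space \<mu>"
      hence l: "0 < l" by (simp add: space_\<mu>)
      \<comment> \<open>The product expands to \<open>t + l + 1 + l / t\<close>.\<close>
      have "1 + l \<le> (1 + 1 / t) * (t + l)" using t l by (simp add: field_simps)
      hence "1 / (t + l) \<le> (1 + 1 / t) * (1 / (1 + l))"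
        using t l by (simp add: divide_le_eq le_divide_eq)
      hence "(t - 1)\<^sup>2 * (1 / (t + l)) \<le> (t - 1)\<^sup>2 * ((1 + 1 / t) * (1 / (1 + l)))"
        by (intro mult_left_mono) auto
      moreover have "0 \<le> (t - 1)\<^sup>2 / (t + l)" "0 \<le> (t - 1)\<^sup>2 * (1 + 1 / t) * (1 / (1 + l))"
        using t l by auto
      ultimately show "norm ((t - 1)\<^sup>2 / (t + l)) \<le> norm ((t - 1)\<^sup>2 * (1 + 1 / t) * (1 / (1 + l)))"
        by (simp only: real_norm_def abs_of_nonneg) (simp add: mult.assoc)
    qed
  qed measurable
  show "(\<integral>\<^sup>+l. ennreal ((t - 1)^2 / (t + l)) \<partial>\<mu>) = ennreal (\<integral>l. (t - 1)^2 / (t + l) \<partial>\<mu>)"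
    using t by (intro nn_integral_eq_integral[OF int] AE_I2) (simp add: space_\<mu>)
qed

text \<open>The part of the perspective that comes from \<open>\<mu>\<close>. Its end values, the
  integral of \<open>1 / l\<close> at 0 and the mass of \<open>\<mu>\<close> at 1, may be infinite,
  hence the extended range.\<close>

definition kernel_int :: "real \<Rightarrow> ennreal" where
  "kernel_int r = (\<integral>\<^sup>+l. ennreal ((2 * r - 1)\<^sup>2 / (r + l * (1 - r))) \<partial>\<mu>)"

lemma persp_interior:
  assumes r: "0 < r" "r < 1"
  shows "persp f r (1 - r) = ereal ((b - 2 * c + d) * r + (a - b + c - 2 * d) * (1 - r))
    + enn2ereal (ennreal c * persp_sq r + ennreal d * persp_sq (1 - r) + kernel_int r)"
proof -
  define t where "t = r / (1 - r)"
  have t: "0 < t" using r by (simp add: t_def)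
  define K where "K = (\<integral>l. (t - 1)^2 / (t + l) \<partial>\<mu>)"
  have K0: "0 \<le> K" unfolding K_def using t by (intro integral_nonneg_AE AE_I2) (simp add: space_\<mu>)
  have tm: "t - 1 = (2 * r - 1) / (1 - r)" using r by (simp add: t_def field_simps)
  have kern: "kernel_int r = ennreal ((1 - r) * K)"
  proof -
    have "(2 * r - 1)\<^sup>2 / (r + l * (1 - r)) = (1 - r) * ((t - 1)\<^sup>2 / (t + l))" if l: "0 < l" for l
    proof -
      have "t + l = (r + l * (1 - r)) / (1 - r)" using r by (simp add: t_def field_simps)
      moreover have "0 < r + l * (1 - r)" using r l by (simp add: add_pos_pos)
      ultimately show ?thesis using r by (simp add: tm power_divide power2_eq_square)
    qed
    hence "kernel_int r = (\<integral>\<^sup>+l. ennreal (1 - r) * ennreal ((t - 1)\<^sup>2 / (t + l)) \<partial>\<mu>)"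
      unfolding kernel_int_def using r t
      by (intro nn_integral_cong) (simp add: space_\<mu> ennreal_mult'[symmetric])
    also have "\<dots> = ennreal (1 - r) * ennreal K"
      by (subst nn_integral_cmult) (simp_all add: integral_kernel(2)[OF t] K_def)
    finally show ?thesis using r by (simp add: ennreal_mult')
  qed
  have sq: "persp_sq r = ennreal (r\<^sup>2 / (1 - r))" "persp_sq (1 - r) = ennreal ((1 - r)\<^sup>2 / r)"
    using r by (auto simp: persp_sq_def)
  have "persp f r (1 - r) = ereal ((1 - r) * f t)" using r by (simp add: persp_def t_def)
  also have "(1 - r) * f t = (b - 2 * c + d) * r + (a - b + c - 2 * d) * (1 - r)
      + (c * (r\<^sup>2 / (1 - r)) + d * ((1 - r)\<^sup>2 / r) + (1 - r) * K)"
  proof -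
    \<comment> \<open>Here \<open>a0\<close> and \<open>b0\<close> originate: with
      \<open>2 r - 1 = r - (1 - r)\<close>, dividing \<open>(2 r - 1)^2\<close> by
      \<open>1 - r\<close> or by \<open>r\<close> leaves the perspective of \<open>t^2\<close>,
      direct or exchanged, and the affine remainders \<open>-2 r + (1 - r)\<close> and
      \<open>r - 2 (1 - r)\<close>.\<close>
    have 1: "(1 - r) * (b * (t - 1)) = b * (2 * r - 1)" using r by (simp add: tm)
    have 2: "(1 - r) * (t - 1)\<^sup>2 = r\<^sup>2 / (1 - r) - 2 * r + (1 - r)"
      using r unfolding tm by (simp add: power_divide power2_eq_square) (simp add: field_simps)
    have 3: "(1 - r) * ((t - 1)\<^sup>2 / t) = (1 - r)\<^sup>2 / r - 2 * (1 - r) + r"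
      using r unfolding tm by (simp add: t_def power_divide power2_eq_square) (simp add: field_simps)
    have "(1 - r) * f t = (1 - r) * a + (1 - r) * (b * (t - 1)) + c * ((1 - r) * (t - 1)\<^sup>2)
        + d * ((1 - r) * ((t - 1)\<^sup>2 / t)) + (1 - r) * K"
      unfolding f[OF t] K_def by (simp add: algebra_simps)
    thus ?thesis unfolding 1 2 3 by (simp add: algebra_simps)
  qed
  finally show ?thesis
    using r c d K0 by (simp add: sq kern ennreal_mult'[symmetric] ennreal_plus[symmetric] enn2ereal_ennreal
        del: ennreal_plus)
qed

text \<open>For \<open>k = 0\<close> both sides vanish, by the convention that 0 times infinity is
  0.\<close>

lemma tendsto_ennreal_mult_top:
  assumes "filterlim g at_top F" "0 \<le> k"
  shows "((\<lambda>t. ennreal (k * g t)) \<longlongrightarrow> ennreal k * \<infinity>) F"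
proof (cases "k = 0")
  case False
  hence "filterlim (\<lambda>t. k * g t) at_top F"
    using assms by (intro filterlim_tendsto_pos_mult_at_top[OF tendsto_const]) auto
  hence "((\<lambda>t. ennreal (k * g t)) \<longlongrightarrow> \<infinity>) F" by (simp add: ennreal_tendsto_top_eq_at_top)
  thus ?thesis using False assms(2) by (simp add: ennreal_mult_top)
qed simp

text \<open>\<open>f t / t\<close> is split into \<open>\<alpha> t\<close>, with a finite limit, and
  nonnegative terms whose limit may be infinite. The quadratic term contributes \<open>c t\<close>
  to the latter and \<open>-2 c + c / t\<close> to the former.\<close>

lemma tendsto_slope:
  "((\<lambda>t. ereal (f t / t)) \<longlongrightarrow> ereal (b - 2 * c + d) + enn2ereal (ennreal c * \<infinity> + kernel_int 1)) at_top"
proof -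
  define \<alpha> where "\<alpha> t = a * inverse t + b * (1 - inverse t) + d * (1 - inverse t)\<^sup>2 - 2 * c + c * inverse t" for t
  define k where "k t l = (1 - inverse t)\<^sup>2 * inverse (1 + l * inverse t)" for t l :: real
  have "(\<alpha> \<longlongrightarrow> a * 0 + b * (1 - 0) + d * (1 - 0)\<^sup>2 - 2 * c + c * 0) at_top"
    unfolding \<alpha>_def[abs_def] by (intro tendsto_intros tendsto_inverse_0_at_top filterlim_ident)
  hence \<alpha>: "((\<lambda>t. ereal (\<alpha> t)) \<longlongrightarrow> ereal (b - 2 * c + d)) at_top" by (simp add: algebra_simps)
  have K: "((\<lambda>t. \<integral>\<^sup>+l. ennreal (k t l) \<partial>\<mu>) \<longlongrightarrow> kernel_int 1) at_top"
  proof (rule tendsto_at_topI_sequentially)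
    fix X :: "nat \<Rightarrow> real" assume X: "filterlim X at_top sequentially"
    \<comment> \<open>The integrand is bounded by its limit 1 for arguments at least 1, so the
      sequence is truncated from below; this changes only finitely many terms.\<close>
    have ev: "\<forall>\<^sub>F n in sequentially. max 1 (X n) = X n"
      using filterlim_at_top[THEN iffD1, OF X, rule_format, of 1] by eventually_elim simp
    have X': "filterlim (\<lambda>n. max 1 (X n)) at_top sequentially"
      by (rule filterlim_at_top_mono[OF X]) simp
    have "(\<lambda>n. \<integral>\<^sup>+l. ennreal (k (max 1 (X n)) l) \<partial>\<mu>) \<longlonglongrightarrow> (\<integral>\<^sup>+l. 1 \<partial>\<mu>)"
    proof (rule nn_integral_tendsto_of_le)
      show "(\<lambda>l. ennreal (k (max 1 (X n)) l)) \<in> borel_measurable \<mu>" for n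
        unfolding k_def by measurable
      fix l assume "l \<in> space \<mu>"
      hence l: "0 < l" by (simp add: space_\<mu>)
      show "ennreal (k (max 1 (X n)) l) \<le> 1" for n
      proof -
        define t where "t = max 1 (X n)"
        have t: "1 \<le> t" by (simp add: t_def)
        have "(1 - inverse t)\<^sup>2 \<le> 1" using t by (intro power_le_one) (auto simp: inverse_le_1_iff)
        moreover have "inverse (1 + l * inverse t) \<le> 1" using t l by (simp add: inverse_le_1_iff)
        ultimately have "k t l \<le> 1 * 1" unfolding k_def using t l by (intro mult_mono) auto
        thus ?thesis by (simp add: t_def)
      qed
      have inv: "(\<lambda>n. inverse (max 1 (X n))) \<longlonglongrightarrow> 0"
        by (rule tendsto_inverse_0_at_top[OF X'])
      have "(\<lambda>n. k (max 1 (X n)) l) \<longlonglongrightarrow> (1 - 0)\<^sup>2 * inverse (1 + l * 0)"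
        unfolding k_def by (intro tendsto_intros inv) simp
      hence "(\<lambda>n. ennreal (k (max 1 (X n)) l)) \<longlonglongrightarrow> ennreal 1" by (intro tendsto_ennrealI) simp
      thus "(\<lambda>n. ennreal (k (max 1 (X n)) l)) \<longlonglongrightarrow> 1" by simp
    qed
    moreover have "\<forall>\<^sub>F n in sequentially. (\<integral>\<^sup>+l. ennreal (k (max 1 (X n)) l) \<partial>\<mu>) = (\<integral>\<^sup>+l. ennreal (k (X n) l) \<partial>\<mu>)"
      using ev by eventually_elim simp
    ultimately have "(\<lambda>n. \<integral>\<^sup>+l. ennreal (k (X n) l) \<partial>\<mu>) \<longlonglongrightarrow> (\<integral>\<^sup>+l. 1 \<partial>\<mu>)"
      by (rule Lim_transform_eventually)
    thus "(\<lambda>n. \<integral>\<^sup>+l. ennreal (k (X n) l) \<partial>\<mu>) \<longlonglongrightarrow> kernel_int 1" by (simp add: kernel_int_def)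
  qed
  have "((\<lambda>t. ennreal (c * t) + (\<integral>\<^sup>+l. ennreal (k t l) \<partial>\<mu>)) \<longlongrightarrow> ennreal c * \<infinity> + kernel_int 1) at_top"
    by (intro tendsto_add K tendsto_ennreal_mult_top filterlim_ident c)
  hence "((\<lambda>t. enn2ereal (ennreal (c * t) + (\<integral>\<^sup>+l. ennreal (k t l) \<partial>\<mu>)))
      \<longlongrightarrow> enn2ereal (ennreal c * \<infinity> + kernel_int 1)) at_top"
    by (simp only: tendsto_enn2ereal_iff)
  from tendsto_add_ereal_nonneg[OF _ _ \<alpha> this]
  have "((\<lambda>t. ereal (\<alpha> t) + enn2ereal (ennreal (c * t) + (\<integral>\<^sup>+l. ennreal (k t l) \<partial>\<mu>)))
      \<longlongrightarrow> ereal (b - 2 * c + d) + enn2ereal (ennreal c * \<infinity> + kernel_int 1)) at_top" by simp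
  moreover have "\<forall>\<^sub>F t in at_top. ereal (\<alpha> t) + enn2ereal (ennreal (c * t) + (\<integral>\<^sup>+l. ennreal (k t l) \<partial>\<mu>)) = ereal (f t / t)"
    using eventually_gt_at_top[of 0]
  proof eventually_elim
    case (elim t)
    define K where "K = (\<integral>l. (t - 1)^2 / (t + l) \<partial>\<mu>)"
    have K0: "0 \<le> K" unfolding K_def using elim by (intro integral_nonneg_AE AE_I2) (simp add: space_\<mu>)
    have "k t l = inverse t * ((t - 1)\<^sup>2 / (t + l))" if "0 < l" for l
    proof -
      have "1 - inverse t = (t - 1) / t" "inverse (1 + l * inverse t) = t / (t + l)"
        using elim that by (simp_all add: field_simps)
      thus ?thesis
        using elim that by (simp add: k_def power_divide power2_eq_square inverse_eq_divide)
    qed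
    hence "(\<integral>\<^sup>+l. ennreal (k t l) \<partial>\<mu>) = (\<integral>\<^sup>+l. ennreal (inverse t) * ennreal ((t - 1)\<^sup>2 / (t + l)) \<partial>\<mu>)"
      using elim by (intro nn_integral_cong) (simp add: space_\<mu> ennreal_mult'[symmetric])
    also have "\<dots> = ennreal (inverse t * K)"
      using elim by (subst nn_integral_cmult) (simp_all add: integral_kernel(2) K_def ennreal_mult')
    finally have 1: "(\<integral>\<^sup>+l. ennreal (k t l) \<partial>\<mu>) = ennreal (inverse t * K)" .
    have "f t / t = \<alpha> t + (c * t + inverse t * K)"
      unfolding f[OF elim] K_def[symmetric] \<alpha>_def using elim by (simp add: field_simps power2_eq_square)
    thus ?case
      unfolding 1 using elim c K0 by (simp add: ennreal_plus[symmetric] enn2ereal_ennreal del: ennreal_plus)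
  qed
  ultimately show ?thesis by (rule Lim_transform_eventually)
qed

text \<open>As for the slope, but now the term with \<open>d\<close> blows up:
  \<open>(t - 1)^2 / t = t - 2 + 1 / t\<close> puts \<open>-2 d\<close> into the finite part. The
  kernel is at most \<open>1 / l\<close> for \<open>t\<close> in (0,1) and tends to it.\<close>

lemma tendsto_value:
  "((\<lambda>t. ereal (f t)) \<longlongrightarrow> ereal (a - b + c - 2 * d) + enn2ereal (ennreal d * \<infinity> + kernel_int 0)) (at_right 0)"
proof -
  define \<alpha> where "\<alpha> t = a + b * (t - 1) + c * (t - 1)\<^sup>2 + d * t - 2 * d" for t
  define k where "k t l = (t - 1)\<^sup>2 / (t + l)" for t l :: real
  have "(\<alpha> \<longlongrightarrow> a + b * (0 - 1) + c * (0 - 1)\<^sup>2 + d * 0 - 2 * d) (at_right 0)"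
    unfolding \<alpha>_def[abs_def] by (intro tendsto_intros)
  hence \<alpha>: "((\<lambda>t. ereal (\<alpha> t)) \<longlongrightarrow> ereal (a - b + c - 2 * d)) (at_right 0)" by simp
  have K: "((\<lambda>t. \<integral>\<^sup>+l. ennreal (k t l) \<partial>\<mu>) \<longlongrightarrow> kernel_int 0) (at_right 0)"
  proof (rule tendsto_at_right_sequentially[of 0 1])
    fix S :: "nat \<Rightarrow> real" assume S: "\<And>n. 0 < S n" "\<And>n. S n < 1" "S \<longlonglongrightarrow> 0"
    have "(\<lambda>n. \<integral>\<^sup>+l. ennreal (k (S n) l) \<partial>\<mu>) \<longlonglongrightarrow> (\<integral>\<^sup>+l. ennreal (1 / l) \<partial>\<mu>)"
    proof (rule nn_integral_tendsto_of_le)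
      show "(\<lambda>l. ennreal (k (S n) l)) \<in> borel_measurable \<mu>" for n
        unfolding k_def by measurable
      fix l assume "l \<in> space \<mu>"
      hence l: "0 < l" by (simp add: space_\<mu>)
      show "ennreal (k (S n) l) \<le> ennreal (1 / l)" for n
      proof (rule ennreal_leI)
        have "(S n - 1)\<^sup>2 \<le> 1" using S(1,2)[of n] by (simp add: power2_le_iff_abs_le abs_le_square_iff[of _ 1, simplified, symmetric])
        thus "k (S n) l \<le> 1 / l" unfolding k_def using S(1)[of n] l by (intro frac_le) auto
      qed
      have "(\<lambda>n. k (S n) l) \<longlonglongrightarrow> (0 - 1)\<^sup>2 / (0 + l)"
        unfolding k_def using l by (intro tendsto_intros S(3)) simp
      thus "(\<lambda>n. ennreal (k (S n) l)) \<longlonglongrightarrow> ennreal (1 / l)" by (intro tendsto_ennrealI) simp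
    qed
    thus "(\<lambda>n. \<integral>\<^sup>+l. ennreal (k (S n) l) \<partial>\<mu>) \<longlonglongrightarrow> kernel_int 0" by (simp add: kernel_int_def)
  qed simp
  have "((\<lambda>t. ennreal (d * inverse t) + (\<integral>\<^sup>+l. ennreal (k t l) \<partial>\<mu>)) \<longlongrightarrow> ennreal d * \<infinity> + kernel_int 0) (at_right 0)"
    by (intro tendsto_add K tendsto_ennreal_mult_top filterlim_inverse_at_top_right d)
  hence "((\<lambda>t. enn2ereal (ennreal (d * inverse t) + (\<integral>\<^sup>+l. ennreal (k t l) \<partial>\<mu>)))
      \<longlongrightarrow> enn2ereal (ennreal d * \<infinity> + kernel_int 0)) (at_right 0)"
    by (simp only: tendsto_enn2ereal_iff)
  from tendsto_add_ereal_nonneg[OF _ _ \<alpha> this]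
  have "((\<lambda>t. ereal (\<alpha> t) + enn2ereal (ennreal (d * inverse t) + (\<integral>\<^sup>+l. ennreal (k t l) \<partial>\<mu>)))
      \<longlongrightarrow> ereal (a - b + c - 2 * d) + enn2ereal (ennreal d * \<infinity> + kernel_int 0)) (at_right 0)" by simp
  moreover have "\<forall>\<^sub>F t in at_right 0. ereal (\<alpha> t) + enn2ereal (ennreal (d * inverse t) + (\<integral>\<^sup>+l. ennreal (k t l) \<partial>\<mu>)) = ereal (f t)"
    using eventually_at_right_less
  proof eventually_elim
    case (elim t)
    define K where "K = (\<integral>l. (t - 1)^2 / (t + l) \<partial>\<mu>)"
    have K0: "0 \<le> K" unfolding K_def using elim by (intro integral_nonneg_AE AE_I2) (simp add: space_\<mu>)
    have 1: "(\<integral>\<^sup>+l. ennreal (k t l) \<partial>\<mu>) = ennreal K"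
      unfolding k_def K_def by (rule integral_kernel(2)[OF elim])
    have sq: "(t - 1)\<^sup>2 / t = t - 2 + inverse t" using elim by (simp add: field_simps power2_eq_square)
    have "f t = \<alpha> t + (d * inverse t + K)"
      unfolding f[OF elim] K_def[symmetric] \<alpha>_def sq by (simp add: algebra_simps)
    thus ?case
      unfolding 1 using elim d K0 by (simp add: ennreal_plus[symmetric] enn2ereal_ennreal del: ennreal_plus)
  qed
  ultimately show ?thesis by (rule Lim_transform_eventually)
qed

text \<open>At the ends the left side is a limit of \<open>f\<close>, and \<open>persp_sq\<close>
  and \<open>kernel_int\<close> take the matching, possibly infinite, values there.\<close>

lemma persp_eq:
  assumes r: "r \<in> {0..1}"
  shows "persp f r (1 - r) = ereal ((b - 2 * c + d) * r + (a - b + c - 2 * d) * (1 - r))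
    + enn2ereal (ennreal c * persp_sq r + ennreal d * persp_sq (1 - r) + kernel_int r)"
proof -
  consider "r = 0" | "r = 1" | "0 < r" "r < 1" using r by fastforce
  thus ?thesis
  proof cases
    case 1
    have "value_at_0 f = ereal (a - b + c - 2 * d) + enn2ereal (ennreal d * \<infinity> + kernel_int 0)"
      unfolding value_at_0_def by (rule tendsto_Lim[OF _ tendsto_value]) simp
    thus ?thesis using 1 by (simp add: persp_def persp_sq_def one_ereal_def[symmetric])
  next
    case 2
    have "slope_at_infinity f = ereal (b - 2 * c + d) + enn2ereal (ennreal c * \<infinity> + kernel_int 1)"
      unfolding slope_at_infinity_def by (rule tendsto_Lim[OF _ tendsto_slope]) simp
    thus ?thesis using 2 by (simp add: persp_def persp_sq_def one_ereal_def[symmetric])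
  qed (rule persp_interior)
qed

end

section \<open>The integral representation\<close>

context
  fixes A B :: "'a::complex_hilbert_space \<Rightarrow> 'a" and \<rho> :: "('a \<Rightarrow> 'a) \<Rightarrow> complex"
  assumes A: "positive_op A" and B: "positive_op B" and \<rho>: "positive_normal \<rho>"
begin

lemma space_pair: "space (pair_measure_of A B \<rho>) = {0..1}"
  using sets_eq_imp_space_eq[OF sets_pair_measure_of[OF A B \<rho>]] by (simp add: space_restrict_space)

lemma id_pair [measurable]: "(\<lambda>r. r) \<in> borel_measurable (pair_measure_of A B \<rho>)"
  unfolding measurable_cong_sets[OF sets_pair_measure_of[OF A B \<rho>] refl]
  by (intro measurable_restrict_space1) simp

lemma finite_pair: "finite_measure (pair_measure_of A B \<rho>)"
proof (rule finite_measureI)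
  let ?N = "pair_measure_of A B \<rho>"
  have "emeasure ?N (space ?N) = (\<integral>\<^sup>+r. 1 \<partial>?N)" by simp
  also have "\<dots> = (\<integral>\<^sup>+r. ennreal r + ennreal (1 - r) \<partial>?N)"
    by (intro nn_integral_cong) (simp add: space_pair ennreal_plus[symmetric] del: ennreal_plus)
  also have "\<dots> = (\<integral>\<^sup>+r. ennreal r \<partial>?N) + (\<integral>\<^sup>+r. ennreal (1 - r) \<partial>?N)"
    by (rule nn_integral_add) measurable
  also have "\<dots> \<noteq> \<infinity>"
    by (simp add: nn_integral_pair_A[OF A B \<rho>] nn_integral_pair_B[OF A B \<rho>])
  finally show "emeasure ?N (space ?N) \<noteq> \<infinity>" .
qed

lemma integral_pair_affine:
  shows "integrable (pair_measure_of A B \<rho>) (\<lambda>r. x * r + y * (1 - r))"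
    and "(\<integral>r. x * r + y * (1 - r) \<partial>pair_measure_of A B \<rho>) = x * Re (\<rho> A) + y * Re (\<rho> B)"
proof -
  let ?N = "pair_measure_of A B \<rho>"
  have "has_bochner_integral ?N (\<lambda>r. r) (Re (\<rho> A))"
    by (rule has_bochner_integral_nn_integral)
       (auto simp: space_pair positive_normal_nonneg[OF \<rho> A] nn_integral_pair_A[OF A B \<rho>] id_pair)
  moreover have "has_bochner_integral ?N (\<lambda>r. 1 - r) (Re (\<rho> B))"
    by (rule has_bochner_integral_nn_integral)
       (auto simp: space_pair positive_normal_nonneg[OF \<rho> B] nn_integral_pair_B[OF A B \<rho>] id_pair)
  ultimately have "has_bochner_integral ?N (\<lambda>r. x * r + y * (1 - r)) (x * Re (\<rho> A) + y * Re (\<rho> B))"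
    by (intro has_bochner_integral_add has_bochner_integral_mult_right)
  thus "integrable ?N (\<lambda>r. x * r + y * (1 - r))"
    "(\<integral>r. x * r + y * (1 - r) \<partial>?N) = x * Re (\<rho> A) + y * Re (\<rho> B)"
    by (auto simp: has_bochner_integral_iff)
qed

lemma nn_integral_pair_affine:
  assumes "0 \<le> x" "0 \<le> y"
  shows "(\<integral>\<^sup>+r. ennreal (x * r + y * (1 - r)) \<partial>pair_measure_of A B \<rho>) = ennreal (x * Re (\<rho> A) + y * Re (\<rho> B))"
  by (subst nn_integral_eq_integral[OF integral_pair_affine(1)])
     (use assms in \<open>auto simp: integral_pair_affine(2) space_pair intro!: AE_I2\<close>)

text \<open>The kernel of the parallel sum is kept on the side of \<open>g\<close>, so that only
  nonnegative functions are integrated; the subtraction takes place afterwards among real numbers.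
  Both the kernel integrated against \<open>\<mu>\<close> and the approximants of the perspective of
  \<open>t^2\<close> have this shape.\<close>

lemma nn_integral_pair_combination:
  assumes xy: "0 \<le> x" "0 \<le> y" "0 \<le> z" and l: "0 < l" and g: "g \<in> borel_measurable (pair_measure_of A B \<rho>)"
    and g0: "\<And>r. r \<in> {0..1} \<Longrightarrow> 0 \<le> g r"
    and eq: "\<And>r. r \<in> {0..1} \<Longrightarrow> g r + z * (l * r * (1 - r) / (r + l * (1 - r))) = x * r + y * (1 - r)"
  defines "v \<equiv> x * Re (\<rho> A) + y * Re (\<rho> B) - z * Re (\<rho> (parallel_sum A (\<lambda>x. l *\<^sub>R B x)))"
  shows "(\<integral>\<^sup>+r. ennreal (g r) \<partial>pair_measure_of A B \<rho>) = ennreal v" and "0 \<le> v"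
proof -
  let ?N = "pair_measure_of A B \<rho>"
  define h where "h r = l * r * (1 - r) / (r + l * (1 - r))" for r
  have h0: "0 \<le> h r" if "r \<in> {0..1}" for r
    unfolding h_def using that l by (intro divide_nonneg_nonneg mult_nonneg_nonneg add_nonneg_nonneg) auto
  have hm: "h \<in> borel_measurable ?N" unfolding h_def[abs_def] by measurable
  define p where "p = Re (\<rho> (parallel_sum A (\<lambda>x. l *\<^sub>R B x)))"
  have p0: "0 \<le> p" unfolding p_def by (intro positive_normal_nonneg[OF \<rho>] positive_parallel_sum A B l)
  have "(\<integral>\<^sup>+r. ennreal (g r) \<partial>?N) + ennreal (z * p) = (\<integral>\<^sup>+r. ennreal (g r) \<partial>?N) + ennreal z * (\<integral>\<^sup>+r. ennreal (h r) \<partial>?N)"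
    using xy by (simp add: h_def nn_integral_pair_parallel[OF A B \<rho> l] p_def ennreal_mult')
  also have "\<dots> = (\<integral>\<^sup>+r. ennreal (g r) + ennreal z * ennreal (h r) \<partial>?N)"
    using g hm by (simp add: nn_integral_add nn_integral_cmult)
  also have "\<dots> = (\<integral>\<^sup>+r. ennreal (x * r + y * (1 - r)) \<partial>?N)"
  proof (rule nn_integral_cong)
    fix r assume "r \<in> space ?N"
    hence r: "r \<in> {0..1}" by (simp add: space_pair)
    have "ennreal (g r) + ennreal z * ennreal (h r) = ennreal (g r + z * h r)"
      using xy g0[OF r] h0[OF r] by (simp add: ennreal_mult'[symmetric] ennreal_plus[symmetric] del: ennreal_plus)
    thus "ennreal (g r) + ennreal z * ennreal (h r) = ennreal (x * r + y * (1 - r))"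
      using eq[OF r] by (simp add: h_def)
  qed
  also have "\<dots> = ennreal (x * Re (\<rho> A) + y * Re (\<rho> B))" by (rule nn_integral_pair_affine[OF xy(1,2)])
  finally have "(\<integral>\<^sup>+r. ennreal (g r) \<partial>?N) + ennreal (z * p) = ennreal (x * Re (\<rho> A) + y * Re (\<rho> B))" .
  from ennreal_add_eqD[OF this] xy p0 positive_normal_nonneg[OF \<rho> A] positive_normal_nonneg[OF \<rho> B]
  show "(\<integral>\<^sup>+r. ennreal (g r) \<partial>?N) = ennreal v" "0 \<le> v" by (simp_all add: v_def p_def)
qed

lemma op_persp_eq: "op_persp g A B \<rho> = ereal_integral (pair_measure_of A B \<rho>) (\<lambda>r. persp g r (1 - r))"
  by (simp add: op_persp_def pair_measure_of_def)

lemma op_persp_square: "op_persp (\<lambda>t. t\<^sup>2) A B \<rho> = enn2ereal (\<integral>\<^sup>+r. persp_sq r \<partial>pair_measure_of A B \<rho>)"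
  unfolding op_persp_eq ereal_integral_nonneg[symmetric]
  by (rule ereal_integral_cong) (simp add: space_pair persp_square)

end

text \<open>The approximants \<open>r\<^sup>2 / (r / n + (1 - r))\<close> of the perspective of \<open>t\<^sup>2\<close> are \<open>n\<close> times the
  difference of \<open>r\<close> and the kernel of the parallel sum with parameter \<open>n\<close>.\<close>

definition persp_sq_approx :: "nat \<Rightarrow> real \<Rightarrow> real" where
  "persp_sq_approx n r = r\<^sup>2 / (r / real (Suc n) + (1 - r))"

lemma persp_sq_approx_nonneg: "r \<in> {0..1} \<Longrightarrow> 0 \<le> persp_sq_approx n r"
  unfolding persp_sq_approx_def by (intro divide_nonneg_nonneg add_nonneg_nonneg) auto

lemma persp_sq_approx_mono: "r \<in> {0..1} \<Longrightarrow> ennreal (persp_sq_approx n r) \<le> ennreal (persp_sq_approx (Suc n) r)"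
proof (cases "r = 0")
  case False
  assume "r \<in> {0..1}"
  hence r: "0 < r" "r \<le> 1" using False by auto
  have le: "r / real (Suc (Suc n)) \<le> r / real (Suc n)" using r by (intro divide_left_mono) auto
  have pos: "0 < r / real (Suc (Suc n)) + (1 - r)" using r by (intro add_pos_nonneg) auto
  show ?thesis unfolding persp_sq_approx_def
    by (intro ennreal_leI divide_left_mono add_mono le order_refl mult_pos_pos pos
        less_le_trans[OF pos add_right_mono[OF le]]) simp
qed (simp add: persp_sq_approx_def)

lemma persp_sq_approx_SUP:
  assumes "r \<in> {0..1}"
  shows "(SUP n. ennreal (persp_sq_approx n r)) = persp_sq r"
proof (rule LIMSEQ_unique)
  have "incseq (\<lambda>n. ennreal (persp_sq_approx n r))"
    by (rule incseq_SucI) (rule persp_sq_approx_mono[OF assms])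
  thus "(\<lambda>n. ennreal (persp_sq_approx n r)) \<longlonglongrightarrow> (SUP n. ennreal (persp_sq_approx n r))"
    by (rule LIMSEQ_SUP)
  show "(\<lambda>n. ennreal (persp_sq_approx n r)) \<longlonglongrightarrow> persp_sq r"
  proof (cases "r = 1")
    case True
    have "filterlim (\<lambda>n. real (Suc n)) at_top sequentially"
      by (rule filterlim_compose[OF filterlim_real_sequentially filterlim_Suc])
    hence "(\<lambda>n. ennreal (real (Suc n))) \<longlonglongrightarrow> \<infinity>"
      by (simp only: infinity_ennreal_def ennreal_tendsto_top_eq_at_top)
    thus ?thesis using True by (simp add: persp_sq_approx_def persp_sq_def)
  next
    case False
    have "(\<lambda>n. r / real (Suc n)) \<longlonglongrightarrow> 0"
      by (rule LIMSEQ_Suc[OF lim_const_over_n])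
    hence "(\<lambda>n. persp_sq_approx n r) \<longlonglongrightarrow> r\<^sup>2 / (0 + (1 - r))"
      unfolding persp_sq_approx_def using False by (intro tendsto_intros) auto
    hence "(\<lambda>n. ennreal (persp_sq_approx n r)) \<longlonglongrightarrow> ennreal (r\<^sup>2 / (1 - r))"
      by (intro tendsto_ennrealI) simp
    thus ?thesis using False by (simp add: persp_sq_def)
  qed
qed

text \<open>With \<open>l = Suc n\<close> the two approximants integrate to
  \<open>l \<rho>(B) - l \<rho>(B : l A)\<close> and
  \<open>l \<rho>(B) - l^2 \<rho>(A : B / l)\<close>. These agree since
  \<open>\<rho>(B : l A)\<close> is \<open>l\<close> times \<open>\<rho>(A : B / l)\<close>, and
  monotone convergence carries the equality to the limit.\<close>

lemma op_persp_square_swap: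
  fixes A B :: "'a::complex_hilbert_space \<Rightarrow> 'a"
  assumes A: "positive_op A" and B: "positive_op B" and \<rho>: "positive_normal \<rho>"
  shows "op_persp (\<lambda>t. t\<^sup>2) B A \<rho> = enn2ereal (\<integral>\<^sup>+r. persp_sq (1 - r) \<partial>pair_measure_of A B \<rho>)"
proof -
  let ?N = "pair_measure_of A B \<rho>" and ?N' = "pair_measure_of B A \<rho>"
  note [measurable] = id_pair[OF A B \<rho>] id_pair[OF B A \<rho>]
  have eq: "(\<integral>\<^sup>+r. ennreal (persp_sq_approx n r) \<partial>?N') = (\<integral>\<^sup>+r. ennreal (persp_sq_approx n (1 - r)) \<partial>?N)" for n
  proof -
    define l where "l = real (Suc n)"
    have l: "0 < l" "0 < 1 / l" by (auto simp: l_def)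
    have P: "persp_sq_approx n r = r\<^sup>2 / (r / l + (1 - r))" for r by (simp add: persp_sq_approx_def l_def)
    have 1: "(\<integral>\<^sup>+r. ennreal (persp_sq_approx n r) \<partial>?N')
        = ennreal (l * Re (\<rho> B) + 0 * Re (\<rho> A) - l * Re (\<rho> (parallel_sum B (\<lambda>x. l *\<^sub>R A x))))"
    proof (rule nn_integral_pair_combination(1)[OF B A \<rho> _ _ _ l(1)])
      show "persp_sq_approx n \<in> borel_measurable ?N'" unfolding persp_sq_approx_def[abs_def] by measurable
      fix r :: real assume r: "r \<in> {0..1}"
      have D: "0 < r + l * (1 - r)"
        using r l by (cases "r = 0") (auto intro!: add_pos_nonneg)
      have "r / l + (1 - r) = (r + l * (1 - r)) / l" using l by (simp add: field_simps)
      hence "persp_sq_approx n r = l * r\<^sup>2 / (r + l * (1 - r))" by (simp add: P)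
      moreover have "l * r\<^sup>2 / (r + l * (1 - r)) + l * (l * r * (1 - r) / (r + l * (1 - r)))
          = l * r * (r + l * (1 - r)) / (r + l * (1 - r))"
      proof -
        have "l * r\<^sup>2 + l * (l * r * (1 - r)) = l * r * (r + l * (1 - r))"
          by (simp add: power2_eq_square algebra_simps)
        thus ?thesis by (simp only: times_divide_eq_right add_divide_distrib[symmetric])
      qed
      ultimately show "persp_sq_approx n r + l * (l * r * (1 - r) / (r + l * (1 - r))) = l * r + 0 * (1 - r)"
        using D by simp
    qed (use l persp_sq_approx_nonneg in auto)
    \<comment> \<open>Passing from \<open>r\<close> to \<open>1 - r\<close> turns the parameter
      \<open>l\<close> of the kernel into \<open>1 / l\<close> and its coefficient \<open>l\<close>
      into \<open>l^2\<close>.\<close>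
    have 2: "(\<integral>\<^sup>+r. ennreal (persp_sq_approx n (1 - r)) \<partial>?N)
        = ennreal (0 * Re (\<rho> A) + l * Re (\<rho> B) - l\<^sup>2 * Re (\<rho> (parallel_sum A (\<lambda>x. (1 / l) *\<^sub>R B x))))"
    proof (rule nn_integral_pair_combination(1)[OF A B \<rho> _ _ _ l(2)])
      show "(\<lambda>r. persp_sq_approx n (1 - r)) \<in> borel_measurable ?N" unfolding persp_sq_approx_def[abs_def] by measurable
      fix r :: real assume r: "r \<in> {0..1}"
      have D: "0 < r + 1 / l * (1 - r)"
        using r l by (cases "r = 0") (auto intro!: add_pos_nonneg)
      have "persp_sq_approx n (1 - r) = (1 - r)\<^sup>2 / (r + 1 / l * (1 - r))" by (simp add: P add.commute)
      moreover have "(1 - r)\<^sup>2 / (r + 1 / l * (1 - r)) + l\<^sup>2 * (1 / l * r * (1 - r) / (r + 1 / l * (1 - r)))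
          = l * (1 - r) * (r + 1 / l * (1 - r)) / (r + 1 / l * (1 - r))"
      proof -
        have "(1 - r)\<^sup>2 + l\<^sup>2 * (1 / l * r * (1 - r)) = l * (1 - r) * (r + 1 / l * (1 - r))"
          using l by (simp add: power2_eq_square field_simps)
        thus ?thesis by (simp only: times_divide_eq_right add_divide_distrib[symmetric])
      qed
      ultimately show "persp_sq_approx n (1 - r) + l\<^sup>2 * (1 / l * r * (1 - r) / (r + 1 / l * (1 - r))) = 0 * r + l * (1 - r)"
        using D by simp
    qed (use l persp_sq_approx_nonneg in auto)
    show ?thesis unfolding 1 2 positive_normal_parallel_swap[OF A B \<rho> l(1)]
      by (simp add: power2_eq_square mult.assoc)
  qed
  have "(\<integral>\<^sup>+r. persp_sq r \<partial>?N') = (\<integral>\<^sup>+r. (SUP n. ennreal (persp_sq_approx n r)) \<partial>?N')"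
    by (rule nn_integral_cong) (simp add: space_pair[OF B A \<rho>] persp_sq_approx_SUP)
  also have "\<dots> = (SUP n. \<integral>\<^sup>+r. ennreal (persp_sq_approx n r) \<partial>?N')"
  proof (rule nn_integral_monotone_convergence_SUP_AE)
    show "AE r in ?N'. ennreal (persp_sq_approx n r) \<le> ennreal (persp_sq_approx (Suc n) r)" for n
      by (rule AE_I2, rule persp_sq_approx_mono) (simp add: space_pair[OF B A \<rho>])
    show "(\<lambda>r. ennreal (persp_sq_approx n r)) \<in> borel_measurable ?N'" for n
      unfolding persp_sq_approx_def by measurable
  qed
  also have "\<dots> = (SUP n. \<integral>\<^sup>+r. ennreal (persp_sq_approx n (1 - r)) \<partial>?N)" by (simp only: eq)
  also have "\<dots> = (\<integral>\<^sup>+r. (SUP n. ennreal (persp_sq_approx n (1 - r))) \<partial>?N)"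
  proof (rule nn_integral_monotone_convergence_SUP_AE[symmetric])
    show "AE r in ?N. ennreal (persp_sq_approx n (1 - r)) \<le> ennreal (persp_sq_approx (Suc n) (1 - r))" for n
      by (rule AE_I2, rule persp_sq_approx_mono) (simp add: space_pair[OF A B \<rho>])
    show "(\<lambda>r. ennreal (persp_sq_approx n (1 - r))) \<in> borel_measurable ?N" for n
      unfolding persp_sq_approx_def by measurable
  qed
  also have "\<dots> = (\<integral>\<^sup>+r. persp_sq (1 - r) \<partial>?N)"
    by (rule nn_integral_cong) (simp add: space_pair[OF A B \<rho>] persp_sq_approx_SUP)
  finally show ?thesis by (simp add: op_persp_square[OF B A \<rho>])
qed

theorem theorem9p1:
  fixes f :: "real \<Rightarrow> real" and a b c d a\<^sub>0 b\<^sub>0 :: real and \<mu> :: "real measure"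
    and A B :: "'a::complex_hilbert_space \<Rightarrow> 'a" and \<rho> :: "('a \<Rightarrow> 'a) \<Rightarrow> complex"
  assumes "operator_convex f"
    and "0 \<le> c" and "0 \<le> d"
    and "sets \<mu> = sets (restrict_space borel {0<..})"
    and "integrable \<mu> (\<lambda>l. 1 / (1 + l))"
    and "\<And>t. 0 < t \<Longrightarrow> f t = a + b * (t - 1) + c * (t - 1)^2 + d * ((t - 1)^2 / t)
           + (\<integral>l. (t - 1)^2 / (t + l) \<partial>\<mu>)"
    and "a\<^sub>0 = b - 2 * c + d" and "b\<^sub>0 = a - b + c - 2 * d"
    and "positive_op A" and "positive_op B" and "positive_normal \<rho>"
  shows "op_persp f A B \<rho> =
      ereal (a\<^sub>0 * Re (\<rho> A) + b\<^sub>0 * Re (\<rho> B))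
      + ereal c * op_persp (\<lambda>t. t^2) A B \<rho> + ereal d * op_persp (\<lambda>t. t^2) B A \<rho>
      + ereal_integral \<mu> (\<lambda>l. ereal (Re (\<rho> A) + 1 / l * Re (\<rho> B)
          - ((1 + l) / l)^2 * Re (\<rho> (parallel_sum A (\<lambda>x. l *\<^sub>R B x)))))"
proof -
  interpret convex_representation f a b c d \<mu>
    by unfold_locales (use assms in auto)
  note pos = assms(9-11)
  let ?N = "pair_measure_of A B \<rho>"
  define g where "g l r = (2 * r - 1)\<^sup>2 / (r + l * (1 - r))" for l r :: real
  define v where "v l = Re (\<rho> A) + 1 / l * Re (\<rho> B) - ((1 + l) / l)^2 * Re (\<rho> (parallel_sum A (\<lambda>x. l *\<^sub>R B x)))" for l
  note [measurable] = id_pair[OF pos]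
  have v: "(\<integral>\<^sup>+r. ennreal (g l r) \<partial>?N) = ennreal (v l)" "0 \<le> v l" if l: "0 < l" for l
  proof -
    have gm: "(\<lambda>r. g l r) \<in> borel_measurable ?N" unfolding g_def by measurable
    have g0: "0 \<le> g l r" if "r \<in> {0..1}" for r
      unfolding g_def using that l by (intro divide_nonneg_nonneg add_nonneg_nonneg) auto
    have geq: "g l r + ((1 + l) / l)\<^sup>2 * (l * r * (1 - r) / (r + l * (1 - r))) = 1 * r + 1 / l * (1 - r)"
      if r: "r \<in> {0..1}" for r
    proof -
      have D: "0 < r + l * (1 - r)"
        using r l by (cases "r = 0") (auto intro!: add_pos_nonneg)
      have "(2 * r - 1)\<^sup>2 + ((1 + l) / l)\<^sup>2 * (l * r * (1 - r)) = (1 * r + 1 / l * (1 - r)) * (r + l * (1 - r))"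
        using l by (simp add: power2_eq_square field_simps)
      hence "g l r + ((1 + l) / l)\<^sup>2 * (l * r * (1 - r) / (r + l * (1 - r)))
          = (1 * r + 1 / l * (1 - r)) * (r + l * (1 - r)) / (r + l * (1 - r))"
        by (simp only: g_def times_divide_eq_right add_divide_distrib[symmetric])
      thus ?thesis using D by simp
    qed
    show "(\<integral>\<^sup>+r. ennreal (g l r) \<partial>?N) = ennreal (v l)" "0 \<le> v l"
      using nn_integral_pair_combination[OF pos _ _ _ l gm g0 geq] l by (simp_all add: v_def)
  qed
  interpret S: sigma_finite_measure \<mu> by (rule sigma_finite_\<mu>)
  have m1: "(\<lambda>p. fst p) \<in> borel_measurable (?N \<Otimes>\<^sub>M \<mu>)" and m2: "(\<lambda>p. snd p) \<in> borel_measurable (?N \<Otimes>\<^sub>M \<mu>)"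
    by (rule measurable_compose[OF measurable_fst id_pair[OF pos]] measurable_compose[OF measurable_snd id_\<mu>])+
  have "(\<lambda>p. ennreal (g (snd p) (fst p))) \<in> borel_measurable (?N \<Otimes>\<^sub>M \<mu>)"
    unfolding g_def using m1 m2 by (intro measurable_compose[OF _ measurable_ennreal] borel_measurable_divide
      borel_measurable_power borel_measurable_diff borel_measurable_add borel_measurable_times borel_measurable_const)
  hence gm: "case_prod (\<lambda>r l. ennreal (g l r)) \<in> borel_measurable (?N \<Otimes>\<^sub>M \<mu>)"
    by (simp add: case_prod_unfold)
  \<comment> \<open>Since \<open>v l\<close> is nonnegative for \<open>l > 0\<close>, there is no
    negative part to subtract, and Tonelli's theorem exchanges the integrals even if they are
    infinite.\<close>
  have last: "ereal_integral \<mu> (\<lambda>l. ereal (v l)) = enn2ereal (\<integral>\<^sup>+r. kernel_int r \<partial>?N)"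
  proof -
    interpret finite_measure ?N by (rule finite_pair[OF pos])
    interpret P: pair_sigma_finite ?N \<mu> ..
    have "ereal_integral \<mu> (\<lambda>l. ereal (v l)) = ereal_integral \<mu> (\<lambda>l. enn2ereal (\<integral>\<^sup>+r. ennreal (g l r) \<partial>?N))"
      by (rule ereal_integral_cong) (simp add: space_\<mu> v enn2ereal_ennreal)
    also have "\<dots> = enn2ereal (\<integral>\<^sup>+l. (\<integral>\<^sup>+r. ennreal (g l r) \<partial>?N) \<partial>\<mu>)" by (rule ereal_integral_nonneg)
    also have "(\<integral>\<^sup>+l. (\<integral>\<^sup>+r. ennreal (g l r) \<partial>?N) \<partial>\<mu>) = (\<integral>\<^sup>+r. (\<integral>\<^sup>+l. ennreal (g l r) \<partial>\<mu>) \<partial>?N)"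
      by (rule P.Fubini'[OF gm])
    finally show ?thesis by (simp add: kernel_int_def g_def)
  qed
  have km: "kernel_int \<in> borel_measurable ?N"
    using S.borel_measurable_nn_integral[OF gm] by (simp add: kernel_int_def[abs_def] g_def)
  have sqm: "persp_sq \<in> borel_measurable ?N" "(\<lambda>r. persp_sq (1 - r)) \<in> borel_measurable ?N"
    by measurable
  \<comment> \<open>All possibly infinite terms are collected in \<open>H\<close> with nonnegative
    coefficients, so their integrals add without a clash of infinities.\<close>
  define H where "H r = ennreal c * persp_sq r + ennreal d * persp_sq (1 - r) + kernel_int r" for r
  have Hm: "H \<in> borel_measurable ?N" unfolding H_def[abs_def] using sqm km by measurable
  have H: "(\<integral>\<^sup>+r. H r \<partial>?N) = ennreal c * (\<integral>\<^sup>+r. persp_sq r \<partial>?N) + ennreal d * (\<integral>\<^sup>+r. persp_sq (1 - r) \<partial>?N)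
      + (\<integral>\<^sup>+r. kernel_int r \<partial>?N)"
    unfolding H_def using sqm km by (simp add: nn_integral_add nn_integral_cmult)
  have "op_persp f A B \<rho> = ereal_integral ?N (\<lambda>r. ereal (a\<^sub>0 * r + b\<^sub>0 * (1 - r)) + enn2ereal (H r))"
    unfolding op_persp_eq[OF pos]
    by (rule ereal_integral_cong) (simp add: space_pair[OF pos] persp_eq assms(7,8) H_def)
  also have "\<dots> = ereal (a\<^sub>0 * Re (\<rho> A) + b\<^sub>0 * Re (\<rho> B)) + enn2ereal (\<integral>\<^sup>+r. H r \<partial>?N)"
    by (subst ereal_integral_add_nonneg[OF integral_pair_affine(1)[OF pos] Hm])
       (simp only: integral_pair_affine(2)[OF pos])
  finally show ?thesis
    using assms(2,3) unfolding v_def[symmetric] last op_persp_square[OF pos] op_persp_square_swap[OF pos] H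
    by (simp add: plus_ennreal.rep_eq times_ennreal.rep_eq enn2ereal_ennreal add.assoc)
qed

end
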